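(* Let $\phi(x,t)=\frac1p t^p+\frac1q a(x)t^q$ with $1<p<q<\infty$ and $a:\mathbb{R}^n\to[0,\infty)$ measurable, and let $\phi\in\mathcal{A}$. There exist constants $s>1$ and $C>0$ such that for every ball $B\subset\mathbb{R}^n$ of radius $r_B$ and any $u\in W^{1,1}(B)$ with $\int_B\phi(x,|\nabla u|)\,dx\le1$ we have $$\frac{1}{|B|}\int_B\phi\left(x,\frac{|u-\langle u\rangle_B|}{r_B}\right)dx\le\left(\frac{1}{|B|}\int_B\phi^s\left(x,\frac{|u-\langle u\rangle_B|}{r_B}\right)dx\right)^{\frac1s}\le C\,\frac{1}{|B|}\int_B\phi(x,|\nabla u|)\,dx.$$ Moreover, if in addition $u\in W^{1,1}_0(B)$, then $$\frac{1}{|B|}\int_B\phi\left(x,\frac{|u|}{r_B}\right)dx\le\left(\frac{1}{|B|}\int_B\phi^s\left(x,\frac{|u|}{r_B}\right)dx\right)^{\frac1s}\le C\,\frac{1}{|B|}\int_B\phi(x,|\nabla u|)\,dx.$$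
   Context: $\phi^s(x,t)$ means $(\phi(x,t))^s$ and $\langle u\rangle_B=\frac{1}{|B|}\int_Bu\,dx$. Cubes have sides parallel to the coordinate axes. The conjugate function is $\phi^*(x,s)=\sup_{t\ge0}(st-\phi(x,t))$. For $\varphi\in\{\phi,\phi^*\}$, $\|f\|_\varphi=\inf\{\lambda>0:\int_{\mathbb{R}^n}\varphi(x,|f(x)|/\lambda)\,dx\le1\}$. We write $\phi\in\mathcal{A}$ if $$[\phi]_{\mathcal{A}}:=\sup_Q\frac{\|\mathbf{1}_Q\|_\phi\|\mathbf{1}_Q\|_{\phi^*}}{|Q|}<\infty,$$ the supremum being over all cubes $Q\subset\mathbb{R}^n$. *)

theory Defs
  imports "HOL-Analysis.Analysis"
begin

text \<open>Integrals are taken over \<^const>\<open>lebesgue\<close>, so that ``measurable'' means Lebesgue measurable.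
  Generalized Young functions \<open>\<phi>(x,t)\<close>, \<open>t \<ge> 0\<close>, take values in \<^typ>\<open>ennreal\<close>; the value at negative \<open>t\<close>
  is never used.\<close>

section \<open>Generalized Orlicz functions and the class \<open>\<A>\<close>\<close>

text \<open>Real powers on \<open>[0,\<infinity>]\<close>, meant for exponents \<open>r > 0\<close> only.\<close>

definition ennpowr :: "ennreal \<Rightarrow> real \<Rightarrow> ennreal" where
  "ennpowr y r = (if y = \<infinity> then \<infinity> else ennreal (enn2real y powr r))"

definition double_phase :: "real \<Rightarrow> real \<Rightarrow> ('a \<Rightarrow> real) \<Rightarrow> 'a \<Rightarrow> real \<Rightarrow> ennreal" where
  "double_phase p q a x t = ennreal (1 / p * t powr p + 1 / q * a x * t powr q)"

text \<open>The subtraction on \<^typ>\<open>ennreal\<close> is truncated at \<open>0\<close>. This does not change the supremum, because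
  \<open>t = 0\<close> already contributes \<open>- \<phi>(x,0) = 0\<close>.\<close>

definition conj_fun :: "('a \<Rightarrow> real \<Rightarrow> ennreal) \<Rightarrow> 'a \<Rightarrow> real \<Rightarrow> ennreal" where
  "conj_fun \<phi> x s = (SUP t\<in>{0..}. ennreal (s * t) - \<phi> x t)"

text \<open>The norm is \<open>\<infinity>\<close> if no \<open>\<lambda>\<close> is admissible.\<close>

definition lux_norm :: "('a::euclidean_space \<Rightarrow> real \<Rightarrow> ennreal) \<Rightarrow> ('a \<Rightarrow> real) \<Rightarrow> ennreal" where
  "lux_norm \<phi> f =
     (INF l\<in>{l::real. l > 0 \<and> (\<integral>\<^sup>+x. \<phi> x (\<bar>f x\<bar> / l) \<partial>lebesgue) \<le> 1}. ennreal l)"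

definition cubes :: "'a::euclidean_space set set" where
  "cubes = {cbox c (c + l *\<^sub>R One) | c l. l > 0}"

definition A_const :: "('a::euclidean_space \<Rightarrow> real \<Rightarrow> ennreal) \<Rightarrow> ennreal" where
  "A_const \<phi> = (SUP Q\<in>cubes.
     lux_norm \<phi> (indicator Q) * lux_norm (conj_fun \<phi>) (indicator Q) / emeasure lebesgue Q)"

definition class_A :: "('a::euclidean_space \<Rightarrow> real \<Rightarrow> ennreal) set" where
  "class_A = {\<phi>. A_const \<phi> < \<infinity>}"

section \<open>Averages\<close>

definition avg :: "'a::euclidean_space set \<Rightarrow> ('a \<Rightarrow> real) \<Rightarrow> real" where
  "avg B u = (LINT x|lebesgue_on B. u x) / measure lebesgue B"

definition nn_avg :: "'a::euclidean_space set \<Rightarrow> ('a \<Rightarrow> ennreal) \<Rightarrow> ennreal" where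
  "nn_avg B f = (\<integral>\<^sup>+x. f x \<partial>lebesgue_on B) / emeasure lebesgue B"

section \<open>The Sobolev spaces \<open>W\<^sup>1\<^sup>,\<^sup>1\<close> and \<open>W\<^sup>1\<^sup>,\<^sup>1\<^sub>0\<close>\<close>

fun iter_deriv :: "'a::euclidean_space list \<Rightarrow> ('a \<Rightarrow> real) \<Rightarrow> 'a \<Rightarrow> real" where
  "iter_deriv [] f = f"
| "iter_deriv (v # vs) f = (\<lambda>x. frechet_derivative (iter_deriv vs f) (at x) v)"

text \<open>Differentiability of all iterated directional derivatives makes all of them continuous, so this is
  \<open>C\<^sup>\<infinity>\<close> on the whole space.\<close>

definition smooth :: "('a::euclidean_space \<Rightarrow> real) \<Rightarrow> bool" where
  "smooth f \<longleftrightarrow> (\<forall>vs x. iter_deriv vs f differentiable (at x))"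

text \<open>Elements of \<open>C\<^sup>\<infinity>\<^sub>c(U)\<close> are represented by their extension by zero.\<close>

definition test_funs :: "'a::euclidean_space set \<Rightarrow> ('a \<Rightarrow> real) set" where
  "test_funs U = {\<eta>. smooth \<eta> \<and> compact (closure {x. \<eta> x \<noteq> 0}) \<and> closure {x. \<eta> x \<noteq> 0} \<subseteq> U}"

definition grad :: "('a::euclidean_space \<Rightarrow> real) \<Rightarrow> 'a \<Rightarrow> 'a" where
  "grad \<eta> x = (\<Sum>i\<in>Basis. frechet_derivative \<eta> (at x) i *\<^sub>R i)"

definition loc_integrable :: "'a::euclidean_space set \<Rightarrow> ('a \<Rightarrow> 'b::euclidean_space) \<Rightarrow> bool" where
  "loc_integrable U f \<longleftrightarrow> (\<forall>K. compact K \<and> K \<subseteq> U \<longrightarrow> integrable (lebesgue_on K) f)"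

definition has_weak_grad :: "'a::euclidean_space set \<Rightarrow> ('a \<Rightarrow> real) \<Rightarrow> ('a \<Rightarrow> 'a) \<Rightarrow> bool" where
  "has_weak_grad U u G \<longleftrightarrow> loc_integrable U u \<and> loc_integrable U G \<and>
     (\<forall>\<eta>\<in>test_funs U. \<forall>i\<in>Basis.
        (LINT x|lebesgue_on U. u x * (grad \<eta> x \<bullet> i)) = - (LINT x|lebesgue_on U. (G x \<bullet> i) * \<eta> x))"

text \<open>On open \<open>U\<close> the weak gradient is unique up to null sets; this picks a representative.\<close>

definition weak_grad :: "'a::euclidean_space set \<Rightarrow> ('a \<Rightarrow> real) \<Rightarrow> 'a \<Rightarrow> 'a" where
  "weak_grad U u = (SOME G. has_weak_grad U u G)"

definition W11 :: "'a::euclidean_space set \<Rightarrow> ('a \<Rightarrow> real) set" where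
  "W11 U = {u. integrable (lebesgue_on U) u \<and> (\<exists>G. has_weak_grad U u G) \<and>
               integrable (lebesgue_on U) (weak_grad U u)}"

text \<open>The closure of \<open>C\<^sup>\<infinity>\<^sub>c(U)\<close> in \<open>W\<^sup>1\<^sup>,\<^sup>1(U)\<close>.\<close>

definition W11_0 :: "'a::euclidean_space set \<Rightarrow> ('a \<Rightarrow> real) set" where
  "W11_0 U = {u\<in>W11 U. \<exists>\<eta>. (\<forall>k::nat. \<eta> k \<in> test_funs U) \<and>
     (\<lambda>k. (LINT x|lebesgue_on U. \<bar>\<eta> k x - u x\<bar>)
          + (LINT x|lebesgue_on U. norm (grad (\<eta> k) x - weak_grad U u x))) \<longlonglongrightarrow> 0}"

end

theory Submission
  imports Defs
begin

text \<open>Let \<open>\<phi>(x,t) = t\<^sup>p / p + a(x) t\<^sup>q / q\<close>. Young's inequality turns the \<open>\<A>\<close>-condition on a single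
  cube \<open>Q\<close> into boundedness of averaging, and because \<open>\<phi>\<close> scales between the powers \<open>p\<close> and \<open>q\<close> this
  becomes homogeneous: \<open>\<integral>\<^sub>Q \<phi>(x, \<langle>f\<rangle>\<^sub>Q) \<le> K \<integral>\<^sub>Q \<phi>(x, f)\<close> whenever the right-hand integral is at most \<open>1\<close>.
  For \<open>f = t 1\<^sub>E\<close> it says that the weight \<open>\<phi>(\<cdot>, t)\<close> is of class \<open>A\<^sub>\<infinity>\<close> on the subcubes of \<open>Q\<close>, with constants
  independent of \<open>t\<close>, so it satisfies a reverse Hoelder inequality with an exponent \<open>1 + e\<close>.

  On the other side, \<open>|u(x) - c| / r\<close> is dominated by \<open>\<Sum>\<^sub>j 2\<^sup>-\<^sup>j F\<^sub>j(x)\<close>, where \<open>F\<^sub>j(x)\<close> is the average of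
  \<open>|\<nabla>u|\<close> over a ball of radius \<open>2\<^sup>1\<^sup>-\<^sup>j r\<close> around \<open>x\<close>. Averaging over cubes of the size of these balls,
  the two facts above give \<open>\<integral> \<phi>(x, F\<^sub>j)\<^sup>1\<^sup>+\<^sup>e \<le> C m (2\<^sup>j\<^sup>n m / r\<^sup>n)\<^sup>e\<close> with \<open>m = \<integral>\<^sub>B \<phi>(x, |\<nabla>u|)\<close>; for small \<open>e\<close>
  the factors \<open>2\<^sup>-\<^sup>j\<close> outweigh the growth \<open>2\<^sup>j\<^sup>n\<^sup>e\<close>, and no maximal function is needed.\<close>

section \<open>Averaging under the \<open>\<A>\<close>-condition\<close>

text \<open>The class condition bounds a product of norms, whereas the conclusion is homogeneous in
  the modular m of the gradient. This is why the estimates carry a free bound d in (0,1] on the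
  modular and end in a multiple of d (d/r^n)^e: with d = m, dividing by the volume and taking the
  (1+e)-th root leaves a multiple of m/r^n, so the radius disappears from the final constant. The
  degenerate case m = 0 is reached by letting d tend to 0.

  Losses are measured by the exponent \<open>q\<close>: a factor K >= 1 in the argument costs at
  most K^q, hence at most K^(2q) after raising to a power 1 + e <= 2.

  The potential bound provides some constant c, not the mean. Replacing c by the mean, and then by 0
  for zero boundary values, adds constant functions dominated by averages over the ball, of |u -
  c|/r and of |grad u| respectively, so the averaging bound is applied once more to each of
  them.\<close>

lemma powr_tangent:
  fixes y m s :: real
  assumes "0 \<le> y" "0 \<le> m" "1 \<le> s"
  shows "s * m powr (s - 1) * y \<le> y powr s + (s - 1) * m powr s"
proof (cases "s = 1")
  case True then show ?thesis using assms by (cases "m = 0") auto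
next
  case False
  then have s: "s > 1" using assms by simp
  have "y * m powr (s - 1) \<le> y powr s / s + (m powr (s - 1)) powr (s / (s - 1)) / (s / (s - 1))"
    using s assms by (intro Youngs_inequality) (auto simp: field_simps)
  also have "(m powr (s - 1)) powr (s / (s - 1)) = m powr s" using s by (simp add: powr_powr)
  finally have "s * (y * m powr (s - 1)) \<le> s * (y powr s / s + m powr s / (s / (s - 1)))" using s by (intro mult_left_mono) auto
  also have "\<dots> = y powr s + (s - 1) * m powr s" using s by (simp add: field_simps)
  finally show ?thesis by (simp add: mult_ac)
qed

text \<open>Integrate the tangent inequality for y^s at the mean m = i / V: the correction (s - 1)
  m^s V then cancels. The integral of f^s may be infinite, so the computation stays in
  \<open>ennreal\<close>, and only finite terms are cancelled.\<close>

lemma nn_integral_powr_jensen: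
  assumes f[measurable]: "f \<in> borel_measurable M" "\<And>x. 0 \<le> f x" and s: "1 \<le> s"
    and V: "emeasure M (space M) = ennreal V" "0 < V"
    and i: "(\<integral>\<^sup>+x. ennreal (f x) \<partial>M) = ennreal i" "0 \<le> i"
  shows "ennreal ((i / V) powr s * V) \<le> (\<integral>\<^sup>+x. ennreal (f x powr s) \<partial>M)"
proof -
  define m where "m = i / V"
  have m: "m \<ge> 0" using i V by (simp add: m_def)
  have "ennreal (s * m powr (s - 1) * i) = (\<integral>\<^sup>+x. ennreal (s * m powr (s - 1)) * ennreal (f x) \<partial>M)"
    using i s by (subst nn_integral_cmult) (auto simp: ennreal_mult')
  also have "\<dots> \<le> (\<integral>\<^sup>+x. ennreal (f x powr s) + ennreal ((s - 1) * m powr s) \<partial>M)"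
    using powr_tangent[OF f(2) m s] s 
    by (intro nn_integral_mono) (auto simp: ennreal_mult'[symmetric] ennreal_plus[symmetric] simp del: ennreal_plus intro!: ennreal_leI)
  also have "\<dots> = (\<integral>\<^sup>+x. ennreal (f x powr s) \<partial>M) + ennreal ((s - 1) * m powr s * V)"
    using V s by (subst nn_integral_add) (auto simp: ennreal_mult')
  finally have *: "ennreal (s * m powr (s - 1) * i) \<le> (\<integral>\<^sup>+x. ennreal (f x powr s) \<partial>M) + ennreal ((s - 1) * m powr s * V)" .
  have "m powr (s - 1) * i = m powr s * V"
    using m V powr_mult_base[of m "s - 1"] by (simp add: m_def field_simps)
  then have "s * m powr (s - 1) * i = m powr s * V + (s - 1) * m powr s * V" by (simp add: algebra_simps)
  then have "ennreal (m powr s * V) + ennreal ((s - 1) * m powr s * V) \<le> (\<integral>\<^sup>+x. ennreal (f x powr s) \<partial>M) + ennreal ((s - 1) * m powr s * V)"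
    using * s V by (simp add: ennreal_plus[symmetric] del: ennreal_plus)
  then show ?thesis unfolding m_def by (simp add: ennreal_add_left_cancel_le add.commute)
qed

section \<open>The double phase function and its scaling\<close>

locale double_phase_A =
  fixes p q :: real and a :: "'a::euclidean_space \<Rightarrow> real"
  assumes p1: "1 < p" and pq: "p < q"
    and a_meas: "a \<in> borel_measurable lebesgue" and a_nn: "\<And>x. 0 \<le> a x"
    and A: "double_phase p q a \<in> class_A"
begin

definition ph :: "'a \<Rightarrow> real \<Rightarrow> real" where
  "ph x t = t powr p / p + a x * t powr q / q"

lemma double_phase_ph: "double_phase p q a x t = ennreal (ph x t)"
  by (simp add: double_phase_def ph_def)

lemma ph_nn [simp]: "0 \<le> ph x t"
  using p1 pq a_nn[of x] by (simp add: ph_def)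

lemma ph_zero [simp]: "ph x 0 = 0"
  by (simp add: ph_def)

lemma ph_mono: "0 \<le> s \<Longrightarrow> s \<le> t \<Longrightarrow> ph x s \<le> ph x t"
  unfolding ph_def using p1 pq a_nn[of x]
  by (intro add_mono divide_right_mono mult_left_mono powr_mono2) auto

lemma ph_scale_le: 
  assumes "0 \<le> t" "1 \<le> c" shows "ph x (c * t) \<le> c powr q * ph x t"
proof -
  have "c powr p \<le> c powr q" using assms pq by (intro powr_mono) auto
  then have "(c * t) powr p / p \<le> c powr q * (t powr p / p)"
    using assms p1 by (simp add: powr_mult divide_right_mono mult_right_mono)
  moreover have "a x * (c * t) powr q / q = c powr q * (a x * t powr q / q)"
    using assms by (simp add: powr_mult)
  ultimately show ?thesis unfolding ph_def distrib_left by linarith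
qed

text \<open>Both exponents exceed 1, so shrinking the argument by c gains at least the factor c. A
  constant in front of a modular bound can thus be turned into a rescaling of the function, which
  restores the bound d that the averaging lemmas demand.\<close>

lemma ph_scale_down: 
  assumes "0 \<le> t" "0 \<le> c" "c \<le> 1" shows "ph x (c * t) \<le> c * ph x t"
proof -
  have *: "c powr r \<le> c" if "r > 1" for r
    using assms that by (cases "c = 0") (auto intro: powr_le_one_le)
  have "(c * t) powr p / p \<le> c * (t powr p / p)"
    using assms p1 *[of p] by (simp add: powr_mult divide_right_mono mult_right_mono)
  moreover have "a x * (c * t) powr q / q \<le> c * (a x * t powr q / q)"
    using assms p1 pq *[of q] a_nn[of x] mult_right_mono[of "c powr q" c "a x * t powr q"] 
    by (simp add: powr_mult divide_right_mono mult.assoc mult.left_commute)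
  ultimately show ?thesis by (simp add: ph_def distrib_left)
qed

lemma ph_quasi_add:
  assumes "0 \<le> s" "0 \<le> t" shows "ph x (s + t) \<le> 2 powr q * (ph x s + ph x t)"
proof -
  have "ph x (s + t) \<le> ph x (2 * max s t)" using assms by (intro ph_mono) auto
  also have "\<dots> \<le> 2 powr q * ph x (max s t)" using assms by (intro ph_scale_le) auto
  also have "ph x (max s t) \<le> ph x s + ph x t" by (auto simp: max_def)
  finally show ?thesis by simp
qed

lemma ph_meas [measurable]: 
  assumes [measurable]: "f \<in> borel_measurable lebesgue"
  shows "(\<lambda>x. ph x (f x)) \<in> borel_measurable lebesgue"
  using a_meas unfolding ph_def by measurable

text \<open>A supremum over rational \<open>t\<close> replaces \<^const>\<open>conj_fun\<close>, whose own measurability is then not needed.\<close>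

lemma conj_young_measurable:
  assumes "0 \<le> s"
  obtains \<psi> where "\<psi> \<in> borel_measurable lebesgue" "\<And>x. \<psi> x \<le> conj_fun (double_phase p q a) x s"
    "\<And>x t. 0 \<le> t \<Longrightarrow> ennreal (s * t) \<le> ennreal (ph x t) + \<psi> x"
proof -
  define \<psi> where "\<psi> = (\<lambda>x. SUP t\<in>\<rat> \<inter> {0..}. ennreal (s * t) - ennreal (ph x t))"
  have c: "countable (\<rat> \<inter> {0::real..})" by (simp add: countable_rat countable_Int1)
  have "\<psi> \<in> borel_measurable lebesgue"
    unfolding \<psi>_def using c by (intro borel_measurable_SUP) auto
  moreover have "\<psi> x \<le> conj_fun (double_phase p q a) x s" for x
    unfolding \<psi>_def conj_fun_def double_phase_ph by (intro SUP_subset_mono) auto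
  moreover have "ennreal (s * t) \<le> ennreal (ph x t) + \<psi> x" if t: "0 \<le> t" for x t
  proof (cases "\<psi> x = \<infinity>")
    case False
    then obtain b where b: "\<psi> x = ennreal b" "0 \<le> b" by (cases "\<psi> x") auto
    have r: "s * t' \<le> ph x t' + b" if "t' \<in> \<rat>" "0 \<le> t'" for t'
    proof -
      have "ennreal (s * t') - ennreal (ph x t') \<le> \<psi> x"
        unfolding \<psi>_def using that by (intro SUP_upper) auto
      then have "ennreal (s * t') \<le> ennreal (ph x t') + ennreal b"
        using b by (metis add.commute ennreal_minus_le_iff)
      then show ?thesis using b by (simp flip: ennreal_plus)
    qed
    have cont: "continuous_on {0..} (\<lambda>t. ph x t + b - s * t)"
      unfolding ph_def using p1 pq by (intro continuous_intros continuous_on_powr') auto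
    \<comment> \<open>Approximation from above keeps the rationals in the half-line over which the
      supremum is taken and on which \<open>ph x\<close> is continuous.\<close>
    have "\<forall>n. \<exists>t'\<in>\<rat>. t < t' \<and> t' < t + 1 / Suc n" 
      using Rats_dense_in_real[of t] by auto
    then obtain T where T: "\<And>n. T n \<in> \<rat>" "\<And>n. t < T n" "\<And>n. T n < t + 1 / Suc n" by metis
    have "(\<lambda>n. t + 1 / Suc n) \<longlonglongrightarrow> t + 0" 
      by (intro tendsto_intros LIMSEQ_Suc lim_1_over_n)
    then have "T \<longlonglongrightarrow> t"
      by (intro tendsto_sandwich[OF _ _ tendsto_const, of t T _ "\<lambda>n. t + 1 / Suc n"])
         (auto intro!: always_eventually less_imp_le T simp del: of_nat_Suc)
    moreover have T0: "0 \<le> T n" for n using T(2)[of n] t by simp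
    ultimately have "(\<lambda>n. ph x (T n) + b - s * T n) \<longlonglongrightarrow> ph x t + b - s * t"
      using t by (intro continuous_on_tendsto_compose[OF cont]) auto
    moreover have "0 \<le> ph x (T n) + b - s * T n" for n
      using r[OF T(1) T0, of n] by simp
    ultimately have "0 \<le> ph x t + b - s * t"
      by (intro LIMSEQ_le_const) auto
    then show ?thesis using b by (simp flip: ennreal_plus)
  qed simp
  ultimately show ?thesis using that by blast
qed

lemma cube_emeasure:
  assumes "Q \<in> cubes" 
  shows "emeasure lebesgue Q < \<infinity>" "0 < measure lebesgue Q" "Q \<in> sets lebesgue" "emeasure lebesgue Q = ennreal (measure lebesgue Q)"
proof -
  obtain c l where Q: "Q = cbox c (c + l *\<^sub>R One)" and l: "0 < l" using assms by (auto simp: cubes_def)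
  have f: "Q \<in> lmeasurable" using Q by simp
  then show "emeasure lebesgue Q < \<infinity>" "Q \<in> sets lebesgue" 
    by (auto simp: fmeasurable_def)
  have "box c (c + l *\<^sub>R One) \<noteq> {}" using l by (auto simp: box_ne_empty inner_add_left)
  then show "0 < measure lebesgue Q" unfolding Q 
    by (simp add: content_cbox' content_pos_lt_eq box_ne_empty inner_add_left prod_pos l)
  show "emeasure lebesgue Q = ennreal (measure lebesgue Q)"
    using f by (simp add: emeasure_eq_measure2)
qed

text \<open>The norms are infima that need not be attained, and in \<open>ennreal\<close> the
  product of 0 and \<infinity> is 0, so a bound on the product alone does not make the factors
  finite. Both norms are therefore shown to be positive; as their product is finite, so is each of
  them. Admissible numbers within a factor 2 of each infimum then give the 4.\<close>

lemma A_admissible: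
  assumes Q: "Q \<in> cubes"
  shows "\<exists>l1 l2. l1 > 0 \<and> l2 > 0 \<and> l1 * l2 \<le> 4 * (enn2real (A_const (double_phase p q a)) + 1) * measure lebesgue Q \<and>
     (\<integral>\<^sup>+x\<in>Q. ennreal (ph x (1 / l1)) \<partial>lebesgue) \<le> 1 \<and> 
     (\<integral>\<^sup>+x\<in>Q. conj_fun (double_phase p q a) x (1 / l2) \<partial>lebesgue) \<le> 1"
proof -
  note Qm = cube_emeasure[OF Q]
  have [measurable]: "Q \<in> sets lebesgue" by fact
  define V where "V = measure lebesgue Q"
  define \<phi> where "\<phi> = double_phase p q a"
  have V: "V > 0" "emeasure lebesgue Q = ennreal V" using Qm by (auto simp: V_def)
  define S1 where "S1 = {l::real. l > 0 \<and> (\<integral>\<^sup>+x\<in>Q. ennreal (ph x (1 / l)) \<partial>lebesgue) \<le> 1}"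
  define S2 where "S2 = {l::real. l > 0 \<and> (\<integral>\<^sup>+x\<in>Q. conj_fun \<phi> x (1 / l) \<partial>lebesgue) \<le> 1}"
  have "\<phi> x (\<bar>indicator Q x\<bar> / l) = ennreal (ph x (1 / l)) * indicator Q x" for x l
    by (auto simp: \<phi>_def double_phase_ph indicator_def)
  then have N1: "lux_norm \<phi> (indicator Q) = (INF l\<in>S1. ennreal l)"
    unfolding lux_norm_def S1_def by simp
  have "conj_fun \<phi> x (\<bar>indicator Q x\<bar> / l) = conj_fun \<phi> x (1 / l) * indicator Q x" for x l
    by (auto simp: conj_fun_def indicator_def)
  then have N2: "lux_norm (conj_fun \<phi>) (indicator Q) = (INF l\<in>S2. ennreal l)"
    unfolding lux_norm_def S2_def by simp
  define n1 where "n1 = (INF l\<in>S1. ennreal l)"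
  define n2 where "n2 = (INF l\<in>S2. ennreal l)"
  obtain K where K: "A_const \<phi> = ennreal K" "0 \<le> K" 
    using A unfolding \<phi>_def class_A_def by (cases "A_const (double_phase p q a)") auto
  have "n1 * n2 / ennreal V \<le> ennreal K"
    unfolding K(1)[symmetric] A_const_def V(2)[symmetric] n1_def n2_def N1[symmetric] N2[symmetric]
    using Q by (rule SUP_upper)
  then have "n1 * n2 / ennreal V * ennreal V \<le> ennreal K * ennreal V"
    by (rule mult_right_mono) simp
  then have prod: "n1 * n2 \<le> ennreal (K * V)"
    using V K by (simp add: ennreal_mult' ennreal_divide_times ennreal_divide_self)
  \<comment> \<open>Since \<open>ph x t\<close> >= t^p / p, an admissible l satisfies V / p <=
    l^p.\<close>
  define b1 where "b1 = (V / p) powr (1 / p)"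
  have b1: "b1 > 0" using V p1 by (simp add: b1_def)
  have "b1 \<le> l" if "l \<in> S1" for l
  proof -
    have l: "l > 0" using that by (simp add: S1_def)
    have "ennreal ((1 / l) powr p / p * V) = (\<integral>\<^sup>+x\<in>Q. ennreal ((1 / l) powr p / p) \<partial>lebesgue)"
      using V p1 by (simp add: nn_integral_cmult_indicator ennreal_mult''[symmetric])
    also have "\<dots> \<le> (\<integral>\<^sup>+x\<in>Q. ennreal (ph x (1 / l)) \<partial>lebesgue)"
      by (intro nn_integral_mono mult_right_mono ennreal_leI) (use p1 pq a_nn in \<open>auto simp: ph_def\<close>)
    also have "\<dots> \<le> 1" using that by (simp add: S1_def)
    finally have "(1 / l) powr p / p * V \<le> 1" by simp
    then have "V / p \<le> l powr p" using l p1 by (simp add: powr_divide field_simps)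
    then have "b1 \<le> (l powr p) powr (1 / p)" unfolding b1_def using V p1 by (intro powr_mono2) auto
    then show ?thesis using l p1 by (simp add: powr_powr)
  qed
  then have n1: "ennreal b1 \<le> n1" unfolding n1_def by (intro INF_greatest ennreal_leI)
  \<comment> \<open>A lower bound for the conjugate norm needs \<open>ph x 1\<close> to be bounded
    on a set of positive measure. As \<open>a\<close> is finite everywhere, the sets where a <= m
    exhaust \<open>Q\<close>, and one of them is not null.\<close>
  obtain m :: nat where m: "0 < emeasure lebesgue {x\<in>Q. a x \<le> m}"
  proof (rule ccontr)
    note [measurable] = a_meas
    assume "\<not> thesis"
    then have "emeasure lebesgue {x\<in>Q. a x \<le> real m} = 0" for m :: nat using that by (meson not_gr_zero)
    moreover have [measurable]: "{x\<in>Q. a x \<le> real m} \<in> sets lebesgue" for m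
    proof -
      have "{x\<in>Q. a x \<le> real m} = {x\<in>space lebesgue. a x \<le> real m} \<inter> Q" by auto
      also have "\<dots> \<in> sets lebesgue" by measurable
      finally show ?thesis .
    qed
    ultimately have "(\<Union>m. {x\<in>Q. a x \<le> real m}) \<in> null_sets lebesgue" by (intro null_sets_UN) (auto simp: null_sets_def)
    moreover have "(\<Union>m. {x\<in>Q. a x \<le> real m}) = Q" using real_arch_simple by auto
    ultimately show False using V by (auto simp: null_sets_def)
  qed
  define E where "E = {x\<in>Q. a x \<le> m}"
  have E[measurable]: "E \<in> sets lebesgue"
  proof -
    note [measurable] = a_meas
    have "E = {x\<in>space lebesgue. a x \<le> real m} \<inter> Q" by (auto simp: E_def)
    also have "\<dots> \<in> sets lebesgue" by measurable
    finally show ?thesis .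
  qed
  have "emeasure lebesgue E \<le> ennreal V" unfolding V(2)[symmetric] by (intro emeasure_mono) (auto simp: E_def)
  then obtain e where e: "emeasure lebesgue E = ennreal e" "e > 0"
    using m unfolding E_def[symmetric] by (cases "emeasure lebesgue E") (auto simp: top_unique)
  \<comment> \<open>Young's inequality at t = 1, integrated over \<open>E\<close>, gives e/l <= (1/p
    + m/q) e + 1, that is 1/l <= c.\<close>
  define c where "c = 1/p + m/q + 1/e"
  have c: "c > 0" using p1 pq e by (simp add: c_def add_pos_nonneg)
  have "1 / c \<le> l" if "l \<in> S2" for l
  proof -
    have l: "l > 0" using that by (simp add: S2_def)
    obtain \<psi> where [measurable]: "\<psi> \<in> borel_measurable lebesgue" and \<psi>: "\<And>x. \<psi> x \<le> conj_fun (double_phase p q a) x (1/l)"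
      "\<And>x t. 0 \<le> t \<Longrightarrow> ennreal (1/l * t) \<le> ennreal (ph x t) + \<psi> x"
      using conj_young_measurable[of "1/l"] l by auto
    have "ennreal (e / l) = (\<integral>\<^sup>+x\<in>E. ennreal (1/l) \<partial>lebesgue)"
      using e l by (simp add: nn_integral_cmult_indicator ennreal_mult'[symmetric])
    also have "\<dots> \<le> (\<integral>\<^sup>+x. ennreal (1/p + m/q) * indicator E x + \<psi> x * indicator Q x \<partial>lebesgue)"
    proof (intro nn_integral_mono)
      fix x
      have "ennreal (1/l) \<le> ennreal (1/p + m/q) + \<psi> x" if "x \<in> E"
      proof -
        have "ph x 1 \<le> 1/p + m/q" using that p1 pq by (auto simp: ph_def E_def divide_right_mono)
        then have "ennreal (ph x 1) + \<psi> x \<le> ennreal (1/p + m/q) + \<psi> x" by (intro add_right_mono ennreal_leI)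
        moreover have "ennreal (1/l) \<le> ennreal (ph x 1) + \<psi> x" using \<psi>(2)[of 1 x] by simp
        ultimately show ?thesis by (rule order_trans[rotated])
      qed
      then show "ennreal (1/l) * indicator E x \<le> ennreal (1/p + m/q) * indicator E x + \<psi> x * indicator Q x"
        by (auto simp: indicator_def E_def)
    qed
    also have "\<dots> = ennreal ((1/p + m/q) * e) + (\<integral>\<^sup>+x\<in>Q. \<psi> x \<partial>lebesgue)"
      using e by (subst nn_integral_add) (auto simp: nn_integral_cmult_indicator ennreal_mult'' simp del: ennreal_plus)
    also have "(\<integral>\<^sup>+x\<in>Q. \<psi> x \<partial>lebesgue) \<le> (\<integral>\<^sup>+x\<in>Q. conj_fun (double_phase p q a) x (1 / l) \<partial>lebesgue)"
      by (intro nn_integral_mono mult_right_mono \<psi>) auto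
    also have "\<dots> \<le> 1" using that by (simp add: S2_def \<phi>_def)
    finally have "ennreal (e / l) \<le> ennreal ((1/p + m/q) * e) + ennreal 1" by (simp add: add_left_mono)
    then have "ennreal (e / l) \<le> ennreal ((1/p + m/q) * e + 1)" 
      using e p1 pq by (subst ennreal_plus) auto
    then have "e / l \<le> (1/p + m/q) * e + 1" 
      using e p1 pq by (subst (asm) ennreal_le_iff) (auto intro!: add_nonneg_nonneg)
    also have "\<dots> = c * e" using e by (simp add: c_def field_simps)
    finally show ?thesis using e l c by (simp add: field_simps)
  qed
  then have n2: "ennreal (1 / c) \<le> n2" unfolding n2_def by (intro INF_greatest ennreal_leI)
  have n1p: "n1 > 0" using n1 b1 by (metis ennreal_less_zero_iff order.strict_trans2 not_gr_zero)
  have n2p: "n2 > 0" using n2 c by (metis ennreal_less_zero_iff order.strict_trans2 zero_less_divide_1_iff)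
  have "n1 \<noteq> \<infinity>" 
  proof
    assume "n1 = \<infinity>"
    then have "n1 * n2 = top" using n2p by (auto simp: ennreal_mult_eq_top_iff)
    with prod show False by (simp add: top_unique)
  qed
  moreover have "n2 \<noteq> \<infinity>" 
  proof
    assume "n2 = \<infinity>"
    then have "n1 * n2 = top" using n1p by (auto simp: ennreal_mult_eq_top_iff)
    with prod show False by (simp add: top_unique)
  qed
  ultimately obtain r1 r2 where r: "n1 = ennreal r1" "n2 = ennreal r2" "r1 > 0" "r2 > 0"
    using n1p n2p by (cases n1; cases n2) auto
  have "n1 < ennreal (2 * r1)" "n2 < ennreal (2 * r2)" using r by (auto simp: ennreal_lessI)
  then obtain l1 l2 where l: "l1 \<in> S1" "ennreal l1 < ennreal (2 * r1)" "l2 \<in> S2" "ennreal l2 < ennreal (2 * r2)"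
    unfolding n1_def n2_def INF_less_iff by blast
  have l': "0 < l1" "l1 \<le> 2 * r1" "0 < l2" "l2 \<le> 2 * r2" using l by (auto simp: S1_def S2_def ennreal_less_iff)
  then have "l1 * l2 \<le> (2 * r1) * (2 * r2)" by (intro mult_mono) auto
  also have "\<dots> \<le> 4 * (K * V)" using prod r K V by (simp add: ennreal_mult'[symmetric])
  also have "\<dots> \<le> 4 * (enn2real (A_const \<phi>) + 1) * V" using K V by (simp add: algebra_simps)
  finally show ?thesis using l l' unfolding S1_def S2_def V_def \<phi>_def by blast
qed

text \<open>Twice the constant of \<open>A_admissible\<close>, because Young's inequality bounds an
  integral by two modulars, each at most 1.\<close>

definition avg_const :: real where "avg_const = 8 * (enn2real (A_const (double_phase p q a)) + 1)"

lemma avg_const_ge: "avg_const \<ge> 8" by (simp add: avg_const_def)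

text \<open>Young's inequality between f(x) and 1/l2 shows that the integral of f is at most 2 l2.
  Since l1 l2 is at most a multiple of |Q|, the mean of f divided by \<open>avg_const\<close> is at
  most 1/l1, and the constant 1/l1 has modular at most 1 on Q.\<close>

lemma averaging_bound:
  assumes Q: "Q \<in> cubes" and f[measurable]: "f \<in> borel_measurable lebesgue" "\<And>x. 0 \<le> f x"
    and le: "(\<integral>\<^sup>+x\<in>Q. ennreal (ph x (f x)) \<partial>lebesgue) \<le> 1"
  shows "(\<integral>\<^sup>+x\<in>Q. ennreal (f x) \<partial>lebesgue) < \<infinity>"
    "(\<integral>\<^sup>+x\<in>Q. ennreal (ph x (enn2real (\<integral>\<^sup>+x\<in>Q. ennreal (f x) \<partial>lebesgue) / measure lebesgue Q / avg_const)) \<partial>lebesgue) \<le> 1"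
proof -
  note Qm = cube_emeasure[OF Q]
  have [measurable]: "Q \<in> sets lebesgue" by fact
  obtain l1 l2 where l: "l1 > 0" "l2 > 0" "l1 * l2 \<le> 4 * (enn2real (A_const (double_phase p q a)) + 1) * measure lebesgue Q"
     "(\<integral>\<^sup>+x\<in>Q. ennreal (ph x (1 / l1)) \<partial>lebesgue) \<le> 1" 
     "(\<integral>\<^sup>+x\<in>Q. conj_fun (double_phase p q a) x (1 / l2) \<partial>lebesgue) \<le> 1"
    using A_admissible[OF Q] by blast
  obtain \<psi> where [measurable]: "\<psi> \<in> borel_measurable lebesgue" and \<psi>: "\<And>x. \<psi> x \<le> conj_fun (double_phase p q a) x (1/l2)"
    "\<And>x t. 0 \<le> t \<Longrightarrow> ennreal (1/l2 * t) \<le> ennreal (ph x t) + \<psi> x"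
    using conj_young_measurable[of "1/l2"] l by auto
  define I where "I = (\<integral>\<^sup>+x\<in>Q. ennreal (f x) \<partial>lebesgue)"
  have "ennreal (1/l2) * I = (\<integral>\<^sup>+x\<in>Q. ennreal (1/l2 * f x) \<partial>lebesgue)"
    unfolding I_def using l by (subst nn_integral_cmult[symmetric]) (auto simp: ennreal_mult f mult.assoc divide_ennreal_def simp del: times_divide_eq_left times_divide_eq_right mult_1)
  also have "\<dots> \<le> (\<integral>\<^sup>+x. ennreal (ph x (f x)) * indicator Q x + \<psi> x * indicator Q x \<partial>lebesgue)"
    by (intro nn_integral_mono) (use \<psi>(2) f in \<open>auto simp: indicator_def\<close>)
  also have "\<dots> = (\<integral>\<^sup>+x\<in>Q. ennreal (ph x (f x)) \<partial>lebesgue) + (\<integral>\<^sup>+x\<in>Q. \<psi> x \<partial>lebesgue)"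
    by (intro nn_integral_add) auto
  also have "(\<integral>\<^sup>+x\<in>Q. \<psi> x \<partial>lebesgue) \<le> (\<integral>\<^sup>+x\<in>Q. conj_fun (double_phase p q a) x (1 / l2) \<partial>lebesgue)"
    by (intro nn_integral_mono mult_right_mono \<psi>) auto
  finally have "ennreal (1/l2) * I \<le> 1 + 1"
    using l le by (meson add_mono order_trans order_refl add_left_mono)
  then have I2: "ennreal (1/l2) * I \<le> 2" by simp
  then show "I < \<infinity>" using l by (cases I) (auto simp: ennreal_mult_top top_unique)
  then obtain i where i: "I = ennreal i" "i \<ge> 0" by (cases I) auto
  then have "ennreal (1/l2 * i) \<le> ennreal 2" using I2 l by (simp add: ennreal_mult' del: times_divide_eq_left)
  then have "1/l2 * i \<le> 2" by (subst (asm) ennreal_le_iff) auto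
  then have "i \<le> 2 * l2" using l by (simp add: field_simps)
  then have "i * l1 \<le> 2 * (l1 * l2)" using l by (simp add: mult.commute mult.left_commute)
  also have "\<dots> \<le> avg_const * measure lebesgue Q" using mult_left_mono[OF l(3), of 2] by (simp add: avg_const_def algebra_simps)
  finally have "i / measure lebesgue Q / avg_const \<le> 1 / l1"
    using l(1) Qm avg_const_ge by (simp add: field_simps)
  then have "(\<integral>\<^sup>+x\<in>Q. ennreal (ph x (i / measure lebesgue Q / avg_const)) \<partial>lebesgue) \<le> (\<integral>\<^sup>+x\<in>Q. ennreal (ph x (1 / l1)) \<partial>lebesgue)"
    by (intro nn_integral_mono mult_right_mono ennreal_leI ph_mono) (use i avg_const_ge in auto)
  also note l(4)
  finally show "(\<integral>\<^sup>+x\<in>Q. ennreal (ph x (enn2real I / measure lebesgue Q / avg_const)) \<partial>lebesgue) \<le> 1"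
    using i by simp
qed

text \<open>The \<open>p\<close>-part follows from Jensen's inequality, the \<open>q\<close>-part from the inhomogeneous bound for \<open>d\<^sup>-\<^sup>1\<^sup>/\<^sup>q f\<close>.\<close>

lemma averaging_hom:
  assumes Q: "Q \<in> cubes" and f[measurable]: "f \<in> borel_measurable lebesgue" "\<And>x. 0 \<le> f x"
    and d: "0 < d" "d \<le> 1"
    and le: "(\<integral>\<^sup>+x\<in>Q. ennreal (ph x (f x)) \<partial>lebesgue) \<le> ennreal d"
  shows "(\<integral>\<^sup>+x\<in>Q. ennreal (f x) \<partial>lebesgue) < \<infinity>"
    "(\<integral>\<^sup>+x\<in>Q. ennreal (ph x (enn2real (\<integral>\<^sup>+x\<in>Q. ennreal (f x) \<partial>lebesgue) / measure lebesgue Q)) \<partial>lebesgue) \<le> ennreal ((1 + avg_const powr q) * d)"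
proof -
  note Qm = cube_emeasure[OF Q]
  have [measurable]: "Q \<in> sets lebesgue" by fact
  have "(\<integral>\<^sup>+x\<in>Q. ennreal (ph x (f x)) \<partial>lebesgue) \<le> 1"
    by (rule order_trans[OF le]) (use d in simp)
  note avb = averaging_bound[OF Q f this]
  show fin: "(\<integral>\<^sup>+x\<in>Q. ennreal (f x) \<partial>lebesgue) < \<infinity>" by (fact avb)
  define V where "V = measure lebesgue Q"
  have V: "V > 0" "emeasure lebesgue Q = ennreal V" using Qm by (auto simp: V_def)
  obtain i where i: "(\<integral>\<^sup>+x\<in>Q. ennreal (f x) \<partial>lebesgue) = ennreal i" "i \<ge> 0"
    using fin by (cases "\<integral>\<^sup>+x\<in>Q. ennreal (f x) \<partial>lebesgue") auto
  define m where "m = i / V"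
  have m: "m \<ge> 0" using i V by (simp add: m_def)
  have "ennreal (m powr p * V) \<le> (\<integral>\<^sup>+x. ennreal (f x powr p) \<partial>lebesgue_on Q)"
    unfolding m_def using V p1 i f
    by (intro nn_integral_powr_jensen) (auto simp: emeasure_restrict_space nn_integral_restrict_space measurable_restrict_space1)
  also have "\<dots> = (\<integral>\<^sup>+x\<in>Q. ennreal (f x powr p) \<partial>lebesgue)" by (simp add: nn_integral_restrict_space)
  also have "\<dots> \<le> (\<integral>\<^sup>+x. ennreal p * (ennreal (ph x (f x)) * indicator Q x) \<partial>lebesgue)"
    using p1 pq a_nn f by (intro nn_integral_mono) (auto simp: indicator_def ennreal_mult'[symmetric] ph_def distrib_left intro!: ennreal_leI)
  also have "\<dots> = ennreal p * (\<integral>\<^sup>+x\<in>Q. ennreal (ph x (f x)) \<partial>lebesgue)"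
    by (intro nn_integral_cmult) measurable
  also have "\<dots> \<le> ennreal p * ennreal d" by (intro mult_left_mono le) auto
  finally have "m powr p * V \<le> p * d" using p1 d by (simp add: ennreal_mult'[symmetric])
  then have P1: "(m powr p / p) * V \<le> d" using p1 by (simp add: field_simps)
  define k where "k = d powr (- 1 / q)"
  have "d powr 0 \<le> d powr (- 1 / q)" using d p1 pq by (intro powr_mono') auto
  then have k: "k \<ge> 1" "k powr q = 1 / d"
    using d p1 pq by (auto simp: k_def powr_powr powr_minus_divide[of d 1] )
  have "(\<integral>\<^sup>+x\<in>Q. ennreal (ph x (k * f x)) \<partial>lebesgue) \<le> (\<integral>\<^sup>+x. ennreal (1 / d) * (ennreal (ph x (f x)) * indicator Q x) \<partial>lebesgue)"
    using ph_scale_le[OF f(2) k(1)] d unfolding k(2)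
    by (intro nn_integral_mono) (auto simp: indicator_def ennreal_mult'[symmetric] intro!: ennreal_leI)
  also have "\<dots> = ennreal (1 / d) * (\<integral>\<^sup>+x\<in>Q. ennreal (ph x (f x)) \<partial>lebesgue)"
    by (intro nn_integral_cmult) measurable
  also have "\<dots> \<le> ennreal (1 / d) * ennreal d" by (intro mult_left_mono le) auto
  also have "\<dots> = 1" using d by (simp add: ennreal_mult'[symmetric])
  finally have "(\<integral>\<^sup>+x\<in>Q. ennreal (ph x (k * f x)) \<partial>lebesgue) \<le> 1" .
  from averaging_bound(2)[OF Q _ _ this] f k
  have "(\<integral>\<^sup>+x\<in>Q. ennreal (ph x (enn2real (\<integral>\<^sup>+x\<in>Q. ennreal (k * f x) \<partial>lebesgue) / measure lebesgue Q / avg_const)) \<partial>lebesgue) \<le> 1"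
    by simp
  also have "(\<integral>\<^sup>+x\<in>Q. ennreal (k * f x) \<partial>lebesgue) = ennreal (k * i)"
    using k f i by (simp add: ennreal_mult' mult.assoc nn_integral_cmult)
  finally have P2: "(\<integral>\<^sup>+x\<in>Q. ennreal (ph x (k * m / avg_const)) \<partial>lebesgue) \<le> 1" 
    using i k by (simp add: m_def V_def)
  \<comment> \<open>On the q-part the dilation by k is undone exactly, as d k^q = 1. On the p-part
    it would leave d k^p = d^(1 - p/q), which is not bounded below as d tends to 0; that part is
    therefore taken from Jensen's inequality.\<close>
  have "ph x m \<le> m powr p / p + d * avg_const powr q * ph x (k * m / avg_const)" for x
  proof -
    have "d * avg_const powr q * (a x * (k * m / avg_const) powr q / q) = a x * m powr q / q"
      using k avg_const_ge m d by (simp add: powr_mult powr_divide)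
    moreover have "a x * (k * m / avg_const) powr q / q \<le> ph x (k * m / avg_const)"
      using p1 by (simp add: ph_def)
    then have "d * avg_const powr q * (a x * (k * m / avg_const) powr q / q) \<le> d * avg_const powr q * ph x (k * m / avg_const)"
      using d by (intro mult_left_mono) auto
    ultimately have "a x * m powr q / q \<le> d * avg_const powr q * ph x (k * m / avg_const)" by linarith
    then show ?thesis by (simp add: ph_def[of x m])
  qed
  then have "(\<integral>\<^sup>+x\<in>Q. ennreal (ph x m) \<partial>lebesgue) \<le> 
    (\<integral>\<^sup>+x. ennreal (m powr p / p) * indicator Q x + ennreal (d * avg_const powr q) * (ennreal (ph x (k * m / avg_const)) * indicator Q x) \<partial>lebesgue)"
    using d p1 by (intro nn_integral_mono) (auto simp: indicator_def ennreal_mult'[symmetric] ennreal_plus[symmetric] simp del: ennreal_plus intro!: ennreal_leI)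
  also have "\<dots> = ennreal (m powr p / p) * emeasure lebesgue Q + ennreal (d * avg_const powr q) * (\<integral>\<^sup>+x\<in>Q. ennreal (ph x (k * m / avg_const)) \<partial>lebesgue)"
    by (subst nn_integral_add) (auto simp: nn_integral_cmult nn_integral_cmult_indicator)
  also have "\<dots> \<le> ennreal d + ennreal (d * avg_const powr q) * 1"
    using P1 P2 V p1 by (intro add_mono mult_left_mono) (auto simp: ennreal_mult'[symmetric] intro!: ennreal_leI)
  also have "\<dots> = ennreal ((1 + avg_const powr q) * d)"
    using d by (simp add: ennreal_plus[symmetric] algebra_simps del: ennreal_plus)
  finally show "(\<integral>\<^sup>+x\<in>Q. ennreal (ph x (enn2real (\<integral>\<^sup>+x\<in>Q. ennreal (f x) \<partial>lebesgue) / measure lebesgue Q)) \<partial>lebesgue) \<le> ennreal ((1 + avg_const powr q) * d)"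
    using i by (simp add: m_def V_def)
qed

end

section \<open>The reverse Hoelder inequality\<close>

text \<open>Half-open, so that the 2^n halves of a cube are pairwise disjoint and cover it exactly.
  The closed cubes of the class condition differ from these by null sets.\<close>

definition hcube :: "'a::euclidean_space \<Rightarrow> real \<Rightarrow> 'a set" where
  "hcube c l = {x. \<forall>i\<in>Basis. c \<bullet> i \<le> x \<bullet> i \<and> x \<bullet> i < c \<bullet> i + l}"

text \<open>A child is named by the set \<open>T\<close> of coordinate directions in which it takes
  the upper half.\<close>

definition child_corner :: "'a::euclidean_space \<Rightarrow> real \<Rightarrow> 'a set \<Rightarrow> 'a" where
  "child_corner c l T = c + (l / 2) *\<^sub>R \<Sum>T"

lemma inner_sum_Basis:
  "T \<subseteq> Basis \<Longrightarrow> i \<in> Basis \<Longrightarrow> \<Sum>T \<bullet> i = (if i \<in> T then 1 else (0::real))"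
  for i :: "'a::euclidean_space"
proof -
  assume T: "T \<subseteq> Basis" "i \<in> Basis"
  then have f: "finite T" by (simp add: finite_subset)
  have "\<Sum>T \<bullet> i = (\<Sum>j\<in>T. if j = i then 1 else 0)"
    unfolding inner_sum_left using T by (intro sum.cong) (auto simp: inner_Basis)
  then show ?thesis using f by simp
qed

lemma child_corner_inner:
  "T \<subseteq> Basis \<Longrightarrow> i \<in> Basis \<Longrightarrow> child_corner c l T \<bullet> i = c \<bullet> i + (if i \<in> T then l / 2 else 0)"
  by (simp add: child_corner_def inner_add_left inner_sum_Basis)

lemma hcube_partition:
  fixes c :: "'a::euclidean_space"
  assumes l: "0 < l"
  shows "hcube c l = (\<Union>T\<in>Pow Basis. hcube (child_corner c l T) (l / 2))"
    and "disjoint_family_on (\<lambda>T. hcube (child_corner c l T) (l / 2)) (Pow Basis)"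
proof -
  show "hcube c l = (\<Union>T\<in>Pow Basis. hcube (child_corner c l T) (l / 2))"
  proof (intro equalityI subsetI)
    fix x assume x: "x \<in> hcube c l"
    define T where "T = {i\<in>Basis. x \<bullet> i \<ge> c \<bullet> i + l / 2}"
    have "x \<in> hcube (child_corner c l T) (l / 2)" 
    proof -
      have "child_corner c l T \<bullet> i \<le> x \<bullet> i \<and> x \<bullet> i < child_corner c l T \<bullet> i + l / 2" if "i \<in> Basis" for i
      proof -
        have "c \<bullet> i \<le> x \<bullet> i" "x \<bullet> i < c \<bullet> i + l" using x that by (auto simp: hcube_def)
        moreover have "child_corner c l T \<bullet> i = c \<bullet> i + (if i \<in> T then l / 2 else 0)"
          by (rule child_corner_inner) (use that in \<open>auto simp: T_def\<close>)
        ultimately show ?thesis using that by (auto simp: T_def)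
      qed
      then show ?thesis by (simp add: hcube_def)
    qed
    then show "x \<in> (\<Union>T\<in>Pow Basis. hcube (child_corner c l T) (l / 2))" by (auto simp: T_def)
  next
    fix x assume "x \<in> (\<Union>T\<in>Pow Basis. hcube (child_corner c l T) (l / 2))"
    then obtain T where T: "T \<subseteq> Basis" "x \<in> hcube (child_corner c l T) (l / 2)" by auto
    have "c \<bullet> i \<le> x \<bullet> i \<and> x \<bullet> i < c \<bullet> i + l" if "i \<in> Basis" for i
    proof -
      have "child_corner c l T \<bullet> i \<le> x \<bullet> i" "x \<bullet> i < child_corner c l T \<bullet> i + l / 2"
        using T that by (auto simp: hcube_def)
      then show ?thesis using T that l by (auto simp: child_corner_inner split: if_splits)
    qed
    then show "x \<in> hcube c l" by (simp add: hcube_def)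
  qed
  show "disjoint_family_on (\<lambda>T. hcube (child_corner c l T) (l / 2)) (Pow Basis)"
  proof (unfold disjoint_family_on_def, intro ballI impI)
    fix T U :: "'a set" assume TU: "T \<in> Pow Basis" "U \<in> Pow Basis" "T \<noteq> U"
    then obtain i where i: "i \<in> Basis" "(i \<in> T) \<noteq> (i \<in> U)" by blast
    show "hcube (child_corner c l T) (l / 2) \<inter> hcube (child_corner c l U) (l / 2) = {}"
    proof (rule ccontr)
      assume "\<not> ?thesis"
      then obtain x where x: "x \<in> hcube (child_corner c l T) (l / 2)" "x \<in> hcube (child_corner c l U) (l / 2)" by auto
      have "child_corner c l T \<bullet> i \<le> x \<bullet> i" "x \<bullet> i < child_corner c l T \<bullet> i + l / 2"
        "child_corner c l U \<bullet> i \<le> x \<bullet> i" "x \<bullet> i < child_corner c l U \<bullet> i + l / 2"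
        using x i by (auto simp: hcube_def)
      then show False using TU i by (auto simp: child_corner_inner split: if_splits)
    qed
  qed
qed

lemma hcube_child_subset:
  fixes c :: "'a::euclidean_space"
  shows "0 < l \<Longrightarrow> T \<in> Pow Basis \<Longrightarrow> hcube (child_corner c l T) (l / 2) \<subseteq> hcube c l"
  using hcube_partition(1)[of l c] by blast

lemma hcube_measure:
  fixes c :: "'a::euclidean_space"
  assumes l: "0 < l"
  shows "hcube c l \<in> sets borel" "hcube c l \<in> lmeasurable" "measure lebesgue (hcube c l) = l ^ DIM('a)"
    "emeasure lebesgue (hcube c l) = ennreal (l ^ DIM('a))"
    "measure lebesgue (cbox c (c + l *\<^sub>R One)) = l ^ DIM('a)" "hcube c l \<subseteq> cbox c (c + l *\<^sub>R One)"
    "cbox c (c + l *\<^sub>R One) - hcube c l \<in> null_sets lebesgue"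
proof -
  have "hcube c l = (\<Inter>i\<in>Basis. {x. c \<bullet> i \<le> x \<bullet> i} \<inter> {x. x \<bullet> i < c \<bullet> i + l})"
    by (auto simp: hcube_def)
  also have "\<dots> \<in> sets borel" by (intro sets.finite_INT sets.Int) auto
  finally show b: "hcube c l \<in> sets borel" .
  let ?C = "cbox c (c + l *\<^sub>R One)" and ?B = "box c (c + l *\<^sub>R One)"
  show sub: "hcube c l \<subseteq> ?C" by (force simp: hcube_def mem_box inner_add_left)
  have sub2: "?B \<subseteq> hcube c l" by (force simp: hcube_def mem_box inner_add_left)
  show mC: "measure lebesgue ?C = l ^ DIM('a)"
    using l by (simp add: content_cbox' box_ne_empty inner_add_left)
  have "emeasure lebesgue ?C = ennreal (l ^ DIM('a))"
    using mC by (metis emeasure_eq_measure2 lmeasurable_cbox)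
  moreover have "emeasure lebesgue ?B = ennreal (l ^ DIM('a))"
  proof -
    have "measure lebesgue ?B = l ^ DIM('a)" using l by (simp add: measure_lborel_box_eq inner_add_left)
    then show ?thesis by (metis emeasure_eq_measure2 lmeasurable_box)
  qed
  moreover have hs: "hcube c l \<in> sets lebesgue" using b by simp
  ultimately show e: "emeasure lebesgue (hcube c l) = ennreal (l ^ DIM('a))"
    by (metis antisym emeasure_mono sub sub2 sets_completionI_sets lmeasurable_cbox fmeasurableD)
  then show "hcube c l \<in> lmeasurable" using hs by (intro fmeasurableI) auto
  show "measure lebesgue (hcube c l) = l ^ DIM('a)" using e l by (simp add: measure_def)
  have "?C - hcube c l \<subseteq> ?C - ?B" using sub2 by blast
  moreover have "negligible (?C - ?B)" by (rule negligible_frontier_interval)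
  ultimately have "negligible (?C - hcube c l)" by (rule negligible_subset[rotated])
  then show "?C - hcube c l \<in> null_sets lebesgue" by (simp add: negligible_iff_null_sets)
qed

text \<open>The union of the maximal dyadic subcubes of generation at most \<open>N\<close> on which the average of \<open>\<nu>\<close> exceeds \<open>L\<close>.\<close>

primrec stopping_set :: "'a::euclidean_space measure \<Rightarrow> real \<Rightarrow> nat \<Rightarrow> 'a \<Rightarrow> real \<Rightarrow> 'a set" where
  "stopping_set \<nu> L 0 c l = (if measure \<nu> (hcube c l) > L * l ^ DIM('a) then hcube c l else {})"
| "stopping_set \<nu> L (Suc N) c l = (if measure \<nu> (hcube c l) > L * l ^ DIM('a) then hcube c l 
     else (\<Union>T\<in>Pow Basis. stopping_set \<nu> L N (child_corner c l T) (l / 2)))"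

text \<open>The sum of \<nu>(P) (\<nu>(P)/|P|)^e over the dyadic subcubes P of generation N. For
  \<nu> with density w it is the integral of the (1+e)-th power of the conditional expectation of w
  on that generation.\<close>

primrec cell_powr_sum :: "'a::euclidean_space measure \<Rightarrow> real \<Rightarrow> nat \<Rightarrow> 'a \<Rightarrow> real \<Rightarrow> real" where
  "cell_powr_sum \<nu> e 0 c l = measure \<nu> (hcube c l) * (measure \<nu> (hcube c l) / l ^ DIM('a)) powr e"
| "cell_powr_sum \<nu> e (Suc N) c l = (\<Sum>T\<in>Pow Basis. cell_powr_sum \<nu> e N (child_corner c l T) (l / 2))"

lemma stopping_set_subset: "0 < l \<Longrightarrow> stopping_set \<nu> L N c l \<subseteq> hcube c l"
proof (induction N arbitrary: c l)
  case (Suc N)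
  have "stopping_set \<nu> L N (child_corner c l T) (l / 2) \<subseteq> hcube c l" if "T \<in> Pow Basis" for T
    using Suc.IH[of "l / 2" "child_corner c l T"] hcube_child_subset[of l T c] Suc.prems that by auto
  then show ?case by auto
qed auto

lemma stopping_set_sets: "0 < l \<Longrightarrow> stopping_set \<nu> L N c l \<in> sets lebesgue"
proof (induction N arbitrary: c l)
  case (Suc N)
  have "(\<Union>T\<in>Pow Basis. stopping_set \<nu> L N (child_corner c l T) (l / 2)) \<in> sets lebesgue"
    using Suc by (intro sets.finite_UN) auto
  then show ?case using hcube_measure(2)[OF Suc.prems, of c] by auto
qed (use hcube_measure(2) in auto)

lemma stopping_set_disjoint:
  fixes c :: "'a::euclidean_space"
  assumes "0 < l" shows "disjoint_family_on (\<lambda>T. stopping_set \<nu> L N (child_corner c l T) (l / 2)) (Pow Basis)"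
  using hcube_partition(2)[OF assms, of c] stopping_set_subset[of "l/2" \<nu> L N] assms
  unfolding disjoint_family_on_def by (meson disjoint_iff half_gt_zero subsetD)

context
  fixes \<nu> :: "'a::euclidean_space measure"
  assumes fin: "finite_measure \<nu>" and sets_eq: "sets \<nu> = sets lebesgue"
begin

interpretation finite_measure \<nu> by (rule fin)

lemma hcube_nu: "0 < l \<Longrightarrow> hcube c l \<in> sets \<nu>"
  using hcube_measure(2) sets_eq by auto

lemma nu_partition:
  assumes l: "0 < l"
  shows "measure \<nu> (hcube c l) = (\<Sum>T\<in>Pow Basis. measure \<nu> (hcube (child_corner c l T) (l / 2)))"
  unfolding hcube_partition(1)[OF l, of c] using l hcube_partition(2)[OF l, of c]
  by (intro finite_measure_finite_Union) (auto intro!: hcube_nu)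

lemma nu_Om_partition:
  assumes l: "0 < l"
  shows "measure \<nu> (\<Union>T\<in>Pow Basis. stopping_set \<nu> L N (child_corner c l T) (l / 2)) = (\<Sum>T\<in>Pow Basis. measure \<nu> (stopping_set \<nu> L N (child_corner c l T) (l / 2)))"
  using l stopping_set_disjoint[OF l] stopping_set_sets[of "l/2" \<nu> L N] sets_eq
  by (intro finite_measure_finite_Union) auto

text \<open>Each selected cube has average above \<open>L\<close>, and the selected cubes are
  disjoint, so the inequality adds up along the recursion.\<close>

lemma stopping_set_weak_type:
  assumes L: "0 \<le> L"
  shows "0 < l \<Longrightarrow> L * measure lebesgue (stopping_set \<nu> L N c l) \<le> measure \<nu> (stopping_set \<nu> L N c l)"
proof (induction N arbitrary: c l)
  case 0 then show ?case using hcube_measure(3)[OF 0, of c] by auto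
next
  case (Suc N)
  let ?O = "\<lambda>T. stopping_set \<nu> L N (child_corner c l T) (l / 2)"
  have l2: "0 < l / 2" using Suc by simp
  have f: "?O T \<in> lmeasurable" for T
    by (rule fmeasurableI2[OF hcube_measure(2)[OF l2] stopping_set_subset[OF l2] stopping_set_sets[OF l2]])
  have "measure lebesgue (\<Union>T\<in>Pow Basis. ?O T) = (\<Sum>T\<in>Pow Basis. measure lebesgue (?O T))"
    using stopping_set_disjoint[OF Suc.prems] by (intro measure_finite_Union) (use fmeasurableD[OF f] fmeasurableD2[OF f] in \<open>auto simp del: emeasure_completion\<close>)
  then have "L * measure lebesgue (\<Union>T\<in>Pow Basis. ?O T) = (\<Sum>T\<in>Pow Basis. L * measure lebesgue (?O T))"
    by (simp add: sum_distrib_left)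
  also have "\<dots> \<le> (\<Sum>T\<in>Pow Basis. measure \<nu> (?O T))"
    using l2 by (intro sum_mono Suc.IH)
  also have "\<dots> = measure \<nu> (\<Union>T\<in>Pow Basis. ?O T)" using nu_Om_partition[OF Suc.prems] by simp
  finally show ?case using hcube_measure(3)[OF Suc.prems, of c] by auto
qed

text \<open>The cells are split by the stopping set. Outside it every cell has average at most
  \<open>L\<close>. A selected cube has a parent that was not selected, so its own average is at
  most 2^n L, and the bound \<open>IH\<close> for fewer generations controls all cells inside it.
  \<open>IH\<close> is an assumption here because it is the hypothesis of an outer induction on the
  number of generations.\<close>

lemma cell_powr_sum_stopping:
  assumes L: "0 \<le> L" and A: "0 \<le> A" and e: "0 \<le> e"
    and IH: "\<And>k c l. k < K \<Longrightarrow> 0 < l \<Longrightarrow> hcube c l \<subseteq> Q \<Longrightarrow>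
        cell_powr_sum \<nu> e k c l \<le> A * measure \<nu> (hcube c l) * (measure \<nu> (hcube c l) / l ^ DIM('a)) powr e"
  shows "0 < l \<Longrightarrow> hcube c l \<subseteq> Q \<Longrightarrow> measure \<nu> (hcube c l) \<le> L * l ^ DIM('a) \<Longrightarrow>
     cell_powr_sum \<nu> e K c l \<le> A * (2 ^ DIM('a) * L) powr e * measure \<nu> (stopping_set \<nu> L K c l) 
        + L powr e * (measure \<nu> (hcube c l) - measure \<nu> (stopping_set \<nu> L K c l))"
  using IH
proof (induction K arbitrary: c l)
  case 0
  have "(measure \<nu> (hcube c l) / l ^ DIM('a)) powr e \<le> L powr e"
    using 0 e by (intro powr_mono2) (auto simp: field_simps)
  then show ?case using 0 by (simp add: mult.commute[of "L powr e"] mult_left_mono)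
next
  case (Suc K)
  let ?O = "\<lambda>T. stopping_set \<nu> L K (child_corner c l T) (l / 2)" and ?H = "\<lambda>T. hcube (child_corner c l T) (l / 2)"
  have l: "0 < l" "0 < l / 2" using Suc by auto
  have *: "cell_powr_sum \<nu> e K (child_corner c l T) (l / 2) \<le> A * (2 ^ DIM('a) * L) powr e * measure \<nu> (?O T) 
      + L powr e * (measure \<nu> (?H T) - measure \<nu> (?O T))" if T: "T \<in> Pow Basis" for T
  proof (cases "measure \<nu> (?H T) \<le> L * (l / 2) ^ DIM('a)")
    case True
    then show ?thesis using Suc.prems l T hcube_child_subset[OF l(1) T, of c]
      by (intro Suc.IH) auto
  next
    case False
    then have O: "?O T = ?H T" by (cases K) auto
    have "measure \<nu> (?H T) \<le> measure \<nu> (hcube c l)"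
      by (intro finite_measure_mono hcube_child_subset[OF l(1) T] hcube_nu l)
    also have "\<dots> \<le> L * l ^ DIM('a)" by fact
    finally have "measure \<nu> (?H T) / (l / 2) ^ DIM('a) \<le> 2 ^ DIM('a) * L"
      using l by (simp add: field_simps power_divide)
    then have "(measure \<nu> (?H T) / (l / 2) ^ DIM('a)) powr e \<le> (2 ^ DIM('a) * L) powr e"
      using e l by (intro powr_mono2) auto
    then have "A * measure \<nu> (?H T) * (measure \<nu> (?H T) / (l / 2) ^ DIM('a)) powr e \<le> A * measure \<nu> (?H T) * (2 ^ DIM('a) * L) powr e"
      using A by (intro mult_left_mono) auto
    moreover have "cell_powr_sum \<nu> e K (child_corner c l T) (l / 2) \<le> A * measure \<nu> (?H T) * (measure \<nu> (?H T) / (l / 2) ^ DIM('a)) powr e"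
      using Suc.prems l hcube_child_subset[OF l(1) T, of c] by (intro Suc.prems) auto
    ultimately show ?thesis unfolding O by (simp add: mult_ac)
  qed
  have "stopping_set \<nu> L (Suc K) c l = (\<Union>T\<in>Pow Basis. ?O T)" using Suc.prems by simp
  then have O: "measure \<nu> (stopping_set \<nu> L (Suc K) c l) = (\<Sum>T\<in>Pow Basis. measure \<nu> (?O T))"
    using nu_Om_partition[OF l(1)] by simp
  have "cell_powr_sum \<nu> e (Suc K) c l \<le> (\<Sum>T\<in>Pow Basis. A * (2 ^ DIM('a) * L) powr e * measure \<nu> (?O T) 
      + L powr e * (measure \<nu> (?H T) - measure \<nu> (?O T)))"
    unfolding cell_powr_sum.simps by (intro sum_mono *)
  also have "\<dots> = A * (2 ^ DIM('a) * L) powr e * measure \<nu> (stopping_set \<nu> L (Suc K) c l) 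
        + L powr e * (measure \<nu> (hcube c l) - measure \<nu> (stopping_set \<nu> L (Suc K) c l))"
    unfolding O nu_partition[OF l(1), of c] by (simp add: sum.distrib sum_distrib_left sum_subtractf right_diff_distrib)
  finally show ?case .
qed

lemma cell_powr_sum_zero: "0 < l \<Longrightarrow> measure \<nu> (hcube c l) = 0 \<Longrightarrow> cell_powr_sum \<nu> e N c l = 0"
proof (induction N arbitrary: c l)
  case (Suc N)
  have "measure \<nu> (hcube (child_corner c l T) (l / 2)) = 0" if T: "T \<in> Pow Basis" for T
    using finite_measure_mono[OF hcube_child_subset[OF Suc.prems(1) T, of c] hcube_nu[OF Suc.prems(1)]] Suc.prems(2)
    by (simp add: measure_le_0_iff)
  then show ?case using Suc by simp
qed simp

text \<open>Stopping at twice the average selects at most half of the cube, by the weak-type bound.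
  The remaining half carries at least the fraction b of the mass, so the stopping set carries at
  most the fraction 1 - b. The recursive bound is therefore multiplied by (2 * 2^n)^e (1 - b), and
  \<open>AC\<close> says that A reproduces itself, whatever the number of generations.\<close>

lemma cell_powr_sum_bound:
  assumes A: "1 \<le> A" and e: "0 \<le> e" and b: "0 < b" "b \<le> 1"
    and AC: "A * (2 * 2 ^ DIM('a)) powr e * (1 - b) + 2 powr e \<le> A"
    and Ainf: "\<And>c l E. 0 < l \<Longrightarrow> hcube c l \<subseteq> Q \<Longrightarrow> E \<subseteq> hcube c l \<Longrightarrow> E \<in> sets lebesgue \<Longrightarrow>
        l ^ DIM('a) / 2 \<le> measure lebesgue E \<Longrightarrow> b * measure \<nu> (hcube c l) \<le> measure \<nu> E"
  shows "0 < l \<Longrightarrow> hcube c l \<subseteq> Q \<Longrightarrow>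
    cell_powr_sum \<nu> e N c l \<le> A * measure \<nu> (hcube c l) * (measure \<nu> (hcube c l) / l ^ DIM('a)) powr e"
proof (induction N arbitrary: c l rule: less_induct)
  case (less N)
  let ?h = "measure \<nu> (hcube c l)" and ?n = "DIM('a)"
  define av where "av = ?h / l ^ ?n"
  show ?case
  proof (cases "?h = 0")
    case True then show ?thesis using cell_powr_sum_zero less.prems by simp
  next
    case False
    then have h: "?h > 0" by (simp add: zero_less_measure_iff)
    have ln: "l ^ ?n > 0" using less.prems by simp
    have av: "av > 0" "?h = av * l ^ ?n" using h ln less.prems(1) by (auto simp: av_def)
    let ?O = "stopping_set \<nu> (2 * av) N c l"
    have S: "cell_powr_sum \<nu> e N c l \<le> A * (2 ^ ?n * (2 * av)) powr e * measure \<nu> ?O + (2 * av) powr e * (?h - measure \<nu> ?O)"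
      using less av A e ln by (intro cell_powr_sum_stopping[where Q = Q]) (auto simp: mult_ac)
    have O1: "?O \<subseteq> hcube c l" "?O \<in> sets lebesgue" using stopping_set_subset[OF less.prems(1)] stopping_set_sets[OF less.prems(1)] .
    have Oh: "measure \<nu> ?O \<le> ?h" using O1 less.prems by (intro finite_measure_mono hcube_nu)
    have "2 * av * measure lebesgue ?O \<le> measure \<nu> ?O" using av less.prems by (intro stopping_set_weak_type) auto
    then have "2 * av * measure lebesgue ?O \<le> av * l ^ ?n" using Oh av by linarith
    then have O2: "measure lebesgue ?O \<le> l ^ ?n / 2" using av by simp
    have "measure lebesgue (hcube c l - ?O) = l ^ ?n - measure lebesgue ?O"
      using O1 hcube_measure(2,3)[OF less.prems(1), of c] 
      by (subst measurable_measure_Diff) (auto)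
    then have "b * ?h \<le> measure \<nu> (hcube c l - ?O)"
      using O1 O2 less.prems hcube_measure(2)[OF less.prems(1), of c] by (intro Ainf) auto
    also have "\<dots> = ?h - measure \<nu> ?O"
      using O1 sets_eq less.prems by (intro finite_measure_Diff hcube_nu) auto
    finally have O3: "measure \<nu> ?O \<le> (1 - b) * ?h" by (simp add: algebra_simps)
    have "cell_powr_sum \<nu> e N c l \<le> A * (2 ^ ?n * (2 * av)) powr e * ((1 - b) * ?h) + (2 * av) powr e * ?h"
      using O3 A by (intro order_trans[OF S] add_mono mult_left_mono) auto
    also have "\<dots> = (A * (2 * 2 ^ ?n) powr e * (1 - b) + 2 powr e) * (?h * av powr e)"
      using av by (simp add: powr_mult algebra_simps)
    also have "\<dots> \<le> A * (?h * av powr e)" by (intro mult_right_mono AC) auto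
    finally show ?thesis by (simp add: av_def mult_ac)
  qed
qed

end

text \<open>With A = 4/b the left-hand side tends to A (1 - b) + 1 < A as e tends to 0.
  Quantitatively, (2 * 2^n)^e <= (1 - b/2)/(1 - b) leaves a gap of A b/2 = 2, which absorbs
  2^e.\<close>

lemma tree_exponent:
  fixes b :: real
  assumes b: "0 < b" "b < 1"
  obtains e0 where "0 < e0" "e0 \<le> 1" 
   "\<And>e. 0 \<le> e \<Longrightarrow> e \<le> e0 \<Longrightarrow> (4 / b) * (2 * 2 ^ n) powr e * (1 - b) + 2 powr e \<le> 4 / b"
proof -
  define X where "X = (1 - b / 2) / (1 - b)"
  define M :: real where "M = 2 * 2 ^ n"
  have X: "X > 1" using b by (simp add: X_def field_simps)
  have M: "M > 1" unfolding M_def by (rule less_le_trans[of _ 2]) auto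
  define e0 where "e0 = min 1 (ln X / ln M)"
  show thesis
  proof (rule that[of e0])
    show "0 < e0" "e0 \<le> 1" using X M by (auto simp: e0_def)
    fix e assume e: "0 \<le> e" "e \<le> e0"
    have "M powr e \<le> M powr (ln X / ln M)" using e M by (intro powr_mono) (auto simp: e0_def)
    also have "\<dots> = X" using M X by (simp add: powr_def)
    finally have "M powr e * (1 - b) \<le> X * (1 - b)" using b by (intro mult_right_mono) auto
    also have "\<dots> = 1 - b / 2" using b by (simp add: X_def)
    finally have "(4 / b) * (M powr e * (1 - b)) \<le> (4 / b) * (1 - b / 2)" using b by (intro mult_left_mono) auto
    also have "\<dots> = 4 / b - 2" using b by (simp add: field_simps)
    finally have "(4 / b) * (M powr e * (1 - b)) \<le> 4 / b - 2" .
    moreover have "2 powr e \<le> (2::real) powr 1" using e by (intro powr_mono) (auto simp: e0_def)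
    ultimately show "(4 / b) * (2 * 2 ^ n) powr e * (1 - b) + 2 powr e \<le> 4 / b" 
      by (simp add: M_def mult.assoc)
  qed
qed

section \<open>Convergence of dyadic averages in L1 and almost everywhere\<close>

text \<open>A subsequence is all that Fatou's lemma and pointwise bounds ask for. Integrability is
  deduced from the hypothesis, hence only from some index on.\<close>

lemma L1_AE_subseq:
  fixes u :: "nat \<Rightarrow> 'a \<Rightarrow> real"
  assumes [measurable]: "\<And>n. u n \<in> borel_measurable M"
    and key: "\<And>e. 0 < e \<Longrightarrow> \<exists>N0. \<forall>N\<ge>N0. (\<integral>\<^sup>+x. ennreal (norm (u N x)) \<partial>M) \<le> ennreal e"
  obtains r where "strict_mono (r::nat\<Rightarrow>nat)" "AE x in M. (\<lambda>n. u (r n) x) \<longlonglongrightarrow> 0"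
proof -
  obtain N0 where N0: "\<And>N. N \<ge> N0 \<Longrightarrow> (\<integral>\<^sup>+x. ennreal (norm (u N x)) \<partial>M) \<le> ennreal 1"
    using key[of 1] by auto
  have ui: "integrable M (u (N + N0))" for N
  proof (rule integrableI_bounded)
    show "(\<integral>\<^sup>+x. ennreal (norm (u (N + N0) x)) \<partial>M) < \<infinity>"
      using N0[of "N + N0"] by (simp add: le_less_trans)
  qed simp
  have "(\<lambda>N. LINT x|M. norm (u (N + N0) x)) \<longlonglongrightarrow> 0"
  proof (rule LIMSEQ_I)
    fix e :: real assume e: "0 < e"
    obtain N1 where N1: "\<And>N. N \<ge> N1 \<Longrightarrow> (\<integral>\<^sup>+x. ennreal (norm (u N x)) \<partial>M) \<le> ennreal (e / 2)"
      using key[of "e/2"] e by auto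
    show "\<exists>no. \<forall>N\<ge>no. norm ((LINT x|M. norm (u (N + N0) x)) - 0) < e"
    proof (intro exI allI impI)
      fix N assume "N \<ge> N1"
      then have "ennreal (LINT x|M. norm (u (N + N0) x)) \<le> ennreal (e / 2)"
        using N1[of "N + N0"] nn_integral_eq_integral[OF integrable_norm[OF ui[of N]]] by simp
      then have "(LINT x|M. norm (u (N + N0) x)) \<le> e / 2" using e by (subst (asm) ennreal_le_iff) auto
      moreover have "(LINT x|M. norm (u (N + N0) x)) \<ge> 0" by (intro integral_nonneg_AE) auto
      ultimately show "norm ((LINT x|M. norm (u (N + N0) x)) - 0) < e" using e by simp
    qed
  qed
  from tendsto_L1_AE_subseq[OF ui this] obtain r where r: "strict_mono (r::nat\<Rightarrow>nat)" 
    "AE x in M. (\<lambda>n. u (r n + N0) x) \<longlonglongrightarrow> 0" by auto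
  then show thesis using that[of "\<lambda>k. r k + N0"] by (auto simp: strict_mono_def)
qed

lemma integrable_approx_bounded:
  fixes f :: "'a::euclidean_space \<Rightarrow> real"
  assumes f: "integrable lebesgue f" and e: "0 < e"
  obtains K :: real where "0 \<le> K" "(LINT x|lebesgue. \<bar>f x - max (-K) (min K (f x))\<bar>) < e"
proof -
  have [measurable]: "f \<in> borel_measurable lebesgue" using f by auto
  have "(\<lambda>k. LINT x|lebesgue. \<bar>f x - max (- real k) (min (real k) (f x))\<bar>) \<longlonglongrightarrow> integral\<^sup>L lebesgue (\<lambda>x::'a. 0::real)"
  proof (rule integral_dominated_convergence[OF _ _ integrable_abs[OF f]])
    show "AE x in lebesgue. (\<lambda>k. \<bar>f x - max (- real k) (min (real k) (f x))\<bar>) \<longlonglongrightarrow> 0"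
    proof (rule AE_I2)
      fix x
      obtain n :: nat where n: "\<bar>f x\<bar> \<le> n" using real_arch_simple by blast
      have "\<forall>\<^sub>F k in sequentially. \<bar>f x - max (- real k) (min (real k) (f x))\<bar> = 0"
        using eventually_ge_at_top[of n] by eventually_elim (use n in auto)
      then show "(\<lambda>k. \<bar>f x - max (- real k) (min (real k) (f x))\<bar>) \<longlonglongrightarrow> 0"
        by (rule tendsto_eventually)
    qed
    show "AE x in lebesgue. norm \<bar>f x - max (- real k) (min (real k) (f x))\<bar> \<le> \<bar>f x\<bar>" for k
      by (rule AE_I2) auto
  qed auto
  then have "\<forall>\<^sub>F k in sequentially. (LINT x|lebesgue. \<bar>f x - max (- real k) (min (real k) (f x))\<bar>) < e"
    using e by (intro order_tendstoD(2)[where a = e]) auto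
  then obtain k :: nat where "(LINT x|lebesgue. \<bar>f x - max (- real k) (min (real k) (f x))\<bar>) < e"
    using eventually_happens by force
  then show thesis using that[of "real k"] by simp
qed

lemma integrable_approx_continuous:
  fixes f :: "'a::euclidean_space \<Rightarrow> real"
  assumes f: "integrable lebesgue f" and S: "S \<in> lmeasurable" and e: "0 < e"
  obtains g K where "continuous_on UNIV g" "\<And>x. \<bar>g x\<bar> \<le> K" "(LINT x:S|lebesgue. \<bar>f x - g x\<bar>) < e"
proof -
  have [measurable]: "f \<in> borel_measurable lebesgue" using f by auto
  have [measurable]: "S \<in> sets lebesgue" using S by auto
  obtain K where K: "0 \<le> K" "(LINT x|lebesgue. \<bar>f x - max (-K) (min K (f x))\<bar>) < e / 2"
    using integrable_approx_bounded[OF f, of "e / 2"] e by auto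
  have "f measurable_on UNIV" by (intro lebesgue_measurable_imp_measurable_on_real) auto
  then obtain N g where N: "negligible N" and g: "\<And>n. continuous_on UNIV (g n)" 
    and lim: "\<And>x. x \<notin> N \<Longrightarrow> (\<lambda>n. g n x) \<longlonglongrightarrow> f x"
    unfolding measurable_on_def by auto
  \<comment> \<open>The continuous approximants come without a dominating function. Truncating them
    and f at the same level K supplies the bound 2K on the set \<open>S\<close> of finite
    measure.\<close>
  define h where "h n x = max (-K) (min K (g n x))" for n x
  define fK where "fK x = max (-K) (min K (f x))" for x
  have h: "continuous_on UNIV (h n)" for n unfolding h_def using g by (intro continuous_intros)
  have [measurable]: "h n \<in> borel_measurable lebesgue" for n
    using borel_measurable_continuous_onI[OF h[of n]] by (intro measurable_completion) simp
  have [measurable]: "fK \<in> borel_measurable lebesgue" unfolding fK_def by measurable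
  have hb: "\<bar>h n x\<bar> \<le> K" "\<bar>fK x\<bar> \<le> K" for n x using K by (auto simp: h_def fK_def)
  have iK: "integrable lebesgue (\<lambda>x. indicator S x * (2 * K))" using S by (simp add: lmeasurable_iff_integrable)
  have "(\<lambda>n. LINT x|lebesgue. indicator S x * \<bar>fK x - h n x\<bar>) \<longlonglongrightarrow> integral\<^sup>L lebesgue (\<lambda>x::'a. 0::real)"
  proof (rule integral_dominated_convergence[OF _ _ iK])
    have "AE x in lebesgue. x \<notin> N" using N by (simp add: negligible_iff_null_sets AE_not_in)
    then show "AE x in lebesgue. (\<lambda>n. indicator S x * \<bar>fK x - h n x\<bar>) \<longlonglongrightarrow> 0"
    proof eventually_elim
      fix x assume "x \<notin> N"
      then have "(\<lambda>n. h n x) \<longlonglongrightarrow> fK x" unfolding h_def fK_def by (intro tendsto_intros lim)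
      then have "(\<lambda>n. indicator S x * \<bar>fK x - h n x\<bar>) \<longlonglongrightarrow> indicator S x * \<bar>fK x - fK x\<bar>" by (intro tendsto_intros)
      then show "(\<lambda>n. indicator S x * \<bar>fK x - h n x\<bar>) \<longlonglongrightarrow> 0" by simp
    qed
    have "\<bar>fK x - h n x\<bar> \<le> 2 * K" for n x using hb(1)[of n x] hb(2)[of x] by linarith
    then show "AE x in lebesgue. norm (indicator S x * \<bar>fK x - h n x\<bar>) \<le> indicator S x * (2 * K)" for n
      by (intro AE_I2) (auto simp: indicator_def)
  qed auto
  then have "\<forall>\<^sub>F n in sequentially. (LINT x|lebesgue. indicator S x * \<bar>fK x - h n x\<bar>) < e / 2"
    using e by (intro order_tendstoD(2)[where a = "e / 2"]) auto
  then obtain n where n: "(LINT x|lebesgue. indicator S x * \<bar>fK x - h n x\<bar>) < e / 2"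
    using eventually_happens by force
  have i1: "integrable lebesgue (\<lambda>x. \<bar>f x - fK x\<bar>)"
    by (rule Bochner_Integration.integrable_bound[OF integrable_abs[OF f]]) (use K in \<open>auto simp: fK_def\<close>)
  have "\<bar>fK x - h n x\<bar> \<le> \<bar>2 * K\<bar>" for x using hb(1)[of n x] hb(2)[of x] by linarith
  then have i2: "integrable lebesgue (\<lambda>x. indicator S x * \<bar>fK x - h n x\<bar>)"
    by (intro Bochner_Integration.integrable_bound[OF iK]) (auto simp: indicator_def intro!: AE_I2)
  have "(LINT x:S|lebesgue. \<bar>f x - h n x\<bar>) \<le> (LINT x|lebesgue. \<bar>f x - fK x\<bar> + indicator S x * \<bar>fK x - h n x\<bar>)"
    unfolding set_lebesgue_integral_def using i1 i2
    by (intro integral_mono' Bochner_Integration.integrable_add) (auto simp: indicator_def)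
  also have "\<dots> = (LINT x|lebesgue. \<bar>f x - fK x\<bar>) + (LINT x|lebesgue. indicator S x * \<bar>fK x - h n x\<bar>)"
    using i1 i2 by (rule Bochner_Integration.integral_add)
  also have "\<dots> < e" using n K(2) by (simp add: fK_def)
  finally show thesis using that[of "h n" K] h hb by blast
qed

text \<open>The conditional expectation of w on the cells of generation N, set to 0 outside the
  cube. Only the leaves carry indicators, so at a given point at most one child contributes.\<close>

primrec dyadic_avg :: "('a::euclidean_space \<Rightarrow> real) \<Rightarrow> nat \<Rightarrow> 'a \<Rightarrow> real \<Rightarrow> 'a \<Rightarrow> real" where
  "dyadic_avg w 0 c l x = (LINT y:hcube c l|lebesgue. w y) / l ^ DIM('a) * indicator (hcube c l) x"
| "dyadic_avg w (Suc N) c l x = (\<Sum>T\<in>Pow Basis. dyadic_avg w N (child_corner c l T) (l / 2) x)"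

lemma dyadic_avg_meas [measurable]: "0 < l \<Longrightarrow> dyadic_avg w N c l \<in> borel_measurable lebesgue"
proof (induction N arbitrary: c l)
  case 0
  then have "hcube c l \<in> sets lebesgue" using hcube_measure(2) by auto
  then show ?case by simp
next
  case (Suc N)
  then show ?case unfolding dyadic_avg.simps by (intro borel_measurable_sum) auto
qed

lemma dyadic_avg_outside: "0 < l \<Longrightarrow> x \<notin> hcube c l \<Longrightarrow> dyadic_avg w N c l x = 0"
proof (induction N arbitrary: c l)
  case (Suc N)
  then have "dyadic_avg w N (child_corner c l T) (l / 2) x = 0" if "T \<in> Pow Basis" for T
    using that hcube_child_subset[of l T c] by (intro Suc.IH) auto
  then show ?case by simp
qed simp

lemma dyadic_avg_Suc_eq:
  fixes c :: "'a::euclidean_space"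
  assumes l: "0 < l" and T: "T \<in> Pow Basis" and x: "x \<in> hcube (child_corner c l T) (l / 2)" 
    and F: "F 0 = (0::'b::comm_monoid_add)"
  shows "(\<Sum>T\<in>Pow Basis. F (dyadic_avg w N (child_corner c l T) (l / 2) x)) = F (dyadic_avg w N (child_corner c l T) (l / 2) x)"
proof -
  have "F (dyadic_avg w N (child_corner c l U) (l / 2) x) = 0" if "U \<in> Pow Basis" "U \<noteq> T" for U
  proof -
    have "x \<notin> hcube (child_corner c l U) (l / 2)"
      using hcube_partition(2)[OF l, of c] that T x unfolding disjoint_family_on_def by blast
    then show ?thesis using dyadic_avg_outside[of "l/2" x "child_corner c l U"] l F by simp
  qed
  then have "(\<Sum>U\<in>Pow Basis. F (dyadic_avg w N (child_corner c l U) (l / 2) x)) = (\<Sum>U\<in>{T}. F (dyadic_avg w N (child_corner c l U) (l / 2) x))"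
    using T by (intro sum.mono_neutral_right) auto
  then show ?thesis by simp
qed

text \<open>At most one summand is nonzero at each point, so even a nonlinear \<open>F\<close> with
  F 0 = 0 passes through the sum over the children. It is applied to powers.\<close>

lemma dyadic_avg_function_Suc:
  fixes c :: "'a::euclidean_space"
  assumes l: "0 < l" and F: "F 0 = (0::'b::comm_monoid_add)"
  shows "F (dyadic_avg w (Suc N) c l x) = (\<Sum>T\<in>Pow Basis. F (dyadic_avg w N (child_corner c l T) (l / 2) x))"
proof (cases "x \<in> hcube c l")
  case True
  then obtain T where T: "T \<in> Pow Basis" "x \<in> hcube (child_corner c l T) (l / 2)"
    using hcube_partition(1)[OF l, of c] by blast
  show ?thesis unfolding dyadic_avg.simps using dyadic_avg_Suc_eq[OF l T, of F, OF F] dyadic_avg_Suc_eq[OF l T, of "\<lambda>x. x", OF refl] by simp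
next
  case False
  have "dyadic_avg w N (child_corner c l T) (l / 2) x = 0" if "T \<in> Pow Basis" for T
    using that False l hcube_child_subset[of l T c] by (intro dyadic_avg_outside) auto
  then show ?thesis using F by simp
qed

lemma dyadic_avg_nonneg: "0 < l \<Longrightarrow> (\<And>x. 0 \<le> w x) \<Longrightarrow> 0 \<le> dyadic_avg w N c l x"
proof (induction N arbitrary: c l)
  case 0 then show ?case by (auto simp: set_lebesgue_integral_def intro!: mult_nonneg_nonneg integral_nonneg_AE)
next
  case (Suc N) then show ?case unfolding dyadic_avg.simps by (intro sum_nonneg) auto
qed

text \<open>Averaging over one cell does not increase the L1 norm there, and the cells are
  disjoint.\<close>

lemma dyadic_avg_contract:
  fixes w g :: "'a::euclidean_space \<Rightarrow> real"
  assumes w: "integrable lebesgue w" and g: "integrable lebesgue g"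
  shows "0 < l \<Longrightarrow> (\<integral>\<^sup>+x. ennreal \<bar>dyadic_avg w N c l x - dyadic_avg g N c l x\<bar> \<partial>lebesgue) \<le> (\<integral>\<^sup>+x\<in>hcube c l. ennreal \<bar>w x - g x\<bar> \<partial>lebesgue)"
proof (induction N arbitrary: c l)
  case (0 c l)
  let ?H = "hcube c l"
  note hm = hcube_measure[OF 0, of c]
  have [measurable]: "?H \<in> sets lebesgue" using hm by auto
  have ln: "l ^ DIM('a) > 0" using 0 by simp
  have iw: "set_integrable lebesgue ?H w" "set_integrable lebesgue ?H g" "set_integrable lebesgue ?H (\<lambda>x. w x - g x)"
    unfolding set_integrable_def using w g by (auto intro!: integrable_mult_indicator simp del: real_scaleR_def)
  have "(\<integral>\<^sup>+x. ennreal \<bar>dyadic_avg w 0 c l x - dyadic_avg g 0 c l x\<bar> \<partial>lebesgue)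
     = (\<integral>\<^sup>+x. ennreal (\<bar>(LINT y:?H|lebesgue. w y - g y)\<bar> / l ^ DIM('a)) * indicator ?H x \<partial>lebesgue)"
    using iw ln by (intro nn_integral_cong) (auto simp: indicator_def set_integral_diff diff_divide_distrib[symmetric] )
  also have "\<dots> = ennreal \<bar>(LINT y:?H|lebesgue. w y - g y)\<bar>"
    using hm ln 0 by (simp add: nn_integral_cmult_indicator ennreal_mult''[symmetric] del: emeasure_completion)
  also have "\<dots> \<le> ennreal (LINT y:?H|lebesgue. \<bar>w y - g y\<bar>)"
    using set_integral_norm_bound[OF iw(3)] by (intro ennreal_leI) simp
  also have "\<dots> = (\<integral>\<^sup>+x. ennreal (indicator ?H x * \<bar>w x - g x\<bar>) \<partial>lebesgue)"
    unfolding set_lebesgue_integral_def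
    by (subst nn_integral_eq_integral) (use iw(3) in \<open>auto simp: set_integrable_def dest: integrable_abs simp: abs_mult\<close>)
  also have "\<dots> = (\<integral>\<^sup>+x\<in>?H. ennreal \<bar>w x - g x\<bar> \<partial>lebesgue)"
    by (intro nn_integral_cong) (auto simp: indicator_def)
  finally show ?case .
next
  case (Suc N c l)
  have l2: "0 < l / 2" using Suc by simp
  note [measurable] = dyadic_avg_meas[OF l2]
  have [measurable]: "w \<in> borel_measurable lebesgue" "g \<in> borel_measurable lebesgue" using w g by auto
  have Hm[measurable]: "hcube (child_corner c l T) (l / 2) \<in> sets lebesgue" for T :: "'a set" using hcube_measure(2)[OF l2] by auto
  have "(\<integral>\<^sup>+x. ennreal \<bar>dyadic_avg w (Suc N) c l x - dyadic_avg g (Suc N) c l x\<bar> \<partial>lebesgue)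
    \<le> (\<integral>\<^sup>+x. (\<Sum>T\<in>Pow Basis. ennreal \<bar>dyadic_avg w N (child_corner c l T) (l / 2) x - dyadic_avg g N (child_corner c l T) (l / 2) x\<bar>) \<partial>lebesgue)"
    by (intro nn_integral_mono) (auto simp: sum_subtractf[symmetric] intro!: ennreal_leI sum_abs)
  also have "\<dots> = (\<Sum>T\<in>Pow Basis. \<integral>\<^sup>+x. ennreal \<bar>dyadic_avg w N (child_corner c l T) (l / 2) x - dyadic_avg g N (child_corner c l T) (l / 2) x\<bar> \<partial>lebesgue)"
    by (intro nn_integral_sum) measurable
  also have "\<dots> \<le> (\<Sum>T\<in>Pow Basis. \<integral>\<^sup>+x\<in>hcube (child_corner c l T) (l / 2). ennreal \<bar>w x - g x\<bar> \<partial>lebesgue)"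
    using l2 by (intro sum_mono Suc.IH)
  also have "\<dots> = (\<integral>\<^sup>+x. (\<Sum>T\<in>Pow Basis. ennreal \<bar>w x - g x\<bar> * indicator (hcube (child_corner c l T) (l / 2)) x) \<partial>lebesgue)"
    by (intro nn_integral_sum[symmetric]) measurable
  also have "\<dots> = (\<integral>\<^sup>+x\<in>hcube c l. ennreal \<bar>w x - g x\<bar> \<partial>lebesgue)"
    unfolding sum_distrib_left[symmetric] hcube_partition(1)[OF Suc.prems, of c]
    using hcube_partition(2)[OF Suc.prems, of c] by (subst indicator_UN_disjoint) auto
  finally show ?case .
qed

lemma hcube_dist: "x \<in> hcube c l \<Longrightarrow> y \<in> hcube c l \<Longrightarrow> dist x y \<le> real DIM('a) * l" for c :: "'a::euclidean_space"
proof -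
  assume "x \<in> hcube c l" "y \<in> hcube c l"
  then have "\<bar>(x - y) \<bullet> i\<bar> \<le> l" if "i \<in> Basis" for i using that by (force simp: hcube_def inner_diff_left)
  then have "(\<Sum>i\<in>Basis. \<bar>(x - y) \<bullet> i\<bar>) \<le> (\<Sum>i\<in>(Basis::'a set). l)" by (intro sum_mono)
  then show ?thesis using norm_le_l1[of "x - y"] by (simp add: dist_norm)
qed

text \<open>Two points of a cell of generation N are at most n l / 2^N apart, so g varies by at most
  \<eta> over the cell.\<close>

lemma dyadic_avg_uniform:
  fixes g :: "'a::euclidean_space \<Rightarrow> real"
  assumes g: "integrable lebesgue g" and d: "\<And>x y. x \<in> Q \<Longrightarrow> y \<in> Q \<Longrightarrow> dist x y \<le> d \<Longrightarrow> \<bar>g x - g y\<bar> \<le> \<eta>"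
  shows "0 < l \<Longrightarrow> hcube c l \<subseteq> Q \<Longrightarrow> real DIM('a) * (l / 2 ^ N) \<le> d \<Longrightarrow> x \<in> hcube c l \<Longrightarrow> \<bar>dyadic_avg g N c l x - g x\<bar> \<le> \<eta>"
proof (induction N arbitrary: c l)
  case (0 c l)
  let ?H = "hcube c l"
  note hm = hcube_measure[OF 0(1), of c]
  have [measurable]: "?H \<in> sets lebesgue" using hm by auto
  have ln: "l ^ DIM('a) > 0" using 0 by simp
  have ig: "set_integrable lebesgue ?H g"
    unfolding set_integrable_def using g by (auto intro!: integrable_mult_indicator simp del: real_scaleR_def)
  have ic: "set_integrable lebesgue ?H (\<lambda>_. k)" for k :: real
    using hm by (simp add: set_integrable_def)
  have c: "(LINT y:?H|lebesgue. k) = k * l ^ DIM('a)" for k :: real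
    using hm by (simp add: set_lebesgue_integral_def)
  have ub: "g y \<le> g x + \<eta>" "g x - \<eta> \<le> g y" if "y \<in> ?H" for y
    using hcube_dist[OF that 0(4)] 0(2,3,4) that d[of x y] by (force simp: dist_commute)+
  have "(LINT y:?H|lebesgue. g y) \<le> (g x + \<eta>) * l ^ DIM('a)"
    unfolding c[symmetric] by (intro set_integral_mono ig ic ub)
  moreover have "(g x - \<eta>) * l ^ DIM('a) \<le> (LINT y:?H|lebesgue. g y)"
    unfolding c[symmetric] by (intro set_integral_mono ig ic ub)
  ultimately have "(LINT y:?H|lebesgue. g y) / l ^ DIM('a) \<le> g x + \<eta>" "g x - \<eta> \<le> (LINT y:?H|lebesgue. g y) / l ^ DIM('a)"
    using ln by (auto simp: pos_divide_le_eq pos_le_divide_eq)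
  then show ?case using 0(4) by simp
next
  case (Suc N c l)
  obtain T where T: "T \<in> Pow Basis" "x \<in> hcube (child_corner c l T) (l / 2)"
    using hcube_partition(1)[OF Suc.prems(1), of c] Suc.prems by blast
  have "\<bar>dyadic_avg g N (child_corner c l T) (l / 2) x - g x\<bar> \<le> \<eta>"
    using Suc.prems T hcube_child_subset[OF Suc.prems(1) T(1), of c] by (intro Suc.IH) auto
  then show ?case unfolding dyadic_avg.simps using dyadic_avg_Suc_eq[OF Suc.prems(1) T, of "\<lambda>x. x", OF refl] by simp
qed

text \<open>A three-epsilon argument in L1: w is approximated on the cube by a continuous g, the
  averages of g converge uniformly, and averaging w - g does not increase its norm
  (\<open>dyadic_avg_contract\<close>).\<close>

lemma dyadic_avg_tendsto_subseq:
  fixes w :: "'a::euclidean_space \<Rightarrow> real"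
  assumes w: "integrable lebesgue w" and l: "0 < l"
  obtains r where "strict_mono (r::nat\<Rightarrow>nat)" "AE x in lebesgue. x \<in> hcube c l \<longrightarrow> (\<lambda>k. dyadic_avg w (r k) c l x) \<longlonglongrightarrow> w x"
proof -
  let ?H = "hcube c l"
  note hm = hcube_measure[OF l, of c]
  have Hm[measurable]: "?H \<in> sets lebesgue" using hm by auto
  note [measurable] = dyadic_avg_meas[OF l]
  have wm[measurable]: "w \<in> borel_measurable lebesgue" using w by auto
  define u where "u N x = indicator ?H x * (dyadic_avg w N c l x - w x)" for N x
  have um[measurable]: "u N \<in> borel_measurable lebesgue" for N unfolding u_def by measurable
  have key: "\<exists>N0. \<forall>N\<ge>N0. (\<integral>\<^sup>+x. ennreal (norm (u N x)) \<partial>lebesgue) \<le> ennreal e" if e: "0 < e" for e :: real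
  proof -
    have e3: "e / 3 > 0" using e by simp
    obtain g K where g: "continuous_on UNIV g" "\<And>x. \<bar>g x\<bar> \<le> K" "(LINT x:?H|lebesgue. \<bar>w x - g x\<bar>) < e / 3"
      using integrable_approx_continuous[OF w hm(2) e3] by blast
    have [measurable]: "g \<in> borel_measurable lebesgue" using borel_measurable_continuous_onI[OF g(1)] by (intro measurable_completion) simp
    define C where "C = cbox c (c + l *\<^sub>R One)"
    \<comment> \<open>The cut-off makes the continuous approximant integrable on the whole space
      without changing it on the cube.\<close>
    define g' where "g' x = indicator C x * g x" for x
    have C: "C \<in> lmeasurable" "?H \<subseteq> C" using hm by (auto simp: C_def)
    have [measurable]: "C \<in> sets lebesgue" using C by auto
    have gi: "integrable lebesgue g'"
      unfolding g'_def
    proof (rule Bochner_Integration.integrable_bound[where f="\<lambda>x. indicator C x * K"])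
      show "integrable lebesgue (\<lambda>x. indicator C x * K)" using C by (simp add: lmeasurable_iff_integrable)
      have "K \<ge> 0" using g(2)[of c] by linarith
      then show "AE x in lebesgue. norm (indicator C x * g x) \<le> norm (indicator C x * K)" using g(2) by (intro AE_I2) (auto simp: indicator_def)
    qed measurable
    have "uniformly_continuous_on C g" unfolding C_def using g(1) by (intro compact_uniformly_continuous) (auto intro: continuous_on_subset)
    define \<eta> where "\<eta> = e / 3 / l ^ DIM('a)"
    have \<eta>: "\<eta> > 0" using e l by (simp add: \<eta>_def)
    obtain d where d: "d > 0" "\<And>x y. x \<in> C \<Longrightarrow> y \<in> C \<Longrightarrow> dist x y < d \<Longrightarrow> dist (g x) (g y) < \<eta>"
      using uniformly_continuous_onE[OF \<open>uniformly_continuous_on C g\<close> \<eta>] by metis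
    have d2: "\<bar>g' x - g' y\<bar> \<le> \<eta>" if "x \<in> ?H" "y \<in> ?H" "dist x y \<le> d / 2" for x y
    proof -
      have "x \<in> C" "y \<in> C" using that C by auto
      moreover have "dist x y < d" using that d(1) by simp
      ultimately show ?thesis using d(2)[of x y] d(2)[of y x] by (simp add: g'_def dist_real_def dist_commute)
    qed
    have "(\<lambda>N. real DIM('a) * l * (1/2) ^ N) \<longlonglongrightarrow> real DIM('a) * l * 0"
      by (intro tendsto_intros LIMSEQ_realpow_zero) auto
    then have "\<forall>\<^sub>F N in sequentially. real DIM('a) * l * (1/2) ^ N < d / 2"
      using d by (intro order_tendstoD(2)) auto
    then obtain N0 where N0: "\<And>N. N \<ge> N0 \<Longrightarrow> real DIM('a) * l * (1/2) ^ N < d / 2"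
      by (auto simp: eventually_sequentially)
    have "(\<integral>\<^sup>+x. ennreal (norm (u N x)) \<partial>lebesgue) \<le> ennreal e" if N: "N \<ge> N0" for N
    proof -
      have unif: "\<bar>dyadic_avg g' N c l x - g' x\<bar> \<le> \<eta>" if "x \<in> ?H" for x
        by (rule dyadic_avg_uniform[OF gi _ l order_refl _ that, where d = "d / 2"]) 
           (use N0[OF N] d2 in \<open>auto simp: power_divide\<close>)
      have wg: "(\<integral>\<^sup>+x\<in>?H. ennreal \<bar>w x - g' x\<bar> \<partial>lebesgue) \<le> ennreal (e / 3)"
      proof -
        have "integrable lebesgue (\<lambda>x. indicator ?H x * \<bar>w x - g' x\<bar>)"
          using integrable_mult_indicator[of ?H lebesgue "\<lambda>x. \<bar>w x - g' x\<bar>"] w gi by auto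
        then have "(\<integral>\<^sup>+x. ennreal (indicator ?H x * \<bar>w x - g' x\<bar>) \<partial>lebesgue) = ennreal (LINT x|lebesgue. indicator ?H x * \<bar>w x - g' x\<bar>)"
          by (intro nn_integral_eq_integral) auto
        also have "(LINT x|lebesgue. indicator ?H x * \<bar>w x - g' x\<bar>) = (LINT x:?H|lebesgue. \<bar>w x - g x\<bar>)"
          unfolding set_lebesgue_integral_def using C by (intro Bochner_Integration.integral_cong) (auto simp: indicator_def g'_def)
        also have "ennreal \<dots> \<le> ennreal (e / 3)" using g(3) by (intro ennreal_leI) simp
        finally show ?thesis by (simp add: ennreal_mult' mult.commute ennreal_indicator)
      qed
      have "(\<integral>\<^sup>+x. ennreal (norm (u N x)) \<partial>lebesgue) \<le> 
        (\<integral>\<^sup>+x. ennreal \<bar>dyadic_avg w N c l x - dyadic_avg g' N c l x\<bar> + (ennreal \<eta> * indicator ?H x + ennreal \<bar>w x - g' x\<bar> * indicator ?H x) \<partial>lebesgue)"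
      proof (intro nn_integral_mono)
        fix x
        show "ennreal (norm (u N x)) \<le> ennreal \<bar>dyadic_avg w N c l x - dyadic_avg g' N c l x\<bar> + (ennreal \<eta> * indicator ?H x + ennreal \<bar>w x - g' x\<bar> * indicator ?H x)"
        proof (cases "x \<in> ?H")
          case True
          have "\<bar>dyadic_avg w N c l x - w x\<bar> \<le> \<bar>dyadic_avg w N c l x - dyadic_avg g' N c l x\<bar> + (\<eta> + \<bar>w x - g' x\<bar>)" using unif[OF True] by linarith
          then have "ennreal \<bar>dyadic_avg w N c l x - w x\<bar> \<le> ennreal (\<bar>dyadic_avg w N c l x - dyadic_avg g' N c l x\<bar> + (\<eta> + \<bar>w x - g' x\<bar>))" by (rule ennreal_leI)
          then show ?thesis using True \<eta> by (simp add: u_def)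
        qed (simp add: u_def)
      qed
      also have "\<dots> = (\<integral>\<^sup>+x. ennreal \<bar>dyadic_avg w N c l x - dyadic_avg g' N c l x\<bar> \<partial>lebesgue) + 
         (ennreal \<eta> * emeasure lebesgue ?H + (\<integral>\<^sup>+x\<in>?H. ennreal \<bar>w x - g' x\<bar> \<partial>lebesgue))"
        using gi by (subst nn_integral_add) (auto simp: nn_integral_add nn_integral_cmult_indicator simp del: emeasure_completion)
      also have "ennreal \<eta> * emeasure lebesgue ?H = ennreal (e / 3)"
        using l e unfolding hm(4) by (simp add: ennreal_mult''[symmetric] \<eta>_def)
      also have "(\<integral>\<^sup>+x. ennreal \<bar>dyadic_avg w N c l x - dyadic_avg g' N c l x\<bar> \<partial>lebesgue) + (ennreal (e / 3) + (\<integral>\<^sup>+x\<in>?H. ennreal \<bar>w x - g' x\<bar> \<partial>lebesgue))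
        \<le> ennreal (e / 3) + (ennreal (e / 3) + ennreal (e / 3))"
        by (intro add_mono wg order_trans[OF dyadic_avg_contract[OF w gi l] wg] order_refl)
      also have "\<dots> = ennreal e" using e by (simp add: ennreal_plus[symmetric] del: ennreal_plus)
      finally show ?thesis .
    qed
    then show ?thesis by blast
  qed
  obtain r where r: "strict_mono (r::nat\<Rightarrow>nat)" "AE x in lebesgue. (\<lambda>k. u (r k) x) \<longlonglongrightarrow> 0"
    by (rule L1_AE_subseq[of u lebesgue]) (use key in auto)
  have "AE x in lebesgue. x \<in> ?H \<longrightarrow> (\<lambda>k. dyadic_avg w (r k) c l x) \<longlonglongrightarrow> w x"
    using r(2)
  proof eventually_elim
    case (elim x)
    then show ?case by (auto simp: u_def LIM_zero_iff)
  qed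
  with r(1) show thesis by (rule that)
qed

lemma density_measure:
  fixes w :: "'a::euclidean_space \<Rightarrow> real"
  assumes w: "integrable lebesgue w" "\<And>x. 0 \<le> w x"
  shows "finite_measure (density lebesgue (\<lambda>x. ennreal (w x)))" 
    "S \<in> sets lebesgue \<Longrightarrow> measure (density lebesgue (\<lambda>x. ennreal (w x))) S = (LINT x:S|lebesgue. w x)"
proof -
  have [measurable]: "w \<in> borel_measurable lebesgue" using w by auto
  have *: "emeasure (density lebesgue (\<lambda>x. ennreal (w x))) S = ennreal (LINT x:S|lebesgue. w x)" 
    if S[measurable]: "S \<in> sets lebesgue" for S
  proof -
    have "emeasure (density lebesgue (\<lambda>x. ennreal (w x))) S = (\<integral>\<^sup>+x. ennreal (indicator S x * w x) \<partial>lebesgue)"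
      by (subst emeasure_density) (auto intro!: nn_integral_cong simp: indicator_def)
    also have "\<dots> = ennreal (LINT x:S|lebesgue. w x)"
      unfolding set_lebesgue_integral_def real_scaleR_def
      using integrable_mult_indicator[OF S w(1)] w(2) by (intro nn_integral_eq_integral) auto
    finally show ?thesis .
  qed
  show "finite_measure (density lebesgue (\<lambda>x. ennreal (w x)))"
    using *[of UNIV] by (intro finite_measureI) simp
  show "measure (density lebesgue (\<lambda>x. ennreal (w x))) S = (LINT x:S|lebesgue. w x)" if "S \<in> sets lebesgue"
    using *[OF that] w(2) by (simp add: measure_def set_lebesgue_integral_def integral_nonneg_AE)
qed

lemma cell_powr_sum_nonneg: "0 < l \<Longrightarrow> 0 \<le> cell_powr_sum \<nu> e N c l"
  by (induction N arbitrary: c l) (auto intro!: sum_nonneg)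

lemma nn_integral_En_powr:
  fixes w :: "'a::euclidean_space \<Rightarrow> real"
  assumes w: "integrable lebesgue w" "\<And>x. 0 \<le> w x" and e: "0 \<le> e"
  shows "0 < l \<Longrightarrow> (\<integral>\<^sup>+x. ennreal (dyadic_avg w N c l x powr (1 + e)) \<partial>lebesgue) = ennreal (cell_powr_sum (density lebesgue (\<lambda>x. ennreal (w x))) e N c l)"
proof (induction N arbitrary: c l)
  case (0 c l)
  let ?W = "LINT y:hcube c l|lebesgue. w y" and ?n = "DIM('a)"
  note hm = hcube_measure[OF 0, of c]
  have H: "hcube c l \<in> sets lebesgue" using hm by auto
  have ln: "l ^ ?n > 0" using 0 by simp
  have W: "?W \<ge> 0" using w(2) by (simp add: set_lebesgue_integral_def integral_nonneg_AE)
  have "(\<integral>\<^sup>+x. ennreal (dyadic_avg w 0 c l x powr (1 + e)) \<partial>lebesgue) = (\<integral>\<^sup>+x. ennreal ((?W / l ^ ?n) powr (1 + e)) * indicator (hcube c l) x \<partial>lebesgue)"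
    using e by (intro nn_integral_cong) (auto simp: indicator_def)
  also have "\<dots> = ennreal ((?W / l ^ ?n) powr (1 + e) * l ^ ?n)"
    using hm(4) H ln by (simp add: nn_integral_cmult_indicator ennreal_mult''[symmetric] del: emeasure_completion)
  also have "(?W / l ^ ?n) powr (1 + e) * l ^ ?n = ?W * (?W / l ^ ?n) powr e"
    using W ln 0 by (cases "?W = 0") (auto simp: powr_add)
  finally show ?case using density_measure(2)[OF w H] by simp
next
  case (Suc N c l)
  have l2: "0 < l / 2" using Suc by simp
  note [measurable] = dyadic_avg_meas[OF l2]
  have "(\<integral>\<^sup>+x. ennreal (dyadic_avg w (Suc N) c l x powr (1 + e)) \<partial>lebesgue)
     = (\<integral>\<^sup>+x. (\<Sum>T\<in>Pow Basis. ennreal (dyadic_avg w N (child_corner c l T) (l / 2) x powr (1 + e))) \<partial>lebesgue)"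
    by (intro nn_integral_cong dyadic_avg_function_Suc[OF Suc.prems, of "\<lambda>y. ennreal (y powr (1 + e))"]) simp
  also have "\<dots> = (\<Sum>T\<in>Pow Basis. \<integral>\<^sup>+x. ennreal (dyadic_avg w N (child_corner c l T) (l / 2) x powr (1 + e)) \<partial>lebesgue)"
    by (intro nn_integral_sum) measurable
  also have "\<dots> = (\<Sum>T\<in>Pow Basis. ennreal (cell_powr_sum (density lebesgue (\<lambda>x. ennreal (w x))) e N (child_corner c l T) (l / 2)))"
    using Suc.IH[OF l2] by simp
  also have "\<dots> = ennreal (cell_powr_sum (density lebesgue (\<lambda>x. ennreal (w x))) e (Suc N) c l)"
    unfolding cell_powr_sum.simps by (subst sum_ennreal) (use cell_powr_sum_nonneg[OF l2] in auto)
  finally show ?case .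
qed

text \<open>The bound for the conditional expectations does not depend on the generation, and
  Fatou's lemma along an almost everywhere convergent subsequence carries it over to w. The factor
  4/b is the self-reproducing constant of \<open>tree_exponent\<close>.\<close>

lemma reverse_hoelder_hcube:
  fixes w :: "'a::euclidean_space \<Rightarrow> real"
  assumes w: "integrable lebesgue w" "\<And>x. 0 \<le> w x" and b: "0 < b" "b < 1" and e: "0 \<le> e" 
    and be: "(4 / b) * (2 * 2 ^ DIM('a)) powr e * (1 - b) + 2 powr e \<le> 4 / b" and l: "0 < l"
    and Ainf: "\<And>c' l' E. 0 < l' \<Longrightarrow> hcube c' l' \<subseteq> hcube c l \<Longrightarrow> E \<subseteq> hcube c' l' \<Longrightarrow> E \<in> sets lebesgue \<Longrightarrow>
        l' ^ DIM('a) / 2 \<le> measure lebesgue E \<Longrightarrow> b * (LINT x:hcube c' l'|lebesgue. w x) \<le> (LINT x:E|lebesgue. w x)"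
  defines "W \<equiv> (LINT x:hcube c l|lebesgue. w x)"
  shows "(\<integral>\<^sup>+x\<in>hcube c l. ennreal (w x powr (1 + e)) \<partial>lebesgue) \<le> ennreal (4 / b * W * (W / l ^ DIM('a)) powr e)"
proof -
  let ?H = "hcube c l" and ?\<nu> = "density lebesgue (\<lambda>x. ennreal (w x))"
  note hm = hcube_measure[OF l, of c]
  have H[measurable]: "?H \<in> sets lebesgue" using hm by auto
  note [measurable] = dyadic_avg_meas[OF l]
  note dm = density_measure[OF w]
  have S: "cell_powr_sum ?\<nu> e N c l \<le> 4 / b * W * (W / l ^ DIM('a)) powr e" for N
  proof -
    have "cell_powr_sum ?\<nu> e N c l \<le> 4 / b * measure ?\<nu> ?H * (measure ?\<nu> ?H / l ^ DIM('a)) powr e"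
    proof (rule cell_powr_sum_bound[OF dm(1) _ _ e b(1) _ be _ l order_refl])
      fix c' :: 'a and l' E assume E: "0 < l'" "hcube c' l' \<subseteq> ?H" "E \<subseteq> hcube c' l'" "E \<in> sets lebesgue" "l' ^ DIM('a) / 2 \<le> measure lebesgue E"
      have "hcube c' l' \<in> sets lebesgue" using hcube_measure(2)[OF E(1)] by auto
      then show "b * measure ?\<nu> (hcube c' l') \<le> measure ?\<nu> E" using Ainf[OF E] dm(2) E(4) by simp
    qed (use b in \<open>auto simp: field_simps\<close>)
    then show ?thesis using dm(2)[OF H] by (simp add: W_def)
  qed
  obtain r where r: "strict_mono (r::nat\<Rightarrow>nat)" "AE x in lebesgue. x \<in> ?H \<longrightarrow> (\<lambda>k. dyadic_avg w (r k) c l x) \<longlonglongrightarrow> w x"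
    using dyadic_avg_tendsto_subseq[OF w(1) l] by blast
  have "(\<integral>\<^sup>+x\<in>?H. ennreal (w x powr (1 + e)) \<partial>lebesgue) \<le> (\<integral>\<^sup>+x. liminf (\<lambda>k. ennreal (dyadic_avg w (r k) c l x powr (1 + e))) \<partial>lebesgue)"
  proof (rule nn_integral_mono_AE)
    show "AE x in lebesgue. ennreal (w x powr (1 + e)) * indicator ?H x \<le> liminf (\<lambda>k. ennreal (dyadic_avg w (r k) c l x powr (1 + e)))"
      using r(2)
    proof eventually_elim
      case (elim x)
      show ?case
      proof (cases "x \<in> ?H")
        case True
        have "(\<lambda>k. ennreal (dyadic_avg w (r k) c l x powr (1 + e))) \<longlonglongrightarrow> ennreal (w x powr (1 + e))"
          using elim True e w(2) dyadic_avg_nonneg[OF l w(2)] by (intro tendsto_ennrealI tendsto_powr' tendsto_const) (auto intro!: always_eventually)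
        then have "liminf (\<lambda>k. ennreal (dyadic_avg w (r k) c l x powr (1 + e))) = ennreal (w x powr (1 + e))"
          by (intro lim_imp_Liminf) auto
        then show ?thesis using True by simp
      qed simp
    qed
  qed
  also have "\<dots> \<le> liminf (\<lambda>k. \<integral>\<^sup>+x. ennreal (dyadic_avg w (r k) c l x powr (1 + e)) \<partial>lebesgue)"
    by (intro nn_integral_liminf) measurable
  also have "\<dots> \<le> limsup (\<lambda>k. \<integral>\<^sup>+x. ennreal (dyadic_avg w (r k) c l x powr (1 + e)) \<partial>lebesgue)"
    by (intro Liminf_le_Limsup) simp
  also have "\<dots> \<le> ennreal (4 / b * W * (W / l ^ DIM('a)) powr e)"
    using S unfolding nn_integral_En_powr[OF w e l] by (intro Limsup_bounded always_eventually allI ennreal_leI)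
  finally show ?thesis .
qed

context double_phase_A
begin

text \<open>The factor (1/2)^q is the price of replacing t by t/2, a lower bound for the mean of t
  1_E over a cube when E fills half of it; the denominator is the constant of
  \<open>averaging_hom\<close>.\<close>

definition ainf_const :: real where "ainf_const = (1 / 2) powr q / (1 + avg_const powr q)"

lemma ainf_const: "0 < ainf_const" "ainf_const < 1"
proof -
  have "(1 / 2 :: real) powr q \<le> 1" using p1 pq by (intro powr_le1) auto
  moreover have k: "avg_const powr q > 0" using avg_const_ge by simp
  ultimately have "(1 / 2) powr q < 1 + avg_const powr q" by linarith
  then show "0 < ainf_const" "ainf_const < 1" using k unfolding ainf_const_def by (simp_all add: add_pos_pos)
qed

text \<open>Averaging is applied to t 1_E, whose mean over the cube is t |E|/|Q| >= t/2. A free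
  positive bound d for the modular over E also covers sets on which that modular vanishes.\<close>

lemma ph_A_infinity:
  assumes t: "0 \<le> t" and l: "0 < l" and E: "E \<subseteq> hcube c l" "E \<in> sets lebesgue" "l ^ DIM('a) / 2 \<le> measure lebesgue E"
    and d: "0 < d" "d \<le> 1" "(\<integral>\<^sup>+x\<in>E. ennreal (ph x t) \<partial>lebesgue) \<le> ennreal d"
  shows "ennreal ainf_const * (\<integral>\<^sup>+x\<in>hcube c l. ennreal (ph x t) \<partial>lebesgue) \<le> ennreal d"
proof -
  define Q where "Q = cbox c (c + l *\<^sub>R One)"
  have Q: "Q \<in> cubes" using l by (auto simp: Q_def cubes_def)
  note hm = hcube_measure[OF l, of c]
  have EQ: "E \<subseteq> Q" using E hm by (auto simp: Q_def)
  have [measurable]: "E \<in> sets lebesgue" "Q \<in> sets lebesgue" using E cube_emeasure[OF Q] by auto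
  have fE: "E \<in> lmeasurable" by (rule fmeasurableI2[OF hm(2) E(1,2)])
  define f where "f x = t * indicator E x" for x
  have [measurable]: "f \<in> borel_measurable lebesgue" unfolding f_def by measurable
  have f0: "0 \<le> f x" for x using t by (simp add: f_def)
  have "(\<integral>\<^sup>+x\<in>Q. ennreal (ph x (f x)) \<partial>lebesgue) = (\<integral>\<^sup>+x\<in>E. ennreal (ph x t) \<partial>lebesgue)"
    using EQ by (intro nn_integral_cong) (auto simp: f_def indicator_def)
  then have le: "(\<integral>\<^sup>+x\<in>Q. ennreal (ph x (f x)) \<partial>lebesgue) \<le> ennreal d" using d by simp
  have "(\<integral>\<^sup>+x\<in>Q. ennreal (f x) \<partial>lebesgue) = (\<integral>\<^sup>+x. ennreal t * indicator E x \<partial>lebesgue)"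
    using EQ by (intro nn_integral_cong) (auto simp: f_def indicator_def)
  also have "\<dots> = ennreal (t * measure lebesgue E)"
    using t fE by (subst nn_integral_cmult_indicator) (auto simp: emeasure_eq_measure2 ennreal_mult'' simp del: emeasure_completion)
  finally have fi: "enn2real (\<integral>\<^sup>+x\<in>Q. ennreal (f x) \<partial>lebesgue) = t * measure lebesgue E" using t by simp
  have mQ: "measure lebesgue Q = l ^ DIM('a)" using hm by (simp add: Q_def)
  have av: "(\<integral>\<^sup>+x\<in>Q. ennreal (ph x (t * measure lebesgue E / l ^ DIM('a))) \<partial>lebesgue) \<le> ennreal ((1 + avg_const powr q) * d)"
    using averaging_hom(2)[OF Q _ f0 d(1,2) le] unfolding fi mQ by simp
  have "t / 2 \<le> t * measure lebesgue E / l ^ DIM('a)"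
    using mult_left_mono[OF E(3) t] l by (simp add: field_simps)
  then have pt: "(1/2) powr q * ph x t \<le> ph x (t * measure lebesgue E / l ^ DIM('a))" for x
  proof -
    have "ph x t \<le> 2 powr q * ph x (t / 2)" using ph_scale_le[of "t / 2" 2 x] t by simp
    then have "(1/2) powr q * ph x t \<le> (1/2) powr q * (2 powr q * ph x (t / 2))" by (intro mult_left_mono) auto
    also have "\<dots> = ph x (t / 2)" by (simp add: powr_divide)
    also have "\<dots> \<le> ph x (t * measure lebesgue E / l ^ DIM('a))" using t \<open>t / 2 \<le> _\<close> by (intro ph_mono) auto
    finally show ?thesis .
  qed
  have k: "1 + avg_const powr q > 0" using avg_const_ge by (simp add: add_pos_nonneg)
  have [measurable]: "(\<lambda>x. ph x t) \<in> borel_measurable lebesgue" by measurable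
  have [measurable]: "hcube c l \<in> sets lebesgue" using hm by auto
  have "ennreal ((1/2) powr q) * (\<integral>\<^sup>+x\<in>hcube c l. ennreal (ph x t) \<partial>lebesgue) 
     = (\<integral>\<^sup>+x. ennreal ((1/2) powr q) * (ennreal (ph x t) * indicator (hcube c l) x) \<partial>lebesgue)"
    by (intro nn_integral_cmult[symmetric]) measurable
  also have "\<dots> \<le> (\<integral>\<^sup>+x\<in>Q. ennreal (ph x (t * measure lebesgue E / l ^ DIM('a))) \<partial>lebesgue)"
    using pt hm(6) by (intro nn_integral_mono) (auto simp: indicator_def Q_def ennreal_mult'[symmetric] intro!: ennreal_leI)
  also note av
  finally have *: "ennreal ((1/2) powr q) * (\<integral>\<^sup>+x\<in>hcube c l. ennreal (ph x t) \<partial>lebesgue) \<le> ennreal ((1 + avg_const powr q) * d)" .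
  have "ennreal ainf_const = ennreal (1 / (1 + avg_const powr q)) * ennreal ((1/2) powr q)"
    using k by (simp add: ainf_const_def ennreal_mult'[symmetric])
  then have "ennreal ainf_const * (\<integral>\<^sup>+x\<in>hcube c l. ennreal (ph x t) \<partial>lebesgue) \<le> ennreal (1 / (1 + avg_const powr q)) * ennreal ((1 + avg_const powr q) * d)"
    using mult_left_mono[OF *, of "ennreal (1 / (1 + avg_const powr q))"] by (simp add: mult.assoc)
  also have "\<dots> = ennreal d" using k d by (simp add: ennreal_mult'[symmetric])
  finally show ?thesis .
qed

text \<open>The weight \<open>ph x t\<close> is cut off to the half-open cube, where the hypothesis
  makes it integrable. The resulting bound increases with the total mass, so d may take the place of
  that mass.\<close>

lemma reverse_hoelder_ph:
  assumes t: "0 \<le> t" and l: "0 < l" and d: "0 < d" "d \<le> 1" 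
    and le: "(\<integral>\<^sup>+x\<in>cbox c (c + l *\<^sub>R One). ennreal (ph x t) \<partial>lebesgue) \<le> ennreal d"
    and e: "0 \<le> e" and be: "(4 / ainf_const) * (2 * 2 ^ DIM('a)) powr e * (1 - ainf_const) + 2 powr e \<le> 4 / ainf_const"
  shows "(\<integral>\<^sup>+x\<in>cbox c (c + l *\<^sub>R One). ennreal (ph x t powr (1 + e)) \<partial>lebesgue) \<le> ennreal (4 / ainf_const * d * (d / l ^ DIM('a)) powr e)"
proof -
  let ?H = "hcube c l" and ?C = "cbox c (c + l *\<^sub>R One)"
  note hm = hcube_measure[OF l, of c]
  have [measurable]: "?H \<in> sets lebesgue" using hm by auto
  have HC: "AE x in lebesgue. x \<in> ?C \<longleftrightarrow> x \<in> ?H"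
    using AE_not_in[OF hm(7)] by eventually_elim (use hm(6) in auto)
  have eq: "(\<integral>\<^sup>+x\<in>?C. F x \<partial>lebesgue) = (\<integral>\<^sup>+x\<in>?H. F x \<partial>lebesgue)" for F :: "'a \<Rightarrow> ennreal"
    by (intro nn_integral_cong_AE, use HC in eventually_elim) (auto simp: indicator_def)
  define w where "w x = indicator ?H x * ph x t" for x
  have [measurable]: "w \<in> borel_measurable lebesgue" unfolding w_def by measurable
  have w0: "0 \<le> w x" for x by (simp add: w_def)
  have wn: "(\<integral>\<^sup>+x. ennreal (w x) \<partial>lebesgue) = (\<integral>\<^sup>+x\<in>?H. ennreal (ph x t) \<partial>lebesgue)"
    by (intro nn_integral_cong) (auto simp: w_def indicator_def)
  have wle: "(\<integral>\<^sup>+x. ennreal (w x) \<partial>lebesgue) \<le> ennreal d" using le unfolding wn eq .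
  have wi: "integrable lebesgue w"
    using wle w0 by (intro integrableI_nonneg) (auto intro: le_less_trans)
  have wS: "(\<integral>\<^sup>+x\<in>S. ennreal (ph x t) \<partial>lebesgue) = ennreal (LINT x:S|lebesgue. w x)" if S[measurable]: "S \<in> sets lebesgue" and SH: "S \<subseteq> ?H" for S
  proof -
    have "(\<integral>\<^sup>+x\<in>S. ennreal (ph x t) \<partial>lebesgue) = (\<integral>\<^sup>+x. ennreal (indicator S x * w x) \<partial>lebesgue)"
      using SH by (intro nn_integral_cong) (auto simp: w_def indicator_def)
    also have "\<dots> = ennreal (LINT x:S|lebesgue. w x)"
      unfolding set_lebesgue_integral_def real_scaleR_def
      using integrable_mult_indicator[OF S wi] w0 by (intro nn_integral_eq_integral) auto
    finally show ?thesis .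
  qed
  have L0: "0 \<le> (LINT x:S|lebesgue. w x)" for S using w0 by (simp add: set_lebesgue_integral_def integral_nonneg_AE)
  define W where "W = (LINT x:?H|lebesgue. w x)"
  have Wd: "W \<le> d" using wle unfolding wn using wS[of ?H] d L0[of ?H] by (simp add: W_def)
  have W0: "0 \<le> W" using L0 by (simp add: W_def)
  have "(\<integral>\<^sup>+x\<in>?H. ennreal (w x powr (1 + e)) \<partial>lebesgue) \<le> ennreal (4 / ainf_const * W * (W / l ^ DIM('a)) powr e)"
    unfolding W_def
  proof (rule reverse_hoelder_hcube[OF wi w0 ainf_const e be l])
    fix c' :: 'a and l' E assume E: "0 < l'" "hcube c' l' \<subseteq> ?H" "E \<subseteq> hcube c' l'" "E \<in> sets lebesgue" "l' ^ DIM('a) / 2 \<le> measure lebesgue E"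
    have h': "hcube c' l' \<in> sets lebesgue" using hcube_measure(2)[OF E(1)] by auto
    have EH: "E \<subseteq> ?H" using E by auto
    define I where "I = (LINT x:E|lebesgue. w x)"
    show "ainf_const * (LINT x:hcube c' l'|lebesgue. w x) \<le> (LINT x:E|lebesgue. w x)"
    \<comment> \<open>The averaging bound is available only for modulars at most 1. If
      \<open>I\<close> < 1, it is applied with I + \<eta> capped at 1. Otherwise the total mass is
      at most d <= 1 <= \<open>I\<close>, and \<open>ainf_const\<close> < 1 settles the
      claim.\<close>
    proof (cases "I < 1")
      case True
      show ?thesis unfolding I_def[symmetric]
      proof (rule field_le_epsilon)
        fix \<eta> :: real assume \<eta>: "0 < \<eta>"
        define d' where "d' = min 1 (I + \<eta>)"
        have d': "0 < d'" "d' \<le> 1" "I \<le> d'" "d' \<le> I + \<eta>" using \<eta> L0[of E] True by (auto simp: d'_def I_def)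
        have "ennreal ainf_const * ennreal (LINT x:hcube c' l'|lebesgue. w x) \<le> ennreal d'"
          unfolding wS[OF h' E(2), symmetric]
          using d' wS[OF E(4) EH] by (intro ph_A_infinity[OF t E(1,3,4,5) d'(1,2)]) (auto simp: I_def intro!: ennreal_leI)
        then have "ainf_const * (LINT x:hcube c' l'|lebesgue. w x) \<le> d'"
          using ainf_const d' L0 by (simp add: ennreal_mult'[symmetric])
        then show "ainf_const * (LINT x:hcube c' l'|lebesgue. w x) \<le> I + \<eta>" using d' by simp
      qed
    next
      case False
      have "ennreal (LINT x:hcube c' l'|lebesgue. w x) \<le> (\<integral>\<^sup>+x. ennreal (w x) \<partial>lebesgue)"
        unfolding wS[OF h' E(2), symmetric] wn using E(2) by (intro nn_integral_mono) (auto simp: indicator_def)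
      then have "(LINT x:hcube c' l'|lebesgue. w x) \<le> 1" using wle d L0 
        by (metis ennreal_le_1 ennreal_leI order_trans)
      then have "ainf_const * (LINT x:hcube c' l'|lebesgue. w x) \<le> 1 * 1" using ainf_const L0 by (intro mult_mono) auto
      then show ?thesis using False by (simp add: I_def)
    qed
  qed
  also have "\<dots> \<le> ennreal (4 / ainf_const * d * (d / l ^ DIM('a)) powr e)"
    using Wd W0 ainf_const l e by (intro ennreal_leI mult_mono powr_mono2 divide_right_mono) auto
  also have "(\<integral>\<^sup>+x\<in>?H. ennreal (w x powr (1 + e)) \<partial>lebesgue) = (\<integral>\<^sup>+x\<in>?H. ennreal (ph x t powr (1 + e)) \<partial>lebesgue)"
    by (intro nn_integral_cong) (auto simp: w_def indicator_def)
  finally show ?thesis unfolding eq .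
qed

text \<open>The factor 4 / \<open>ainf_const\<close> comes from the reverse Hoelder inequality. The
  other one pays for enlarging the argument of \<open>ph\<close> by the constant of
  \<open>averaging_hom\<close>, raised to a power 1 + e <= 2.\<close>

definition avg_powr_const :: real where "avg_powr_const = (1 + avg_const powr q) powr (2 * q) * (4 / ainf_const)"

lemma avg_powr_const_pos: "avg_powr_const > 0" 
proof -
  have "1 + avg_const powr q \<noteq> 0" using powr_ge_zero[of avg_const q] by linarith
  then show ?thesis unfolding avg_powr_const_def using ainf_const by simp
qed

text \<open>The mean m is only known to have modular at most C0 d, which may exceed 1, whereas the
  reverse Hoelder inequality wants a constant of modular at most d. It is therefore applied to m /
  C0, and the power-type growth of \<open>ph\<close> brings back m.\<close>

lemma average_powr:
  assumes l: "0 < l" and Q: "Q = cbox c (c + l *\<^sub>R One)"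
    and f[measurable]: "f \<in> borel_measurable lebesgue" "\<And>x. 0 \<le> f x"
    and d: "0 < d" "d \<le> 1"
    and le: "(\<integral>\<^sup>+x\<in>Q. ennreal (ph x (f x)) \<partial>lebesgue) \<le> ennreal d"
    and e: "0 \<le> e" "e \<le> 1" and be: "(4 / ainf_const) * (2 * 2 ^ DIM('a)) powr e * (1 - ainf_const) + 2 powr e \<le> 4 / ainf_const"
  shows "(\<integral>\<^sup>+x\<in>Q. ennreal (ph x (enn2real (\<integral>\<^sup>+x\<in>Q. ennreal (f x) \<partial>lebesgue) / l ^ DIM('a)) powr (1 + e)) \<partial>lebesgue)
    \<le> ennreal (avg_powr_const * d * (d / l ^ DIM('a)) powr e)"
proof -
  have Qc: "Q \<in> cubes" using l Q by (auto simp: cubes_def)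
  have [measurable]: "Q \<in> sets lebesgue" using Q by simp
  define m where "m = enn2real (\<integral>\<^sup>+x\<in>Q. ennreal (f x) \<partial>lebesgue) / l ^ DIM('a)"
  have m: "m \<ge> 0" using l by (simp add: m_def)
  define C0 where "C0 = 1 + avg_const powr q"
  have C0: "C0 \<ge> 1" by (simp add: C0_def)
  have mQ: "measure lebesgue Q = l ^ DIM('a)" using hcube_measure(5)[OF l, of c] by (simp add: Q)
  have av: "(\<integral>\<^sup>+x\<in>Q. ennreal (ph x m) \<partial>lebesgue) \<le> ennreal (C0 * d)"
    using averaging_hom(2)[OF Qc f d le] unfolding mQ m_def C0_def .
  have "(\<integral>\<^sup>+x\<in>Q. ennreal (ph x (m / C0)) \<partial>lebesgue) \<le> (\<integral>\<^sup>+x. ennreal (1 / C0) * (ennreal (ph x m) * indicator Q x) \<partial>lebesgue)"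
    using ph_scale_down[OF m, of "1 / C0"] C0
    by (intro nn_integral_mono) (auto simp: indicator_def ennreal_mult'[symmetric] intro!: ennreal_leI)
  also have "\<dots> = ennreal (1 / C0) * (\<integral>\<^sup>+x\<in>Q. ennreal (ph x m) \<partial>lebesgue)"
    by (intro nn_integral_cmult) measurable
  also have "\<dots> \<le> ennreal (1 / C0) * ennreal (C0 * d)" by (intro mult_left_mono av) auto
  also have "\<dots> = ennreal d" using C0 d by (simp add: ennreal_mult'[symmetric])
  finally have "(\<integral>\<^sup>+x\<in>Q. ennreal (ph x (m / C0)) \<partial>lebesgue) \<le> ennreal d" .
  then have rh: "(\<integral>\<^sup>+x\<in>Q. ennreal (ph x (m / C0) powr (1 + e)) \<partial>lebesgue) \<le> ennreal (4 / ainf_const * d * (d / l ^ DIM('a)) powr e)"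
    unfolding Q using m C0 by (intro reverse_hoelder_ph l d e be) auto
  have pt: "ph x m powr (1 + e) \<le> C0 powr (2 * q) * ph x (m / C0) powr (1 + e)" for x
  proof -
    have "ph x m \<le> C0 powr q * ph x (m / C0)" using ph_scale_le[of "m / C0" C0 x] m C0 by simp
    then have "ph x m powr (1 + e) \<le> (C0 powr q * ph x (m / C0)) powr (1 + e)" using e by (intro powr_mono2) auto
    also have "\<dots> = C0 powr (q * (1 + e)) * ph x (m / C0) powr (1 + e)" by (simp add: powr_mult powr_powr)
    also have "\<dots> \<le> C0 powr (2 * q) * ph x (m / C0) powr (1 + e)"
      using C0 e p1 pq by (intro mult_right_mono powr_mono) auto
    finally show ?thesis .
  qed
  have "(\<integral>\<^sup>+x\<in>Q. ennreal (ph x m powr (1 + e)) \<partial>lebesgue) \<le> (\<integral>\<^sup>+x. ennreal (C0 powr (2 * q)) * (ennreal (ph x (m / C0) powr (1 + e)) * indicator Q x) \<partial>lebesgue)"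
    using pt by (intro nn_integral_mono) (auto simp: indicator_def ennreal_mult'[symmetric] intro!: ennreal_leI)
  also have "\<dots> = ennreal (C0 powr (2 * q)) * (\<integral>\<^sup>+x\<in>Q. ennreal (ph x (m / C0) powr (1 + e)) \<partial>lebesgue)"
    by (intro nn_integral_cmult) measurable
  also have "\<dots> \<le> ennreal (C0 powr (2 * q)) * ennreal (4 / ainf_const * d * (d / l ^ DIM('a)) powr e)" by (intro mult_left_mono rh) auto
  also have "\<dots> = ennreal (avg_powr_const * d * (d / l ^ DIM('a)) powr e)" by (simp add: ennreal_mult'[symmetric] avg_powr_const_def C0_def mult_ac)
  finally show ?thesis unfolding m_def .
qed

end

section \<open>A pointwise estimate for Sobolev functions\<close>

text \<open>The function exp(-1/t) on t > 0, times t^(-k). The derivative of a member is a linear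
  combination of the next two, so the family provides all derivatives of the cut-off
  \<open>flat 0\<close>, and the behaviour at 0 is examined once for all k.\<close>

definition flat :: "nat \<Rightarrow> real \<Rightarrow> real" where
  "flat k t = (if 0 < t then (1 / t) ^ k * exp (- 1 / t) else 0)"

lemma power_le_fact_exp:
  fixes y :: real assumes "0 \<le> y" shows "y ^ k \<le> fact k * exp y"
proof -
  have "(\<Sum>n\<in>{k}. y ^ n /\<^sub>R fact n) \<le> (\<Sum>n. y ^ n /\<^sub>R fact n)"
    using assms by (intro sum_le_suminf summable_exp_generic) auto
  then have "y ^ k / fact k \<le> exp y" by (simp add: exp_def divide_inverse mult.commute)
  then show ?thesis by (simp add: field_simps)
qed

lemma flat_nonneg: "0 \<le> flat k t" by (simp add: flat_def)

lemma flat_le_fact: "flat k t \<le> fact k"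
proof (cases "0 < t")
  case True
  then have "(1 / t) ^ k \<le> fact k * exp (1 / t)" by (intro power_le_fact_exp) auto
  then have "(1 / t) ^ k * exp (- (1 / t)) \<le> fact k * exp (1 / t) * exp (- (1 / t))" by (intro mult_right_mono) auto
  then show ?thesis using True by (simp add: flat_def mult.assoc exp_minus_inverse)
qed (simp add: flat_def)

lemma flat_Suc: "0 < t \<Longrightarrow> flat (Suc k) t = flat k t / t"
  by (simp add: flat_def)

lemma flat_le_linear: "0 < t \<Longrightarrow> flat k t \<le> fact (Suc k) * t"
  using flat_le_fact[of "Suc k" t] by (simp add: flat_Suc pos_divide_le_eq)

lemma has_derivative_flat: "(flat k has_real_derivative flat (k + 2) t - real k * flat (k + 1) t) (at t)"
proof (cases t "0::real" rule: linorder_cases)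
  case greater
  have d1: "((\<lambda>t. 1 / t) has_real_derivative - ((1 / t)^2)) (at t)"
    using greater by (auto intro!: derivative_eq_intros simp: field_simps power2_eq_square)
  have d2: "((\<lambda>t. exp (- 1 / t)) has_real_derivative exp (- 1 / t) * (1 / t)^2) (at t)"
    using greater by (auto intro!: derivative_eq_intros simp: field_simps power2_eq_square)
  define y where "y = 1 / t"
  have "((\<lambda>t. (1 / t) ^ k * exp (- 1 / t)) has_real_derivative flat (k + 2) t - real k * flat (k + 1) t) (at t)"
    by (rule DERIV_cong[OF DERIV_mult[OF DERIV_power[OF d1, of k] d2]], unfold flat_def y_def[symmetric])
       (use greater in \<open>cases k; simp add: algebra_simps power2_eq_square\<close>)
  moreover have "\<forall>\<^sub>F s in nhds t. (1 / s) ^ k * exp (- 1 / s) = flat k s"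
    using eventually_nhds_in_open[of "{0<..}" t] greater by (auto elim!: eventually_mono simp: flat_def)
  ultimately show ?thesis by (rule DERIV_cong_ev[OF refl _ refl, THEN iffD1, rotated])
next
  case less
  have "((\<lambda>t. 0) has_real_derivative flat (k + 2) t - real k * flat (k + 1) t) (at t)"
    using less by (auto simp: flat_def)
  moreover have "\<forall>\<^sub>F s in nhds t. 0 = flat k s"
    using eventually_nhds_in_open[of "{..<0}" t] less by (auto elim!: eventually_mono simp: flat_def)
  ultimately show ?thesis by (rule DERIV_cong_ev[OF refl _ refl, THEN iffD1, rotated])
next
  case equal
  \<comment> \<open>For h > 0 the quotient is \<open>flat (Suc k) h\<close>, which is at most a
    multiple of h.\<close>
  have "((\<lambda>h. flat k h / h) \<longlongrightarrow> 0) (at 0)"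
  proof (rule tendsto_sandwich[where f="\<lambda>_. 0" and h="\<lambda>h. fact (Suc (Suc k)) * \<bar>h\<bar>"])
    have "flat k h / h \<le> fact (Suc (Suc k)) * \<bar>h\<bar>" for h :: real
    proof (cases "0 < h")
      case True
      then show ?thesis using flat_le_linear[of h "Suc k"] flat_Suc[of h k] by simp
    next
      case False
      then have "flat k h = 0" by (simp add: flat_def)
      then show ?thesis by (simp del: fact_Suc)
    qed
    then show "\<forall>\<^sub>F h in at 0. flat k h / h \<le> fact (Suc (Suc k)) * \<bar>h\<bar>" by simp
    have "((\<lambda>h::real. fact (Suc (Suc k)) * \<bar>h\<bar>) \<longlongrightarrow> fact (Suc (Suc k)) * \<bar>0\<bar>) (at 0)" by (intro tendsto_intros)
    then show "((\<lambda>h::real. fact (Suc (Suc k)) * \<bar>h\<bar>) \<longlongrightarrow> 0) (at 0)" by simp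
    have "0 \<le> flat k h / h" for h :: real by (cases "0 < h") (auto simp: flat_def)
    then show "\<forall>\<^sub>F h in at 0. 0 \<le> flat k h / h" by simp
  qed simp
  then show ?thesis using equal by (simp add: DERIV_def flat_def)
qed

text \<open>A class of smooth functions closed under directional derivatives, so that membership in it gives
  \<^const>\<open>smooth\<close> without any product or chain rule for \<^const>\<open>iter_deriv\<close>.\<close>

inductive smooth_term :: "('a::euclidean_space \<Rightarrow> real) \<Rightarrow> bool" where
  const: "smooth_term (\<lambda>x. c)"
| lin: "smooth_term (\<lambda>x. x \<bullet> v)"
| add: "smooth_term f \<Longrightarrow> smooth_term g \<Longrightarrow> smooth_term (\<lambda>x. f x + g x)"
| mult: "smooth_term f \<Longrightarrow> smooth_term g \<Longrightarrow> smooth_term (\<lambda>x. f x * g x)"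
| flat: "smooth_term f \<Longrightarrow> smooth_term (\<lambda>x. flat k (f x))"

lemma smooth_term_deriv: "smooth_term f \<Longrightarrow> \<exists>D. (\<forall>x. (f has_derivative D x) (at x)) \<and> (\<forall>v. smooth_term (\<lambda>x. D x v))"
proof (induction rule: smooth_term.induct)
  case (const c)
  show ?case by (rule exI[of _ "\<lambda>_ _. 0"]) (auto intro: smooth_term.const)
next
  case (lin v)
  show ?case by (rule exI[of _ "\<lambda>_ h. h \<bullet> v"]) (auto intro: smooth_term.const intro!: derivative_eq_intros)
next
  case (add f g)
  then obtain D E where D: "\<And>x. (f has_derivative D x) (at x)" "\<And>v. smooth_term (\<lambda>x. D x v)" 
    and E: "\<And>x. (g has_derivative E x) (at x)" "\<And>v. smooth_term (\<lambda>x. E x v)" by blast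
  show ?case by (rule exI[of _ "\<lambda>x h. D x h + E x h"]) (use D E in \<open>auto intro: smooth_term.add has_derivative_add\<close>)
next
  case (mult f g)
  then obtain D E where D: "\<And>x. (f has_derivative D x) (at x)" "\<And>v. smooth_term (\<lambda>x. D x v)" 
    and E: "\<And>x. (g has_derivative E x) (at x)" "\<And>v. smooth_term (\<lambda>x. E x v)" by blast
  show ?case by (rule exI[of _ "\<lambda>x h. f x * E x h + D x h * g x"]) 
     (use D E mult in \<open>auto intro!: smooth_term.add smooth_term.mult has_derivative_mult\<close>)
next
  case (flat f k)
  then obtain D where D: "\<And>x. (f has_derivative D x) (at x)" "\<And>v. smooth_term (\<lambda>x. D x v)" by blast
  have "((\<lambda>x. flat k (f x)) has_derivative (\<lambda>h. (flat (k + 2) (f x) + (- real k) * flat (k + 1) (f x)) * D x h)) (at x)" for x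
    using has_derivative_compose[OF D(1), of "flat k" _ ] has_derivative_flat[of k "f x"] D(1)[of x]
    by (auto simp: has_field_derivative_def intro: has_derivative_compose)
  moreover have "smooth_term (\<lambda>x. (flat (k + 2) (f x) + (- real k) * flat (k + 1) (f x)) * D x v)" for v
    using D(2) flat by (intro smooth_term.add smooth_term.mult smooth_term.const smooth_term.flat)
  ultimately show ?case by (intro exI[of _ "\<lambda>x h. (flat (k + 2) (f x) + (- real k) * flat (k + 1) (f x)) * D x h"]) blast
qed

lemma smooth_term_differentiable: "smooth_term f \<Longrightarrow> f differentiable at x"
  using smooth_term_deriv unfolding differentiable_def by blast

lemma smooth_term_frechet: "smooth_term f \<Longrightarrow> smooth_term (\<lambda>x. frechet_derivative f (at x) v)"
proof -
  assume "smooth_term f"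
  then obtain D where D: "\<And>x. (f has_derivative D x) (at x)" "\<And>v. smooth_term (\<lambda>x. D x v)" using smooth_term_deriv by blast
  have "frechet_derivative f (at x) = D x" for x using frechet_derivative_at[OF D(1)] by simp
  then show ?thesis using D(2) by simp
qed

lemma smooth_term_smooth: assumes "smooth_term f" shows "smooth f"
proof -
  have "smooth_term (iter_deriv vs f)" for vs
    by (induction vs) (use assms in \<open>auto intro: smooth_term_frechet\<close>)
  then show ?thesis unfolding smooth_def by (blast intro: smooth_term_differentiable)
qed

lemma smooth_term_sum: "finite A \<Longrightarrow> (\<And>i. i \<in> A \<Longrightarrow> smooth_term (f i)) \<Longrightarrow> smooth_term (\<lambda>x. \<Sum>i\<in>A. f i x)"
  by (induction A rule: finite_induct) (auto intro: smooth_term.const smooth_term.add)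

section \<open>Integrals of derivatives and differentiation under the integral\<close>

lemma lborel_integral_translation:
  fixes f :: "'a::euclidean_space \<Rightarrow> real"
  assumes f: "f \<in> borel_measurable borel"
  shows "(LINT x|lborel. f (x + v)) = (LINT x|lborel. f x)"
proof -
  have "(LINT x|lborel. f x) = (LINT x|distr lborel borel ((+) v). f x)"
    by (simp add: lborel_distr_plus)
  also have "\<dots> = (LINT x|lborel. f (v + x))" using f by (intro integral_distr) auto
  finally show ?thesis by (simp add: add.commute)
qed

text \<open>Difference quotients of f in direction v integrate to 0 by translation invariance. They
  converge to the derivative, and the mean value theorem together with the compact support bounds
  them by a constant on one fixed ball, so dominated convergence applies.\<close>

lemma integral_derivative_zero:
  fixes f :: "'a::euclidean_space \<Rightarrow> real"
  assumes D: "\<And>x. (f has_derivative D x) (at x)" and cont: "continuous_on UNIV (\<lambda>x. D x v)"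
    and supp: "\<And>x. x \<notin> C \<Longrightarrow> f x = 0" and C: "compact C"
  shows "(LINT x|lebesgue. D x v) = 0" "integrable lebesgue (\<lambda>x. D x v)"
proof -
  obtain R where R: "R > 0" "\<And>x. x \<in> C \<Longrightarrow> norm x \<le> R"
    using compact_imp_bounded[OF C] by (auto simp: bounded_pos)
  \<comment> \<open>The increments are multiples of v by factors at most 1, so all the difference
    quotients vanish outside \<open>S\<close>.\<close>
  define S where "S = cball (0::'a) (R + norm v + 1)"
  define T where "T = cball (0::'a) (R + 2 * norm v + 1)"
  have fc: "continuous_on UNIV f" using D by (intro has_derivative_continuous_on[of UNIV f D]) (auto intro: has_derivative_at_withinI)
  have fm[measurable]: "f \<in> borel_measurable borel" by (rule borel_measurable_continuous_onI[OF fc])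
  have Dm[measurable]: "(\<lambda>x. D x v) \<in> borel_measurable borel" by (rule borel_measurable_continuous_onI[OF cont])
  have D0: "D x v = 0" if x: "norm x > R" for x
  proof -
    have "(f has_derivative (\<lambda>_. 0)) (at x)"
    proof (rule has_derivative_transform_within_open[of "\<lambda>_. 0" _ x UNIV "{x. norm x > R}"])
      show "open {x::'a. R < norm x}" by (intro open_Collect_less continuous_intros)
      show "0 = f y" if "y \<in> {x. R < norm x}" for y using supp[of y] R(2)[of y] that by force
    qed (use x in auto)
    then have "D x = (\<lambda>_. 0)" using D has_derivative_unique by blast
    then show ?thesis by simp
  qed
  have "bounded ((\<lambda>x. D x v) ` T)"
    unfolding T_def by (intro compact_imp_bounded compact_continuous_image continuous_on_subset[OF cont]) auto
  then obtain M where M: "\<And>x. x \<in> T \<Longrightarrow> \<bar>D x v\<bar> \<le> M" by (auto simp: bounded_iff)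
  have M': "\<bar>D x v\<bar> \<le> M" for x
  proof (cases "x \<in> T")
    case False
    then have "norm x > R" using norm_ge_zero[of v] by (simp add: T_def del: norm_ge_zero)
    moreover have "0 \<le> M" using M[of 0] R(1) by (simp add: T_def)
    ultimately show ?thesis using D0 by simp
  qed (use M in auto)
  define s where "s m x = (f (x + (1 / Suc m) *\<^sub>R v) - f x) * Suc m" for m :: nat and x
  have [measurable]: "s m \<in> borel_measurable borel" for m unfolding s_def by measurable
  have quot: "(\<lambda>m. s m x) \<longlonglongrightarrow> D x v" for x
  proof -
    have "((\<lambda>t. f (x + t *\<^sub>R v)) has_derivative (\<lambda>t. D x (t *\<^sub>R v))) (at 0)"
    proof -
      have i: "((\<lambda>t. x + t *\<^sub>R v) has_derivative (\<lambda>t. t *\<^sub>R v)) (at 0)" by (auto intro!: derivative_eq_intros)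
      show ?thesis using has_derivative_compose[OF i, of f "D x"] D[of x] by simp
    qed
    moreover have "(\<lambda>t. D x (t *\<^sub>R v)) = (*) (D x v)"
      using linear_scale[OF has_derivative_linear[OF D[of x]]] by (intro ext) (simp add: mult.commute)
    ultimately have "((\<lambda>t. f (x + t *\<^sub>R v)) has_real_derivative D x v) (at 0)"
      by (simp only: has_field_derivative_def)
    then have l: "((\<lambda>h. (f (x + h *\<^sub>R v) - f x) / h) \<longlongrightarrow> D x v) (at 0)" by (simp add: DERIV_def)
    have "filterlim (\<lambda>m. 1 / real (Suc m)) (at 0) sequentially"
      unfolding filterlim_at by (auto intro!: always_eventually LIMSEQ_Suc lim_1_over_n simp del: of_nat_Suc)
    from filterlim_compose[OF l this] show ?thesis by (simp add: s_def)
  qed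
  have bound: "\<bar>s m x\<bar> \<le> indicator S x * M" for m x
  proof (cases "x \<in> S")
    case True
    have t: "1 / real (Suc m) > 0" by simp
    have "\<exists>z. z > 0 \<and> z < 1 / real (Suc m) \<and> f (x + (1 / Suc m) *\<^sub>R v) - f (x + 0 *\<^sub>R v) = (1 / real (Suc m) - 0) * D (x + z *\<^sub>R v) v"
    proof (rule MVT2[OF t])
      fix t :: real
      have "((\<lambda>t. f (x + t *\<^sub>R v)) has_derivative (\<lambda>h. D (x + t *\<^sub>R v) (h *\<^sub>R v))) (at t)"
      proof -
        have i: "((\<lambda>t. x + t *\<^sub>R v) has_derivative (\<lambda>t. t *\<^sub>R v)) (at t)" by (auto intro!: derivative_eq_intros)
        show ?thesis using has_derivative_compose[OF i, of f "D (x + t *\<^sub>R v)"] D[of "x + t *\<^sub>R v"] by simp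
      qed
      moreover have "(\<lambda>h. D (x + t *\<^sub>R v) (h *\<^sub>R v)) = (*) (D (x + t *\<^sub>R v) v)"
        using linear_scale[OF has_derivative_linear[OF D[of "x + t *\<^sub>R v"]]] by (intro ext) (simp add: mult.commute)
      ultimately show "((\<lambda>t. f (x + t *\<^sub>R v)) has_real_derivative D (x + t *\<^sub>R v) v) (at t)"
        by (simp only: has_field_derivative_def)
    qed
    then obtain z where "f (x + (1 / Suc m) *\<^sub>R v) - f x = (1 / real (Suc m)) * D (x + z *\<^sub>R v) v" by auto
    then have "s m x = D (x + z *\<^sub>R v) v" by (simp add: s_def field_simps)
    then show ?thesis using M' True by simp
  next
    case False
    then have x: "norm x > R + norm v + 1" by (simp add: S_def)
    have "norm ((1 / real (Suc m)) *\<^sub>R v) \<le> norm v" 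
      using mult_right_mono[of "1 / real (Suc m)" 1 "norm v"] by simp
    then have "norm (x + (1 / Suc m) *\<^sub>R v) > R" using x norm_diff_ineq[of x "(1 / Suc m) *\<^sub>R v"] by linarith
    then have "f (x + (1 / Suc m) *\<^sub>R v) = 0" using supp R(2) by force
    moreover have "f x = 0" using x supp R(2)[of x] norm_ge_zero[of v] by force
    ultimately show ?thesis using False by (simp add: s_def)
  qed
  have iw: "integrable lborel (\<lambda>x. indicator S x * M)"
    unfolding S_def by (intro integrable_mult_left integrable_real_indicator) (use emeasure_bounded_finite[OF bounded_cball, of "0::'a" "R + norm v + 1"] in auto)
  have fi: "integrable lborel (\<lambda>x. f x)"
  proof -
    have "bounded (f ` S)" unfolding S_def by (intro compact_imp_bounded compact_continuous_image continuous_on_subset[OF fc]) auto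
    then obtain K where K: "\<And>x. x \<in> S \<Longrightarrow> \<bar>f x\<bar> \<le> K" by (auto simp: bounded_iff)
    have K0: "0 \<le> K" using K[of 0] R by (simp add: S_def)
    have "\<bar>f x\<bar> \<le> indicator S x * K" for x
    proof (cases "x \<in> S")
      case False
      then have "norm x > R" using norm_ge_zero[of v] by (simp add: S_def del: norm_ge_zero)
      then show ?thesis using supp[of x] R(2)[of x] False by force
    qed (use K in simp)
    moreover have "integrable lborel (\<lambda>x. indicator S x * K)"
      unfolding S_def by (intro integrable_mult_left integrable_real_indicator) (use emeasure_bounded_finite[OF bounded_cball, of "0::'a" "R + norm v + 1"] in auto)
    ultimately show ?thesis using K0 by (intro Bochner_Integration.integrable_bound[of lborel "\<lambda>x. indicator S x * K" f]) auto
  qed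
  have fi2: "integrable lborel (\<lambda>x. f (x + a))" for a
    using integrable_distr_eq[of "(+) a" lborel borel f] fi by (simp add: lborel_distr_plus add.commute)
  have "(LINT x|lborel. s m x) = 0" for m
    unfolding s_def using fi fi2 lborel_integral_translation[OF fm] by simp
  moreover have "(\<lambda>m. LINT x|lborel. s m x) \<longlonglongrightarrow> (LINT x|lborel. D x v)"
    by (rule integral_dominated_convergence[OF _ _ iw]) (use quot bound in auto)
  ultimately have "(LINT x|lborel. D x v) = 0" by (simp add: LIMSEQ_const_iff)
  moreover have i: "integrable lborel (\<lambda>x. D x v)"
    by (rule integrable_dominated_convergence[OF _ _ iw, of _ s]) (use quot bound in auto)
  ultimately show "(LINT x|lebesgue. D x v) = 0" "integrable lebesgue (\<lambda>x. D x v)"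
    by (auto simp: integral_completion integrable_completion)
qed

lemma has_real_derivative_weighted_integral:
  fixes u :: "'a \<Rightarrow> real" and k k' :: "real \<Rightarrow> 'a \<Rightarrow> real"
  assumes u: "integrable M u" and \<tau>: "a < \<tau>" "\<tau> < b"
    and [measurable]: "\<And>t. k t \<in> borel_measurable M" "k' \<tau> \<in> borel_measurable M"
    and D: "\<And>t y. a < t \<Longrightarrow> t < b \<Longrightarrow> y \<in> space M \<Longrightarrow> ((\<lambda>t. k t y) has_real_derivative k' t y) (at t)"
    and bd: "\<And>t y. a < t \<Longrightarrow> t < b \<Longrightarrow> y \<in> space M \<Longrightarrow> \<bar>k' t y\<bar> \<le> C"
    and kb: "\<And>t y. a < t \<Longrightarrow> t < b \<Longrightarrow> y \<in> space M \<Longrightarrow> \<bar>k t y\<bar> \<le> C'"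
  shows "((\<lambda>t. LINT y|M. u y * k t y) has_real_derivative (LINT y|M. u y * k' \<tau> y)) (at \<tau>)"
proof -
  have [measurable]: "u \<in> borel_measurable M" using u by auto
  have ki: "integrable M (\<lambda>y. u y * k t y)" if "a < t" "t < b" for t
  proof (rule Bochner_Integration.integrable_bound[of M "\<lambda>y. C' * u y"])
    show "AE y in M. norm (u y * k t y) \<le> norm (C' * u y)"
    proof (rule AE_I2)
      fix y assume "y \<in> space M"
      then have "\<bar>k t y\<bar> \<le> \<bar>C'\<bar>" using kb[OF that, of y] by simp
      then show "norm (u y * k t y) \<le> norm (C' * u y)" by (simp add: abs_mult mult.commute[of "\<bar>C'\<bar>"] mult_left_mono)
    qed
  qed (use u in auto)
  show ?thesis
    unfolding has_field_derivative_iff tendsto_at_iff_sequentially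
  proof (intro allI impI)
    fix X :: "nat \<Rightarrow> real" assume X: "\<forall>i. X i \<in> UNIV - {\<tau>}" "X \<longlonglongrightarrow> \<tau>"
    have "\<forall>\<^sub>F n in sequentially. a < X n \<and> X n < b"
      using order_tendstoD[OF X(2)] \<tau> by (auto intro: eventually_conj)
    then obtain N where N: "\<And>n. n \<ge> N \<Longrightarrow> a < X n \<and> X n < b" by (auto simp: eventually_sequentially)
    \<comment> \<open>Shifted by N so that every evaluation point lies in (a, b), where the bound on
      the derivative yields the dominating function C |u|.\<close>
    define s where "s n y = u y * ((k (X (n + N)) y - k \<tau> y) / (X (n + N) - \<tau>))" for n y
    have "(\<lambda>n. LINT y|M. s n y) \<longlonglongrightarrow> (LINT y|M. u y * k' \<tau> y)"
    proof (rule integral_dominated_convergence[of _ _ _ "\<lambda>y. C * \<bar>u y\<bar>"])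
      show "AE y in M. (\<lambda>n. s n y) \<longlonglongrightarrow> u y * k' \<tau> y"
      proof (rule AE_I2)
        fix y assume y: "y \<in> space M"
        have "((\<lambda>t. (k t y - k \<tau> y) / (t - \<tau>)) \<longlongrightarrow> k' \<tau> y) (at \<tau>)"
          using D[OF \<tau> y] by (simp add: has_field_derivative_iff)
        then have "(\<lambda>n. (k (X n) y - k \<tau> y) / (X n - \<tau>)) \<longlonglongrightarrow> k' \<tau> y"
          unfolding tendsto_at_iff_sequentially using X by (auto simp: o_def)
        then have "(\<lambda>n. (k (X (n + N)) y - k \<tau> y) / (X (n + N) - \<tau>)) \<longlonglongrightarrow> k' \<tau> y"
          by (rule LIMSEQ_ignore_initial_segment)
        then show "(\<lambda>n. s n y) \<longlonglongrightarrow> u y * k' \<tau> y" unfolding s_def by (intro tendsto_intros)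
      qed
      fix n
      show "AE y in M. norm (s n y) \<le> C * \<bar>u y\<bar>"
      proof (rule AE_I2)
        fix y assume y: "y \<in> space M"
        let ?t = "X (n + N)"
        have t: "a < ?t" "?t < b" "?t \<noteq> \<tau>" using N[of "n + N"] X by auto
        have "\<bar>k ?t y - k \<tau> y\<bar> \<le> C * \<bar>?t - \<tau>\<bar>"
          using field_differentiable_bound[of "{a<..<b}" "\<lambda>t. k t y" "\<lambda>t. k' t y" C ?t \<tau>] t \<tau> D[OF _ _ y] bd[OF _ _ y]
          by (auto intro: has_field_derivative_at_within)
        then have "\<bar>(k ?t y - k \<tau> y) / (?t - \<tau>)\<bar> \<le> C" using t by (simp add: pos_divide_le_eq)
        then have "\<bar>u y\<bar> * \<bar>(k ?t y - k \<tau> y) / (?t - \<tau>)\<bar> \<le> \<bar>u y\<bar> * C" by (intro mult_left_mono) auto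
        then show "norm (s n y) \<le> C * \<bar>u y\<bar>" unfolding s_def real_norm_def abs_mult by (simp only: mult.commute)
      qed
    qed (use u in \<open>auto simp: s_def\<close>)
    moreover have "(LINT y|M. s n y) = ((LINT y|M. u y * k (X (n + N)) y) - (LINT y|M. u y * k \<tau> y)) / (X (n + N) - \<tau>)" for n
      unfolding s_def using ki[of "X (n + N)"] N[of "n + N"] ki[OF \<tau>] 
      by (simp add: right_diff_distrib Bochner_Integration.integral_diff times_divide_eq_right[symmetric] del: times_divide_eq_right)
         (simp add: diff_divide_distrib right_diff_distrib)
    ultimately have "(\<lambda>n. ((LINT y|M. u y * k (X (n + N)) y) - (LINT y|M. u y * k \<tau> y)) / (X (n + N) - \<tau>)) \<longlonglongrightarrow> (LINT y|M. u y * k' \<tau> y)" by simp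
    from LIMSEQ_offset[OF this]
    show "((\<lambda>t. ((LINT y|M. u y * k t y) - (LINT y|M. u y * k \<tau> y)) / (t - \<tau>)) \<circ> X) \<longlonglongrightarrow> (LINT y|M. u y * k' \<tau> y)"
      by (simp add: o_def)
  qed
qed


section \<open>Bump kernels contracting to a point\<close>

lemma flat_continuous: "continuous_on UNIV (flat k)"
  by (intro continuous_at_imp_continuous_on ballI DERIV_isCont[OF has_derivative_flat])

lemma flat_meas [measurable]: "flat k \<in> borel_measurable borel"
  by (rule borel_measurable_continuous_onI[OF flat_continuous])

lemma borel_measurable_lebesgue_on: "f \<in> borel_measurable borel \<Longrightarrow> f \<in> borel_measurable (lebesgue_on S)"
  by (intro measurable_restrict_space1 measurable_completion) simp

text \<open>\<open>bump z r x \<theta>\<close> is a bump on the ball of radius \<open>r/2\<close> around \<open>z\<close>, shrunk by the factor \<open>\<theta>\<close> towards \<open>x\<close>.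
  For \<open>x\<close> in \<open>ball z r\<close> and \<open>\<theta> \<ge> 1\<close> its support stays in \<open>ball z r\<close> by convexity, at \<open>\<theta> = 1\<close> it does not depend
  on \<open>x\<close>, and as \<open>\<theta> \<rightarrow> \<infinity>\<close> it concentrates at \<open>x\<close>.\<close>

definition bump_arg :: "'a::euclidean_space \<Rightarrow> real \<Rightarrow> 'a \<Rightarrow> real \<Rightarrow> 'a \<Rightarrow> real" where
  "bump_arg z r x \<theta> y = 1 - 4 / r^2 * (norm (x + \<theta> *\<^sub>R (y - x) - z))^2"

definition bump :: "'a::euclidean_space \<Rightarrow> real \<Rightarrow> 'a \<Rightarrow> real \<Rightarrow> 'a \<Rightarrow> real" where
  "bump z r x \<theta> y = flat 0 (bump_arg z r x \<theta> y)"

text \<open>The divergence in \<open>y\<close> of \<open>bump z r x \<theta> y (y - x)\<close>. It is also the derivative in \<open>\<theta>\<close> of the mass-preserving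
  kernel \<open>\<theta>\<^sup>n bump z r x \<theta> y\<close> up to the factor \<open>\<theta>\<^sup>n\<^sup>-\<^sup>1\<close>, which turns a change of \<open>\<theta>\<close> into an integral of the
  weak gradient.\<close>

definition bump_div :: "'a::euclidean_space \<Rightarrow> real \<Rightarrow> 'a \<Rightarrow> real \<Rightarrow> 'a \<Rightarrow> real" where
  "bump_div z r x \<theta> y = real DIM('a) * bump z r x \<theta> y 
     - 8 / r^2 * \<theta> * flat 2 (bump_arg z r x \<theta> y) * ((x + \<theta> *\<^sub>R (y - x) - z) \<bullet> (y - x))"

lemma bump_meas [measurable]: "bump z r x \<theta> \<in> borel_measurable borel" "bump_div z r x \<theta> \<in> borel_measurable borel"
  unfolding bump_def[abs_def] bump_div_def[abs_def] bump_arg_def[abs_def] by measurable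

lemma bump_nonneg: "0 \<le> bump z r x \<theta> y" by (simp add: bump_def flat_nonneg)

lemma bump_le_1: "bump z r x \<theta> y \<le> 1" using flat_le_fact[of 0] by (simp add: bump_def)

context
  fixes z :: "'a::euclidean_space" and r :: real
  assumes r: "0 < r"
begin

lemma flat_bump_arg_nonzero: 
  assumes "flat k (bump_arg z r x \<theta> y) \<noteq> 0" shows "norm (x + \<theta> *\<^sub>R (y - x) - z) < r / 2"
proof -
  have "0 < bump_arg z r x \<theta> y" using assms by (auto simp: flat_def split: if_splits)
  then have "(norm (x + \<theta> *\<^sub>R (y - x) - z))^2 < (r / 2)^2" using r by (simp add: bump_arg_def field_simps)
  then show ?thesis using r by (intro power2_less_imp_less[of _ "r/2"]) auto
qed

lemma bump_arg_ball:
  assumes "norm (x + \<theta> *\<^sub>R (y - x) - z) < r / 2" "x \<in> ball z r" "0 < \<theta>"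
  shows "dist x y < 2 * r / \<theta>"
proof -
  have "norm (\<theta> *\<^sub>R (y - x)) \<le> norm (x + \<theta> *\<^sub>R (y - x) - z) + norm (z - x)"
    using norm_triangle_ineq[of "x + \<theta> *\<^sub>R (y - x) - z" "z - x"] by (simp add: algebra_simps)
  also have "\<dots> < 2 * r" using assms r by (simp add: dist_norm)
  finally have "\<theta> * dist x y < 2 * r" using assms(3) by (simp add: dist_norm norm_minus_commute)
  then show ?thesis using assms(3) by (simp add: pos_less_divide_eq mult.commute)
qed

lemma bump_ball:
  "bump z r x \<theta> y \<noteq> 0 \<Longrightarrow> x \<in> ball z r \<Longrightarrow> 0 < \<theta> \<Longrightarrow> y \<in> ball x (2 * r / \<theta>)"
  using bump_arg_ball[OF flat_bump_arg_nonzero] by (auto simp: bump_def)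

lemma smooth_term_bump: "smooth_term (bump z r x \<theta>)"
proof -
  have "(norm (x + \<theta> *\<^sub>R (y - x) - z))^2 = 
    (\<Sum>i\<in>Basis. (y \<bullet> (\<theta> *\<^sub>R i) + (x - \<theta> *\<^sub>R x - z) \<bullet> i) * (y \<bullet> (\<theta> *\<^sub>R i) + (x - \<theta> *\<^sub>R x - z) \<bullet> i))" for y
    unfolding power2_norm_eq_inner by (subst euclidean_inner) (simp add: algebra_simps inner_simps)
  then have "bump z r x \<theta> = (\<lambda>y. flat 0 (1 + (- 4 / r^2) * 
    (\<Sum>i\<in>Basis. (y \<bullet> (\<theta> *\<^sub>R i) + (x - \<theta> *\<^sub>R x - z) \<bullet> i) * (y \<bullet> (\<theta> *\<^sub>R i) + (x - \<theta> *\<^sub>R x - z) \<bullet> i))))"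
    by (intro ext) (simp add: bump_def bump_arg_def)
  then show ?thesis by (simp only:) (intro smooth_term.flat smooth_term.add smooth_term.mult smooth_term.const smooth_term_sum smooth_term.lin finite_Basis)
qed

lemma bump_test_fun:
  assumes x: "x \<in> ball z r" and \<theta>: "1 \<le> \<theta>"
  shows "(\<lambda>y. bump z r x \<theta> y * ((y - x) \<bullet> i)) \<in> test_funs (ball z r)"
proof -
  let ?\<psi> = "\<lambda>y. bump z r x \<theta> y * ((y - x) \<bullet> i)"
  have "smooth_term (\<lambda>y. bump z r x \<theta> y * (y \<bullet> i + (- (x \<bullet> i))))" by (intro smooth_term.mult smooth_term_bump smooth_term.add smooth_term.lin smooth_term.const)
  then have smooth: "smooth ?\<psi>" by (intro smooth_term_smooth) (simp add: inner_diff_left)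
  define C where "C = {y. norm (x + \<theta> *\<^sub>R (y - x) - z) \<le> r / 2}"
  have cl: "closed C" unfolding C_def by (intro closed_Collect_le continuous_intros)
  have CB: "C \<subseteq> ball z r"
  proof
    fix y assume y: "y \<in> C"
    define w where "w = x + \<theta> *\<^sub>R (y - x)"
    have w: "w \<in> ball z r" using y r by (auto simp: C_def w_def dist_norm norm_minus_commute)
    have "y = (1 - 1 / \<theta>) *\<^sub>R x + (1 / \<theta>) *\<^sub>R w" using \<theta> by (simp add: w_def algebra_simps)
    also have "\<dots> \<in> ball z r" using x w \<theta> by (intro convexD[OF convex_ball]) auto
    finally show "y \<in> ball z r" .
  qed
  have "{y. ?\<psi> y \<noteq> 0} \<subseteq> C" using flat_bump_arg_nonzero[of 0 x \<theta>] by (force simp: C_def bump_def)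
  then have c: "closure {y. ?\<psi> y \<noteq> 0} \<subseteq> C" using cl by (intro closure_minimal)
  have "compact C" using cl bounded_subset[OF bounded_ball CB] by (simp add: compact_eq_bounded_closed)
  then have "compact (closure {y. ?\<psi> y \<noteq> 0})" using c by (meson bounded_subset closed_closure compact_eq_bounded_closed)
  then show ?thesis using smooth c CB by (auto simp: test_funs_def)
qed

lemma bump_has_derivative:
  "((\<lambda>y. bump z r x \<theta> y * ((y - x) \<bullet> v)) has_derivative 
    (\<lambda>h. bump z r x \<theta> y * (h \<bullet> v) - 8 / r^2 * \<theta> * flat 2 (bump_arg z r x \<theta> y) * ((x + \<theta> *\<^sub>R (y - x) - z) \<bullet> h) * ((y - x) \<bullet> v))) (at y)"
proof -
  have s: "((\<lambda>y. bump_arg z r x \<theta> y) has_derivative (\<lambda>h. - (8 / r^2 * \<theta> * ((x + \<theta> *\<^sub>R (y - x) - z) \<bullet> h)))) (at y)"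
    unfolding bump_arg_def power2_norm_eq_inner
    by (rule derivative_eq_intros refl)+ (auto simp: algebra_simps inner_simps inner_commute add_divide_distrib diff_divide_distrib)
  have "(flat 0 has_derivative (\<lambda>h. flat 2 (bump_arg z r x \<theta> y) * h)) (at (bump_arg z r x \<theta> y))"
    using has_derivative_flat[of 0 "bump_arg z r x \<theta> y"] by (simp add: has_field_derivative_def numeral_2_eq_2)
  from has_derivative_compose[OF s this]
  have b: "(bump z r x \<theta> has_derivative (\<lambda>h. flat 2 (bump_arg z r x \<theta> y) * - (8 / r^2 * \<theta> * ((x + \<theta> *\<^sub>R (y - x) - z) \<bullet> h)))) (at y)"
    by (simp add: bump_def[abs_def])
  have d: "((\<lambda>y. (y - x) \<bullet> v) has_derivative (\<lambda>h. h \<bullet> v)) (at y)" by (auto intro!: derivative_eq_intros)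
  show ?thesis
    by (rule has_derivative_eq_rhs[OF has_derivative_mult[OF b d]]) (intro ext, simp add: mult_ac)
qed

text \<open>Weak gradients are tested one component at a time. The i-th component of the field
  bump(y) (y - x) serves as test function for the i-th derivative, and summing over i produces its
  divergence.\<close>

lemma bump_grad_sum:
  "(\<Sum>i\<in>Basis. grad (\<lambda>y. bump z r x \<theta> y * ((y - x) \<bullet> i)) y \<bullet> i) = bump_div z r x \<theta> y"
proof -
  have g: "grad (\<lambda>y. bump z r x \<theta> y * ((y - x) \<bullet> i)) y \<bullet> i = 
     bump z r x \<theta> y - 8 / r^2 * \<theta> * flat 2 (bump_arg z r x \<theta> y) * (((x + \<theta> *\<^sub>R (y - x) - z) \<bullet> i) * ((y - x) \<bullet> i))" if "i \<in> Basis" for i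
    unfolding grad_def frechet_derivative_at[OF bump_has_derivative, symmetric] using that
    by (simp add: inner_sum_left_Basis inner_Basis mult.assoc)
  show ?thesis unfolding bump_div_def
    by (subst euclidean_inner) (simp add: g sum_subtractf sum_distrib_left)
qed

lemma bump_time_derivative:
  "((\<lambda>\<theta>. \<theta> ^ DIM('a) * bump z r x \<theta> y) has_real_derivative \<theta> ^ (DIM('a) - 1) * bump_div z r x \<theta> y) (at \<theta>)"
proof -
  have s: "((\<lambda>\<theta>. bump_arg z r x \<theta> y) has_derivative (\<lambda>h. - (8 / r^2 * ((x + \<theta> *\<^sub>R (y - x) - z) \<bullet> (y - x))) * h)) (at \<theta>)"
    unfolding bump_arg_def power2_norm_eq_inner
    by (rule derivative_eq_intros refl)+ (auto simp: algebra_simps inner_simps inner_commute add_divide_distrib diff_divide_distrib)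
  have "(flat 0 has_derivative (\<lambda>h. flat 2 (bump_arg z r x \<theta> y) * h)) (at (bump_arg z r x \<theta> y))"
    using has_derivative_flat[of 0 "bump_arg z r x \<theta> y"] by (simp add: has_field_derivative_def numeral_2_eq_2)
  from has_derivative_compose[OF s this]
  have b: "((\<lambda>\<theta>. bump z r x \<theta> y) has_real_derivative flat 2 (bump_arg z r x \<theta> y) * - (8 / r^2 * ((x + \<theta> *\<^sub>R (y - x) - z) \<bullet> (y - x)))) (at \<theta>)"
  proof -
    have eq: "(\<lambda>h. flat 2 (bump_arg z r x \<theta> y) * (- (8 / r^2 * ((x + \<theta> *\<^sub>R (y - x) - z) \<bullet> (y - x))) * h)) 
      = (*) (flat 2 (bump_arg z r x \<theta> y) * - (8 / r^2 * ((x + \<theta> *\<^sub>R (y - x) - z) \<bullet> (y - x))))"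
      by (intro ext) (simp only: mult_ac)
    show ?thesis unfolding bump_def[abs_def] has_field_derivative_def eq[symmetric]
      using has_derivative_compose[OF s \<open>(flat 0 has_derivative _) _\<close>] .
  qed
  obtain m where m: "DIM('a) = Suc m" using DIM_positive[where 'a='a] gr0_conv_Suc by blast
  have "((\<lambda>\<theta>. \<theta> ^ DIM('a)) has_real_derivative real DIM('a) * \<theta> ^ (DIM('a) - 1)) (at \<theta>)"
    by (auto intro!: derivative_eq_intros)
  define c where "c = (x + \<theta> *\<^sub>R (y - x) - z) \<bullet> (y - x)"
  show ?thesis
    by (rule DERIV_cong[OF DERIV_mult[OF \<open>((\<lambda>\<theta>. \<theta> ^ DIM('a)) has_real_derivative _) _\<close> b]]) 
       (unfold bump_div_def c_def[symmetric] m, simp add: algebra_simps)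
qed

lemma bump_integral_derivative:
  assumes u: "integrable (lebesgue_on (ball z r)) u" and x: "x \<in> ball z r" and \<theta>: "0 < \<theta>"
  shows "((\<lambda>\<theta>. LINT y|lebesgue_on (ball z r). u y * (\<theta> ^ DIM('a) * bump z r x \<theta> y)) has_real_derivative 
     (LINT y|lebesgue_on (ball z r). u y * (\<theta> ^ (DIM('a) - 1) * bump_div z r x \<theta> y))) (at \<theta>)"
proof (rule has_real_derivative_weighted_integral[OF u, of "\<theta> / 2" _ "2 * \<theta>"])
  fix t y assume t: "\<theta> / 2 < t" "t < 2 * \<theta>" and "y \<in> space (lebesgue_on (ball z r))"
  then have y: "y \<in> ball z r" by simp
  have t0: "0 < t" using t \<theta> by simp
  show "((\<lambda>t. t ^ DIM('a) * bump z r x t y) has_real_derivative t ^ (DIM('a) - 1) * bump_div z r x t y) (at t)"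
    by (rule bump_time_derivative)
  have "\<bar>t ^ DIM('a) * bump z r x t y\<bar> = t ^ DIM('a) * bump z r x t y"
    using t0 bump_nonneg[of z r x t y] by simp
  also have "\<dots> \<le> (2 * \<theta>) ^ DIM('a) * 1"
    using t t0 bump_nonneg[of z r x t y] bump_le_1[of z r x t y] by (intro mult_mono power_mono) auto
  finally have "\<bar>t ^ DIM('a) * bump z r x t y\<bar> \<le> (2 * \<theta>) ^ DIM('a) * 1" .
  then show "\<bar>t ^ DIM('a) * bump z r x t y\<bar> \<le> (2 * \<theta>) ^ DIM('a)" by simp
  let ?F = "flat 2 (bump_arg z r x t y) * ((x + t *\<^sub>R (y - x) - z) \<bullet> (y - x))"
  \<comment> \<open>The factors are the bound \<open>fact 2\<close> of \<open>flat 2\<close>, the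
    bound r/2 for the vector x + t (y - x) - z wherever the bump is nonzero, and the diameter 2r of
    the ball.\<close>
  have F: "\<bar>?F\<bar> \<le> 2 * (r / 2 * (2 * r))"
  proof (cases "flat 2 (bump_arg z r x t y) = 0")
    case False
    have "norm (y - x) \<le> norm (y - z) + norm (z - x)" using norm_triangle_ineq[of "y - z" "z - x"] by simp
    then have yx: "norm (y - x) \<le> 2 * r" using x y by (simp add: dist_norm norm_minus_commute)
    have "\<bar>(x + t *\<^sub>R (y - x) - z) \<bullet> (y - x)\<bar> \<le> norm (x + t *\<^sub>R (y - x) - z) * norm (y - x)" by (rule Cauchy_Schwarz_ineq2)
    also have "\<dots> \<le> r / 2 * (2 * r)" using flat_bump_arg_nonzero[OF False] yx r by (intro mult_mono) auto
    finally show ?thesis unfolding abs_mult using flat_le_fact[of 2 "bump_arg z r x t y"] flat_nonneg[of 2 "bump_arg z r x t y"] r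
      by (intro mult_mono) (auto simp: fact_numeral)
  qed (use r in simp)
  have "\<bar>bump_div z r x t y\<bar> \<le> real DIM('a) * \<bar>bump z r x t y\<bar> + 8 / r^2 * t * \<bar>?F\<bar>"
    unfolding bump_div_def using t0 r by (intro order_trans[OF abs_triangle_ineq4]) (auto simp: abs_mult mult.assoc)
  also have "\<dots> \<le> real DIM('a) * 1 + 8 / r^2 * (2 * \<theta>) * (2 * (r / 2 * (2 * r)))"
    using bump_nonneg[of z r x t y] bump_le_1[of z r x t y] F t t0 r by (intro add_mono mult_mono) auto
  finally have *: "\<bar>bump_div z r x t y\<bar> \<le> real DIM('a) * 1 + 8 / r^2 * (2 * \<theta>) * (2 * (r / 2 * (2 * r)))" .
  show "\<bar>t ^ (DIM('a) - 1) * bump_div z r x t y\<bar> \<le> (2 * \<theta>) ^ (DIM('a) - 1) * (real DIM('a) * 1 + 8 / r^2 * (2 * \<theta>) * (2 * (r / 2 * (2 * r))))"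
  proof -
    have "t ^ (DIM('a) - 1) \<le> (2 * \<theta>) ^ (DIM('a) - 1)" using t t0 by (intro power_mono) auto
    then have "\<bar>t ^ (DIM('a) - 1)\<bar> \<le> (2 * \<theta>) ^ (DIM('a) - 1)" using t0 by (subst abs_of_nonneg) auto
    then show ?thesis unfolding abs_mult by (intro mult_mono *) auto
  qed
qed (use \<theta> in \<open>auto intro!: borel_measurable_lebesgue_on\<close>)

text \<open>The derivative of \<open>U\<close> in \<theta> is \<theta>^(n-1) times the integral of u
  against a divergence, hence, by definition of the weak gradient, an integral of G against bump(y)
  (y - x). Where the bump is nonzero, |y - x| < 2r/\<theta> <= 2r/s. The mean value theorem over
  [s, t] concludes; the factor n counts the components.\<close>

lemma bump_integral_step:
  assumes u: "integrable (lebesgue_on (ball z r)) u" and G: "integrable (lebesgue_on (ball z r)) G"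
    and w: "has_weak_grad (ball z r) u G"
    and x: "x \<in> ball z r" and st: "1 \<le> s" "s \<le> t"
  defines "U \<equiv> \<lambda>\<theta>. LINT y|lebesgue_on (ball z r). u y * (\<theta> ^ DIM('a) * bump z r x \<theta> y)"
  shows "\<bar>U t - U s\<bar> \<le> (real DIM('a) * t ^ (DIM('a) - 1) * (2 * r / s) * 
     (LINT y|lebesgue_on (ball z r). indicator (ball x (2 * r / s)) y * norm (G y))) * (t - s)"
proof -
  let ?L = "lebesgue_on (ball z r)" and ?n = "DIM('a)"
  define I where "I = (LINT y|?L. indicator (ball x (2 * r / s)) y * norm (G y))"
  define D where "D \<theta> = (LINT y|?L. u y * (\<theta> ^ (?n - 1) * bump_div z r x \<theta> y))" for \<theta>
  have Gm: "G \<in> borel_measurable ?L" using G by auto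
  note [measurable] = borel_measurable_lebesgue_on[OF bump_meas(1)] borel_measurable_lebesgue_on[OF bump_meas(2)]
  have um[measurable]: "u \<in> borel_measurable ?L" using u by auto
  have indm[measurable]: "indicator (ball x (2 * r / s)) \<in> borel_measurable ?L" by (intro borel_measurable_lebesgue_on borel_measurable_indicator) auto
  have Ii: "integrable ?L (\<lambda>y. indicator (ball x (2 * r / s)) y * norm (G y))"
    by (rule Bochner_Integration.integrable_bound[OF integrable_norm[OF G]]) (use borel_measurable_times[OF indm measurable_compose[OF Gm borel_measurable_norm]] in \<open>auto simp: indicator_def\<close>)
  have I0: "0 \<le> I" unfolding I_def by (intro integral_nonneg_AE) auto
  have der: "(U has_real_derivative D \<theta>) (at \<theta>)" if "0 < \<theta>" for \<theta>
    unfolding U_def D_def by (rule bump_integral_derivative[OF u x that])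
  have bd: "\<bar>D \<theta>\<bar> \<le> real ?n * t ^ (?n - 1) * (2 * r / s) * I" if \<theta>: "s \<le> \<theta>" "\<theta> \<le> t" for \<theta>
  proof -
    have \<theta>1: "1 \<le> \<theta>" using \<theta> st by simp
    let ?\<psi> = "\<lambda>i y. bump z r x \<theta> y * ((y - x) \<bullet> i)"
    have sub: "2 * r / \<theta> \<le> 2 * r / s" using \<theta> st r by (intro divide_left_mono) auto
    have \<psi>b: "\<bar>(G y \<bullet> i) * ?\<psi> i y\<bar> \<le> (2 * r / s) * (indicator (ball x (2 * r / s)) y * norm (G y))" if i: "i \<in> Basis" for i y
    proof (cases "bump z r x \<theta> y = 0")
      case True
      then show ?thesis using r st by simp
    next
      case False
      then have d: "dist x y < 2 * r / s" using bump_ball[OF False x] sub \<theta>1 by simp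
      have "\<bar>(y - x) \<bullet> i\<bar> \<le> 2 * r / s" using d Basis_le_norm[OF i, of "y - x"] by (simp add: dist_norm norm_minus_commute)
      then have "\<bar>?\<psi> i y\<bar> \<le> 1 * (2 * r / s)" unfolding abs_mult using bump_nonneg[of z r x \<theta> y] bump_le_1[of z r x \<theta> y]
        by (intro mult_mono) auto
      then have "\<bar>G y \<bullet> i\<bar> * \<bar>?\<psi> i y\<bar> \<le> norm (G y) * (1 * (2 * r / s))" using Basis_le_norm[OF i, of "G y"] by (intro mult_mono) auto
      then show ?thesis using d by (simp add: abs_mult mult.commute)
    qed
    have wg: "(LINT y|?L. u y * (grad (?\<psi> i) y \<bullet> i)) = - (LINT y|?L. (G y \<bullet> i) * ?\<psi> i y)" if "i \<in> Basis" for i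
      using w bump_test_fun[OF x \<theta>1, of i] that unfolding has_weak_grad_def by blast
    have int: "integrable ?L (\<lambda>y. u y * (grad (?\<psi> i) y \<bullet> i))" if i: "i \<in> Basis" for i
    proof -
      have g: "grad (?\<psi> i) y \<bullet> i = 
         bump z r x \<theta> y - 8 / r^2 * \<theta> * flat 2 (bump_arg z r x \<theta> y) * (((x + \<theta> *\<^sub>R (y - x) - z) \<bullet> i) * ((y - x) \<bullet> i))" for y
        unfolding grad_def frechet_derivative_at[OF bump_has_derivative, symmetric] using i
        by (simp add: inner_sum_left_Basis inner_Basis mult.assoc)
      have gm: "(\<lambda>y. grad (?\<psi> i) y \<bullet> i) \<in> borel_measurable borel" unfolding g bump_arg_def by measurable
      have gb: "\<bar>grad (?\<psi> i) y \<bullet> i\<bar> \<le> 1 + 8 / r^2 * \<theta> * (2 * (r / 2 * (2 * r)))" if y: "y \<in> ball z r" for y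
      proof -
        let ?F = "flat 2 (bump_arg z r x \<theta> y) * (((x + \<theta> *\<^sub>R (y - x) - z) \<bullet> i) * ((y - x) \<bullet> i))"
        have F: "\<bar>?F\<bar> \<le> 2 * (r / 2 * (2 * r))"
        proof (cases "flat 2 (bump_arg z r x \<theta> y) = 0")
          case False
          have "norm (y - x) \<le> norm (y - z) + norm (z - x)" using norm_triangle_ineq[of "y - z" "z - x"] by simp
          then have yx: "norm (y - x) \<le> 2 * r" using x y by (simp add: dist_norm norm_minus_commute)
          have "\<bar>((x + \<theta> *\<^sub>R (y - x) - z) \<bullet> i) * ((y - x) \<bullet> i)\<bar> \<le> r / 2 * (2 * r)" 
            unfolding abs_mult using flat_bump_arg_nonzero[OF False] yx r Basis_le_norm[OF i, of "y - x"] Basis_le_norm[OF i, of "x + \<theta> *\<^sub>R (y - x) - z"]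
            by (intro mult_mono) auto
          then show ?thesis unfolding abs_mult[of "flat 2 _"] using flat_le_fact[of 2 "bump_arg z r x \<theta> y"] flat_nonneg[of 2 "bump_arg z r x \<theta> y"] r
            by (intro mult_mono) (auto simp: fact_numeral)
        qed (use r in simp)
        have "\<bar>grad (?\<psi> i) y \<bullet> i\<bar> \<le> \<bar>bump z r x \<theta> y\<bar> + 8 / r^2 * \<theta> * \<bar>?F\<bar>"
          unfolding g using \<theta>1 r by (intro order_trans[OF abs_triangle_ineq4]) (auto simp: abs_mult mult.assoc)
        also have "\<dots> \<le> 1 + 8 / r^2 * \<theta> * (2 * (r / 2 * (2 * r)))"
          using bump_nonneg[of z r x \<theta> y] bump_le_1[of z r x \<theta> y] F \<theta>1 r by (intro add_mono mult_left_mono) auto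
        finally show ?thesis .
      qed
      define Cb where "Cb = 1 + 8 / r^2 * \<theta> * (2 * (r / 2 * (2 * r)))"
      show ?thesis
      proof (rule Bochner_Integration.integrable_bound[of ?L "\<lambda>y. u y * Cb"])
        show "integrable ?L (\<lambda>y. u y * Cb)" using u by simp
        show "AE y in ?L. norm (u y * (grad (?\<psi> i) y \<bullet> i)) \<le> norm (u y * Cb)"
        proof (rule AE_I2)
          fix y assume "y \<in> space ?L"
          then have "\<bar>grad (?\<psi> i) y \<bullet> i\<bar> \<le> \<bar>Cb\<bar>" unfolding Cb_def by (intro order_trans[OF gb abs_ge_self]) simp
          then show "norm (u y * (grad (?\<psi> i) y \<bullet> i)) \<le> norm (u y * Cb)"
            unfolding real_norm_def abs_mult by (intro mult_left_mono) auto
        qed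
        show "(\<lambda>y. u y * (grad (?\<psi> i) y \<bullet> i)) \<in> borel_measurable ?L"
          by (intro borel_measurable_times um borel_measurable_lebesgue_on[OF gm])
      qed
    qed
    have "D \<theta> = \<theta> ^ (?n - 1) * (LINT y|?L. u y * bump_div z r x \<theta> y)"
      unfolding D_def by (subst integral_mult_right_zero[symmetric], intro Bochner_Integration.integral_cong refl) (simp add: mult_ac)
    also have "(LINT y|?L. u y * bump_div z r x \<theta> y) = (\<Sum>i\<in>Basis. LINT y|?L. u y * (grad (?\<psi> i) y \<bullet> i))"
      unfolding bump_grad_sum[symmetric] sum_distrib_left using int by (intro Bochner_Integration.integral_sum)
    also have "\<dots> = - (\<Sum>i\<in>Basis. LINT y|?L. (G y \<bullet> i) * ?\<psi> i y)" by (simp add: wg sum_negf)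
    finally have "\<bar>D \<theta>\<bar> = \<theta> ^ (?n - 1) * \<bar>\<Sum>i\<in>Basis. LINT y|?L. (G y \<bullet> i) * ?\<psi> i y\<bar>" using \<theta>1 by (simp add: abs_mult)
    also have "\<dots> \<le> t ^ (?n - 1) * (\<Sum>i\<in>(Basis::'a set). (2 * r / s) * I)"
    proof (intro mult_mono power_mono order_trans[OF sum_abs] sum_mono)
      fix i :: 'a assume i: "i \<in> Basis"
      have "\<bar>LINT y|?L. (G y \<bullet> i) * ?\<psi> i y\<bar> \<le> (LINT y|?L. \<bar>(G y \<bullet> i) * ?\<psi> i y\<bar>)" by (rule integral_abs_bound)
      also have "\<dots> \<le> (LINT y|?L. (2 * r / s) * (indicator (ball x (2 * r / s)) y * norm (G y)))"
        using Ii \<psi>b[OF i] r st by (intro integral_mono') auto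
      also have "\<dots> = (2 * r / s) * I" by (simp add: I_def)
      finally show "\<bar>LINT y|?L. (G y \<bullet> i) * ?\<psi> i y\<bar> \<le> (2 * r / s) * I" .
    qed (use \<theta> \<theta>1 in auto)
    finally show ?thesis by (simp add: mult_ac)
  qed
  have "norm (U t - U s) \<le> (real ?n * t ^ (?n - 1) * (2 * r / s) * I) * norm (t - s)"
    using st der bd by (intro field_differentiable_bound[of "{s..t}" U D]) (auto intro: has_field_derivative_at_within)
  then show ?thesis using st by (simp add: I_def)
qed

end

lemma test_fun_deriv:
  assumes "\<eta> \<in> test_funs U"
  shows "(\<eta> has_derivative frechet_derivative \<eta> (at x)) (at x)" "continuous_on UNIV (\<lambda>x. frechet_derivative \<eta> (at x) v)"
    "x \<notin> closure {x. \<eta> x \<noteq> 0} \<Longrightarrow> frechet_derivative \<eta> (at x) = (\<lambda>_. 0)"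
proof -
  have s: "smooth \<eta>" using assms by (simp add: test_funs_def)
  have "iter_deriv [] \<eta> differentiable (at x)" for x using s unfolding smooth_def by blast
  then show d: "(\<eta> has_derivative frechet_derivative \<eta> (at x)) (at x)" for x by (simp add: frechet_derivative_works)
  have "iter_deriv [v] \<eta> differentiable (at x)" for x using s unfolding smooth_def by blast
  then show "continuous_on UNIV (\<lambda>x. frechet_derivative \<eta> (at x) v)"
    by (simp add: differentiable_imp_continuous_on differentiable_on_def differentiable_at_withinI)
  show "frechet_derivative \<eta> (at x) = (\<lambda>_. 0)" if x: "x \<notin> closure {x. \<eta> x \<noteq> 0}"
  proof -
    have "(\<eta> has_derivative (\<lambda>_. 0)) (at x)"
    proof (rule has_derivative_transform_within_open[of "\<lambda>_. 0" _ x UNIV "- closure {x. \<eta> x \<noteq> 0}"])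
      show "0 = \<eta> y" if "y \<in> - closure {x. \<eta> x \<noteq> 0}" for y using that closure_subset[of "{x. \<eta> x \<noteq> 0}"] by auto
    qed (use x in auto)
    then show ?thesis using d has_derivative_unique by blast
  qed
qed

lemma grad_inner: "i \<in> Basis \<Longrightarrow> grad \<eta> x \<bullet> i = frechet_derivative \<eta> (at x) i"
  by (simp add: grad_def inner_sum_left_Basis)

lemma finite_measure_lebesgue_on: "S \<in> lmeasurable \<Longrightarrow> finite_measure (lebesgue_on S)"
  by (intro finite_measureI) (auto simp: emeasure_restrict_space fmeasurable_def)

context
  fixes z :: "'a::euclidean_space" and r :: real
  assumes r: "0 < r"
begin

interpretation L: finite_measure "lebesgue_on (ball z r)" by (rule finite_measure_lebesgue_on) simp

interpretation LL: pair_sigma_finite "lebesgue_on (ball z r)" "lebesgue_on (ball z r)" ..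

text \<open>With u = 1 and G = 0, \<open>bump_integral_step\<close> says that the mass of the kernel
  depends neither on \<theta> nor, because of its form at \<theta> = 1, on x.\<close>

lemma weak_grad_one: "has_weak_grad (ball z r) (\<lambda>_. 1) (\<lambda>_. 0)"
  unfolding has_weak_grad_def loc_integrable_def
proof (intro conjI allI ballI impI)
  fix K :: "'a set" assume "compact K \<and> K \<subseteq> ball z r"
  then interpret K: finite_measure "lebesgue_on K" by (intro finite_measure_lebesgue_on lmeasurable_compact) auto
  show "integrable (lebesgue_on K) (\<lambda>_. 1::real)" "integrable (lebesgue_on K) (\<lambda>_. 0::'a)" by auto
next
  fix \<eta> i assume \<eta>: "\<eta> \<in> test_funs (ball z r)" and i: "i \<in> (Basis :: 'a set)"
  let ?C = "closure {x. \<eta> x \<noteq> 0}"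
  have C: "compact ?C" "?C \<subseteq> ball z r" using \<eta> by (auto simp: test_funs_def)
  have "(LINT x|lebesgue_on (ball z r). 1 * (grad \<eta> x \<bullet> i)) = (LINT x|lebesgue. indicator (ball z r) x *\<^sub>R frechet_derivative \<eta> (at x) i)"
    using i by (subst integral_restrict_space) (auto simp: grad_inner)
  also have "\<dots> = (LINT x|lebesgue. frechet_derivative \<eta> (at x) i)"
  proof -
    have "frechet_derivative \<eta> (at x) i = 0" if "x \<notin> ball z r" for x
    proof -
      have "x \<notin> ?C" using that C(2) by blast
      then show ?thesis using test_fun_deriv(3)[OF \<eta>, of x] by simp
    qed
    then show ?thesis by (intro Bochner_Integration.integral_cong) (auto simp: indicator_def)
  qed
  also have "\<dots> = 0"
    by (rule integral_derivative_zero(1)[OF test_fun_deriv(1,2)[OF \<eta>] _ C(1)]) (use closure_subset[of "{x. \<eta> x \<noteq> 0}"] in auto)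
  finally show "(LINT x|lebesgue_on (ball z r). 1 * (grad \<eta> x \<bullet> i)) = - (LINT x|lebesgue_on (ball z r). 0 \<bullet> i * \<eta> x)" by simp
qed

definition bump_mass :: real where "bump_mass = (LINT y|lebesgue_on (ball z r). bump z r z 1 y)"

lemma bump_one: "bump z r x 1 y = bump z r z 1 y"
  by (simp add: bump_def bump_arg_def)

lemma bump_integral_const:
  assumes x: "x \<in> ball z r" and \<theta>: "1 \<le> \<theta>"
  shows "(LINT y|lebesgue_on (ball z r). \<theta> ^ DIM('a) * bump z r x \<theta> y) = bump_mass"
proof -
  have "\<bar>(LINT y|lebesgue_on (ball z r). 1 * (\<theta> ^ DIM('a) * bump z r x \<theta> y)) - (LINT y|lebesgue_on (ball z r). 1 * (1 ^ DIM('a) * bump z r x 1 y))\<bar> \<le> 0"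
    using bump_integral_step[OF r _ _ weak_grad_one x order_refl \<theta>] by simp
  then show ?thesis unfolding bump_mass_def by (simp add: bump_one[of x])
qed

lemma bump_integrable: "integrable (lebesgue_on (ball z r)) (bump z r x \<theta>)"
  by (rule L.integrable_const_bound[of _ 1]) (auto simp: bump_nonneg bump_le_1 intro: borel_measurable_lebesgue_on)

text \<open>On the concentric ball of radius r/4 the argument of \<open>flat 0\<close> is at least
  3/4, so the bump is at least exp(-4/3). The factor r^n is made explicit because it cancels against
  the scaling of the potential.\<close>

lemma bump_mass_ge: "exp (- 4 / 3) * unit_ball_vol (real DIM('a)) / 4 ^ DIM('a) * r ^ DIM('a) \<le> bump_mass"
proof -
  have sub: "ball z (r / 4) \<subseteq> ball z r" using r by auto
  have b: "exp (- 4 / 3) * indicator (ball z (r / 4)) y \<le> bump z r z 1 y" for y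
  proof (cases "y \<in> ball z (r / 4)")
    case True
    then have "(norm (y - z))^2 \<le> (r / 4)^2" by (intro power_mono) (auto simp: dist_norm norm_minus_commute)
    then have a: "bump_arg z r z 1 y \<ge> 3 / 4" using r by (simp add: bump_arg_def field_simps)
    then have "- 4 / 3 \<le> - 1 / bump_arg z r z 1 y" by (simp add: field_simps)
    then show ?thesis using a True by (simp add: bump_def flat_def)
  qed (simp add: bump_nonneg)
  have "exp (- 4 / 3) * unit_ball_vol (real DIM('a)) / 4 ^ DIM('a) * r ^ DIM('a) = exp (- 4 / 3) * measure lebesgue (ball z (r / 4))"
    using r by (simp add: content_ball power_divide)
  also have "\<dots> = (LINT y|lebesgue_on (ball z r). exp (- 4 / 3) * indicator (ball z (r / 4)) y)"
    using sub by (simp add: measure_restrict_space inf.absorb1)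
  also have "\<dots> \<le> bump_mass" unfolding bump_mass_def
    using b sub by (intro integral_mono bump_integrable integrable_mult_right integrable_real_indicator) 
      (use emeasure_bounded_finite[OF bounded_ball, of z "r / 4"] in \<open>auto simp: emeasure_restrict_space sets_restrict_space_iff\<close>)
  finally show ?thesis .
qed

lemma bump_mass_pos: "0 < bump_mass"
  by (rule less_le_trans[OF _ bump_mass_ge]) (use r in simp)

lemma bump_pair_meas [measurable]:
  "(\<lambda>p. bump z r (fst p) \<theta> (snd p)) \<in> borel_measurable (lebesgue_on (ball z r) \<Otimes>\<^sub>M lebesgue_on (ball z r))"
proof -
  have id: "(\<lambda>x. x) \<in> borel_measurable (lebesgue_on (ball z r))" by (rule borel_measurable_lebesgue_on) simp
  have [measurable]: "fst \<in> borel_measurable (lebesgue_on (ball z r) \<Otimes>\<^sub>M lebesgue_on (ball z r))" 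
    "snd \<in> borel_measurable (lebesgue_on (ball z r) \<Otimes>\<^sub>M lebesgue_on (ball z r))"
    using measurable_compose[OF measurable_fst id] measurable_compose[OF measurable_snd id] by auto
  show ?thesis unfolding bump_def bump_arg_def by measurable
qed

text \<open>The kernel keeps its mass \<open>bump_mass\<close> instead of being normalised to 1, so
  the limit for large \<theta> is \<open>bump_mass\<close> times f.\<close>

definition mollify :: "('a \<Rightarrow> real) \<Rightarrow> real \<Rightarrow> 'a \<Rightarrow> real" where
  "mollify f \<theta> x = (LINT y|lebesgue_on (ball z r). f y * (\<theta> ^ DIM('a) * bump z r x \<theta> y))"

lemma mollify_pair_meas:
  assumes [measurable]: "f \<in> borel_measurable (lebesgue_on (ball z r))"
  shows "(\<lambda>p. f (snd p) * (\<theta> ^ DIM('a) * bump z r (fst p) \<theta> (snd p))) \<in> borel_measurable (lebesgue_on (ball z r) \<Otimes>\<^sub>M lebesgue_on (ball z r))"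
  by measurable

lemma mollify_meas [measurable]:
  assumes "f \<in> borel_measurable (lebesgue_on (ball z r))"
  shows "mollify f \<theta> \<in> borel_measurable (lebesgue_on (ball z r))"
  unfolding mollify_def[abs_def] 
  by (rule L.borel_measurable_lebesgue_integral) (use mollify_pair_meas[OF assms, of \<theta>] in \<open>simp add: case_prod_beta'\<close>)

lemma mollify_integrable:
  assumes f: "integrable (lebesgue_on (ball z r)) f" and \<theta>: "0 \<le> \<theta>"
  shows "integrable (lebesgue_on (ball z r)) (\<lambda>y. f y * (\<theta> ^ DIM('a) * bump z r x \<theta> y))"
proof (rule Bochner_Integration.integrable_bound[of _ "\<lambda>y. f y * \<theta> ^ DIM('a)"])
  show "AE y in lebesgue_on (ball z r). norm (f y * (\<theta> ^ DIM('a) * bump z r x \<theta> y)) \<le> norm (f y * \<theta> ^ DIM('a))"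
    using \<theta> bump_le_1[of z r x \<theta>] bump_nonneg[of z r x \<theta>] by (intro AE_I2) (auto simp: abs_mult mult_left_le intro!: mult_left_mono)
  have [measurable]: "f \<in> borel_measurable (lebesgue_on (ball z r))" using f by auto
  note [measurable] = borel_measurable_lebesgue_on[OF bump_meas(1)]
  show "(\<lambda>y. f y * (\<theta> ^ DIM('a) * bump z r x \<theta> y)) \<in> borel_measurable (lebesgue_on (ball z r))" by measurable
qed (use f in simp)

text \<open>For fixed y, the points x at which the kernel is nonzero lie in a ball around y of
  radius 2r/\<theta>, whose volume cancels the factor \<theta>^n. By Fubini the operators are
  bounded on L1 uniformly in \<theta>.\<close>

lemma mollify_L1:
  assumes f: "integrable (lebesgue_on (ball z r)) f" and \<theta>: "0 < \<theta>"
  shows "(\<integral>\<^sup>+x. ennreal \<bar>mollify f \<theta> x\<bar> \<partial>lebesgue_on (ball z r)) 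
    \<le> ennreal (unit_ball_vol (real DIM('a)) * (2 * r) ^ DIM('a)) * (\<integral>\<^sup>+y. ennreal \<bar>f y\<bar> \<partial>lebesgue_on (ball z r))"
proof -
  let ?L = "lebesgue_on (ball z r)" and ?n = "DIM('a)"
  have [measurable]: "f \<in> borel_measurable ?L" using f by auto
  note [measurable] = mollify_pair_meas
  have "(\<integral>\<^sup>+x. ennreal \<bar>mollify f \<theta> x\<bar> \<partial>?L) \<le> (\<integral>\<^sup>+x. \<integral>\<^sup>+y. ennreal \<bar>f y * (\<theta> ^ ?n * bump z r x \<theta> y)\<bar> \<partial>?L \<partial>?L)"
  proof (intro nn_integral_mono)
    fix x
    show "ennreal \<bar>mollify f \<theta> x\<bar> \<le> (\<integral>\<^sup>+y. ennreal \<bar>f y * (\<theta> ^ ?n * bump z r x \<theta> y)\<bar> \<partial>?L)"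
      unfolding mollify_def using integral_norm_bound_ennreal[OF mollify_integrable[OF f, of \<theta> x]] \<theta> by simp
  qed
  also have "\<dots> = (\<integral>\<^sup>+y. \<integral>\<^sup>+x. ennreal \<bar>f y * (\<theta> ^ ?n * bump z r x \<theta> y)\<bar> \<partial>?L \<partial>?L)"
    by (rule LL.Fubini'[symmetric]) (simp add: case_prod_beta')
  also have "\<dots> \<le> (\<integral>\<^sup>+y. ennreal (unit_ball_vol (real ?n) * (2 * r) ^ ?n) * ennreal \<bar>f y\<bar> \<partial>?L)"
  proof (intro nn_integral_mono)
    fix y
    have "(\<integral>\<^sup>+x. ennreal \<bar>f y * (\<theta> ^ ?n * bump z r x \<theta> y)\<bar> \<partial>?L) \<le> (\<integral>\<^sup>+x. ennreal (\<bar>f y\<bar> * \<theta> ^ ?n) * indicator (ball y (2 * r / \<theta>)) x \<partial>?L)"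
    proof (intro nn_integral_mono)
      fix x assume "x \<in> space ?L"
      then have x: "x \<in> ball z r" by simp
      show "ennreal \<bar>f y * (\<theta> ^ ?n * bump z r x \<theta> y)\<bar> \<le> ennreal (\<bar>f y\<bar> * \<theta> ^ ?n) * indicator (ball y (2 * r / \<theta>)) x"
      proof (cases "bump z r x \<theta> y = 0")
        case False
        then have "x \<in> ball y (2 * r / \<theta>)" using bump_ball[OF r False x \<theta>] by (simp add: dist_commute)
        moreover have "\<bar>f y * (\<theta> ^ ?n * bump z r x \<theta> y)\<bar> \<le> \<bar>f y\<bar> * \<theta> ^ ?n"
          using \<theta> bump_le_1[of z r x \<theta> y] bump_nonneg[of z r x \<theta> y] by (auto simp: abs_mult mult_left_le intro!: mult_left_mono)
        ultimately show ?thesis by (simp add: ennreal_leI)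
      qed simp
    qed
    also have "\<dots> = ennreal (\<bar>f y\<bar> * \<theta> ^ ?n) * emeasure ?L (ball y (2 * r / \<theta>) \<inter> ball z r)"
      by (subst nn_integral_restrict_space) 
         (auto simp: emeasure_restrict_space nn_integral_cmult_indicator[symmetric] sets_restrict_space_iff indicator_inter_arith[symmetric] mult.assoc simp del: emeasure_completion nn_integral_cmult_indicator intro!: nn_integral_cong split: split_indicator)
    also have "\<dots> \<le> ennreal (\<bar>f y\<bar> * \<theta> ^ ?n) * emeasure lebesgue (ball y (2 * r / \<theta>))"
      by (intro mult_left_mono) (auto simp: emeasure_restrict_space simp del: emeasure_completion intro!: emeasure_mono)
    also have "emeasure lebesgue (ball y (2 * r / \<theta>)) = ennreal (unit_ball_vol (real ?n) * (2 * r / \<theta>) ^ ?n)"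
      using r \<theta> by (simp add: emeasure_ball)
    also have "ennreal (\<bar>f y\<bar> * \<theta> ^ ?n) * \<dots> = ennreal (unit_ball_vol (real ?n) * (2 * r) ^ ?n) * ennreal \<bar>f y\<bar>"
      using \<theta> r by (simp add: ennreal_mult'[symmetric] ennreal_mult''[symmetric] power_divide mult_ac)
    finally show "(\<integral>\<^sup>+x. ennreal \<bar>f y * (\<theta> ^ ?n * bump z r x \<theta> y)\<bar> \<partial>?L) \<le> ennreal (unit_ball_vol (real ?n) * (2 * r) ^ ?n) * ennreal \<bar>f y\<bar>" .
  qed
  also have "\<dots> = ennreal (unit_ball_vol (real ?n) * (2 * r) ^ ?n) * (\<integral>\<^sup>+y. ennreal \<bar>f y\<bar> \<partial>?L)"
    by (rule nn_integral_cmult) measurable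
  finally show ?thesis .
qed

lemma mollify_uniform:
  assumes g: "integrable (lebesgue_on (ball z r)) g" and d: "\<And>x y. x \<in> ball z r \<Longrightarrow> y \<in> ball z r \<Longrightarrow> dist x y < d \<Longrightarrow> \<bar>g y - g x\<bar> \<le> \<epsilon>"
    and \<theta>: "1 \<le> \<theta>" "2 * r / \<theta> \<le> d" and x: "x \<in> ball z r"
  shows "\<bar>mollify g \<theta> x - bump_mass * g x\<bar> \<le> \<epsilon> * bump_mass"
proof -
  let ?L = "lebesgue_on (ball z r)" and ?b = "\<lambda>y. \<theta> ^ DIM('a) * bump z r x \<theta> y"
  have bi: "integrable ?L ?b" using bump_integrable by simp
  have "mollify g \<theta> x - bump_mass * g x = (LINT y|?L. g y * ?b y) - (LINT y|?L. g x * ?b y)"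
    using bump_integral_const[OF x \<theta>(1)] by (simp add: mollify_def)
  also have "\<dots> = (LINT y|?L. (g y - g x) * ?b y)"
    using mollify_integrable[OF g, of \<theta> x] \<theta> bi by (subst Bochner_Integration.integral_diff[symmetric]) (auto simp: left_diff_distrib)
  also have "\<bar>\<dots>\<bar> \<le> (LINT y|?L. \<bar>(g y - g x) * ?b y\<bar>)" by (rule integral_abs_bound)
  also have "\<dots> \<le> (LINT y|?L. \<epsilon> * ?b y)"
  proof (rule integral_mono')
    fix y assume "y \<in> space ?L"
    then have y: "y \<in> ball z r" by simp
    have b0: "0 \<le> ?b y" using \<theta> bump_nonneg[of z r x \<theta> y] by simp
    show "\<bar>(g y - g x) * ?b y\<bar> \<le> \<epsilon> * ?b y"
    proof (cases "bump z r x \<theta> y = 0")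
      case False
      then have "dist x y < d" using bump_ball[OF r False x] \<theta> by simp
      then have "\<bar>g y - g x\<bar> * ?b y \<le> \<epsilon> * ?b y" using b0 by (intro mult_right_mono d x y)
      then show ?thesis using b0 by (simp only: abs_mult[of "g y - g x"] abs_of_nonneg[OF b0])
    qed simp
    have "0 \<le> \<bar>(g y - g x) * ?b y\<bar>" by simp
    then show "0 \<le> \<epsilon> * ?b y" using \<open>\<bar>(g y - g x) * ?b y\<bar> \<le> \<epsilon> * ?b y\<close> by linarith
  qed (use bi in simp)
  also have "\<dots> = \<epsilon> * bump_mass" using bump_integral_const[OF x \<theta>(1)] by simp
  finally show ?thesis .
qed

text \<open>The uniform L1 bound disposes of u - g for a continuous g close to u; for g itself,
  constant mass and a support of radius 2r/\<theta> around x give uniform convergence. The scales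
  are powers of 2 to match the telescoping sum that uses the result.\<close>

lemma mollify_tendsto_subseq:
  assumes u: "integrable (lebesgue_on (ball z r)) u"
  obtains \<rho> where "strict_mono (\<rho>::nat\<Rightarrow>nat)" 
    "AE x in lebesgue_on (ball z r). (\<lambda>k. mollify u (2 ^ \<rho> k) x) \<longlonglongrightarrow> bump_mass * u x"
proof -
  let ?L = "lebesgue_on (ball z r)" and ?n = "DIM('a)"
  have um[measurable]: "u \<in> borel_measurable ?L" using u by auto
  note [measurable] = mollify_meas
  define CV where "CV = unit_ball_vol (real ?n) * (2 * r) ^ ?n"
  define VB where "VB = measure lebesgue (ball z r)"
  have CV: "0 \<le> CV" using r by (simp add: CV_def)
  have VB: "0 \<le> VB" "emeasure ?L (space ?L) = ennreal VB" 
    by (auto simp: VB_def emeasure_restrict_space emeasure_eq_measure2 simp del: emeasure_completion)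
  have key: "\<exists>N0. \<forall>N\<ge>N0. (\<integral>\<^sup>+x. ennreal (norm (mollify u (2 ^ N) x - bump_mass * u x)) \<partial>?L) \<le> ennreal e" if e: "0 < e" for e :: real
  proof -
    \<comment> \<open>\<open>e1\<close> bounds the L1 distance of u and g, which enters once through
      the kernel and once directly; \<open>e2\<close> bounds the oscillation of g. Each contributes
      at most half of e.\<close>
    define e1 where "e1 = e / (2 * (CV + bump_mass))"
    define e2 where "e2 = e / (2 * (bump_mass * VB + 1))"
    have e1: "0 < e1" using e CV bump_mass_pos by (simp add: e1_def add_nonneg_pos)
    have e2: "0 < e2" using e VB bump_mass_pos by (simp add: e2_def add_nonneg_pos)
    have iu: "integrable lebesgue (\<lambda>x. indicator (ball z r) x *\<^sub>R u x)" using u by (simp add: integrable_restrict_space)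
    obtain g K where g: "continuous_on UNIV g" "\<And>x. \<bar>g x\<bar> \<le> K" 
      "(LINT x:ball z r|lebesgue. \<bar>indicator (ball z r) x *\<^sub>R u x - g x\<bar>) < e1"
      using integrable_approx_continuous[OF iu _ e1, of "ball z r"] by auto
    have gm[measurable]: "g \<in> borel_measurable ?L" by (intro borel_measurable_lebesgue_on borel_measurable_continuous_onI g)
    have gi: "integrable ?L g" by (rule L.integrable_const_bound[of _ K]) (use g(2) in auto)
    have "(LINT x|?L. \<bar>u x - g x\<bar>) = (LINT x:ball z r|lebesgue. \<bar>indicator (ball z r) x *\<^sub>R u x - g x\<bar>)"
      by (subst integral_restrict_space) (auto simp: set_lebesgue_integral_def indicator_def intro!: Bochner_Integration.integral_cong)
    then have ug: "(\<integral>\<^sup>+x. ennreal \<bar>u x - g x\<bar> \<partial>?L) \<le> ennreal e1"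
      using g(3) nn_integral_eq_integral[of ?L "\<lambda>x. \<bar>u x - g x\<bar>"] u gi by (simp add: ennreal_leI)
    have "uniformly_continuous_on (cball z r) g" using g(1) by (intro compact_uniformly_continuous) (auto intro: continuous_on_subset)
    then obtain d where d: "d > 0" "\<And>x y. x \<in> cball z r \<Longrightarrow> y \<in> cball z r \<Longrightarrow> dist y x < d \<Longrightarrow> dist (g y) (g x) < e2"
      by (rule uniformly_continuous_onE[OF _ e2]) metis
    have d': "\<bar>g y - g x\<bar> \<le> e2" if "x \<in> ball z r" "y \<in> ball z r" "dist x y < d" for x y
      using d(2)[of x y] that by (simp add: dist_real_def dist_commute)
    have "(\<lambda>N. 2 * r * (1/2) ^ N) \<longlonglongrightarrow> 2 * r * 0" by (intro tendsto_intros LIMSEQ_realpow_zero) auto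
    then have "\<forall>\<^sub>F N in sequentially. 2 * r * (1/2) ^ N < d" using d by (intro order_tendstoD(2)) auto
    then obtain N0 where N0: "\<And>N. N \<ge> N0 \<Longrightarrow> 2 * r * (1/2) ^ N < d" by (auto simp: eventually_sequentially)
    have "(\<integral>\<^sup>+x. ennreal (norm (mollify u (2 ^ N) x - bump_mass * u x)) \<partial>?L) \<le> ennreal e" if N: "N \<ge> N0" for N
    proof -
      have \<theta>: "2 * r / 2 ^ N \<le> d" using N0[OF N] by (simp add: power_divide)
      have lin: "mollify (\<lambda>x. u x - g x) (2 ^ N) x = mollify u (2 ^ N) x - mollify g (2 ^ N) x" for x
        unfolding mollify_def left_diff_distrib using mollify_integrable[OF u, of "2 ^ N" x] mollify_integrable[OF gi, of "2 ^ N" x]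
        by (intro Bochner_Integration.integral_diff) auto
      have "(\<integral>\<^sup>+x. ennreal (norm (mollify u (2 ^ N) x - bump_mass * u x)) \<partial>?L) \<le> 
        (\<integral>\<^sup>+x. ennreal \<bar>mollify (\<lambda>x. u x - g x) (2 ^ N) x\<bar> + (ennreal (e2 * bump_mass) + ennreal bump_mass * ennreal \<bar>u x - g x\<bar>) \<partial>?L)"
      proof (intro nn_integral_mono)
        fix x assume "x \<in> space ?L"
        then have x: "x \<in> ball z r" by simp
        have "\<bar>mollify g (2 ^ N) x - bump_mass * g x\<bar> \<le> e2 * bump_mass" by (rule mollify_uniform[OF gi d' _ \<theta> x]) auto
        moreover have "\<bar>bump_mass * g x - bump_mass * u x\<bar> = bump_mass * \<bar>u x - g x\<bar>"
          using bump_mass_pos by (simp add: right_diff_distrib[symmetric] abs_mult abs_minus_commute)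
        ultimately have "\<bar>mollify u (2 ^ N) x - bump_mass * u x\<bar> \<le> \<bar>mollify (\<lambda>x. u x - g x) (2 ^ N) x\<bar> + (e2 * bump_mass + bump_mass * \<bar>u x - g x\<bar>)"
          unfolding lin by linarith
        then have "ennreal \<bar>mollify u (2 ^ N) x - bump_mass * u x\<bar> \<le> ennreal (\<bar>mollify (\<lambda>x. u x - g x) (2 ^ N) x\<bar> + (e2 * bump_mass + bump_mass * \<bar>u x - g x\<bar>))"
          by (rule ennreal_leI)
        then show "ennreal (norm (mollify u (2 ^ N) x - bump_mass * u x)) \<le> ennreal \<bar>mollify (\<lambda>x. u x - g x) (2 ^ N) x\<bar> + (ennreal (e2 * bump_mass) + ennreal bump_mass * ennreal \<bar>u x - g x\<bar>)"
          using bump_mass_pos e2 by (simp add: ennreal_mult')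
      qed
      also have "\<dots> = (\<integral>\<^sup>+x. ennreal \<bar>mollify (\<lambda>x. u x - g x) (2 ^ N) x\<bar> \<partial>?L) + (ennreal (e2 * bump_mass) * ennreal VB + ennreal bump_mass * (\<integral>\<^sup>+x. ennreal \<bar>u x - g x\<bar> \<partial>?L))"
        unfolding VB(2)[symmetric] by (subst nn_integral_add) (auto simp: nn_integral_add nn_integral_cmult)
      also have "\<dots> \<le> ennreal CV * ennreal e1 + (ennreal (e2 * bump_mass) * ennreal VB + ennreal bump_mass * ennreal e1)"
        using mollify_L1[of "\<lambda>x. u x - g x" "2 ^ N"] u gi ug unfolding CV_def[symmetric]
        by (intro add_mono mult_left_mono order_refl) (auto intro: order_trans[OF _ mult_left_mono[OF ug]])
      also have "\<dots> = ennreal ((CV + bump_mass) * e1 + (bump_mass * VB) * e2)"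
        using CV VB e1 e2 bump_mass_pos by (simp add: ennreal_mult'[symmetric] ennreal_plus[symmetric] algebra_simps del: ennreal_plus)
      also have "(CV + bump_mass) * e1 + (bump_mass * VB) * e2 \<le> e"
      proof -
        have half: "y * (e / (2 * y)) = e / 2" if "y \<noteq> 0" for y :: real using that by simp
        have "CV + bump_mass \<noteq> 0" using CV bump_mass_pos by linarith
        then have "(CV + bump_mass) * e1 = e / 2" unfolding e1_def by (rule half)
        moreover have "(bump_mass * VB) * e2 \<le> (bump_mass * VB + 1) * e2" using e2 by (intro mult_right_mono) auto
        moreover have "(bump_mass * VB + 1) * e2 = e / 2"
        proof -
          have "bump_mass * VB + 1 \<noteq> 0" using mult_nonneg_nonneg[OF less_imp_le[OF bump_mass_pos] VB(1)] by linarith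
          then show ?thesis unfolding e2_def by (rule half)
        qed
        ultimately show ?thesis by linarith
      qed
      finally show ?thesis by (simp add: ennreal_leI)
    qed
    then show ?thesis by blast
  qed
  obtain \<rho> where "strict_mono (\<rho>::nat\<Rightarrow>nat)" "AE x in ?L. (\<lambda>k. mollify u (2 ^ \<rho> k) x - bump_mass * u x) \<longlonglongrightarrow> 0"
    by (rule L1_AE_subseq[of "\<lambda>N x. mollify u (2 ^ N) x - bump_mass * u x" ?L]) (use key in auto)
  then show thesis using that by (auto simp: LIM_zero_iff)
qed

text \<open>Telescoping over \<theta> = 2^j starts at \<theta> = 1, where the mollification is the
  same number for all x and defines c. Divided by the mass, each step costs a multiple of r F_j(x) /
  2^j. In place of the full series a finite sum is used, up to a scale at which the mollification
  has recovered half of |u(x) - c|; this presupposes u(x) \<noteq> c and doubles the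
  constant.\<close>

lemma pointwise_potential:
  assumes u: "integrable (lebesgue_on (ball z r)) u" and G: "integrable (lebesgue_on (ball z r)) G"
    and w: "has_weak_grad (ball z r) u G"
  defines "F \<equiv> \<lambda>j x. (2 ^ j / (2 * r)) ^ DIM('a) * (LINT y|lebesgue_on (ball z r). indicator (ball x (2 * r / 2 ^ j)) y * norm (G y))"
  defines "CP \<equiv> real DIM('a) * 4 * 4 ^ DIM('a) * 4 ^ DIM('a) / (exp (- 4 / 3) * unit_ball_vol (real DIM('a)))"
  obtains c where "AE x in lebesgue_on (ball z r). u x \<noteq> c \<longrightarrow> (\<exists>k. \<bar>u x - c\<bar> \<le> CP * r * (\<Sum>j<k. F j x / 2 ^ j))"
proof -
  let ?L = "lebesgue_on (ball z r)" and ?n = "DIM('a)"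
  define c where "c = mollify u 1 z / bump_mass"
  define cN where "cN = exp (- 4 / 3) * unit_ball_vol (real ?n) / 4 ^ ?n"
  have cN: "0 < cN" "cN * r ^ ?n \<le> bump_mass" using bump_mass_ge by (auto simp: cN_def)
  have F0: "0 \<le> F j x" for j x unfolding F_def using r by (intro mult_nonneg_nonneg integral_nonneg_AE) auto
  have m1: "mollify u 1 x = bump_mass * c" for x
    using bump_mass_pos by (simp add: c_def mollify_def bump_one[of x])
  have step: "\<bar>mollify u (2 ^ Suc j) x - mollify u (2 ^ j) x\<bar> \<le> real ?n * (2 * 4 ^ ?n * r) * r ^ ?n * (F j x / 2 ^ j)" if x: "x \<in> ball z r" for j x
  proof -
    define I where "I = (LINT y|?L. indicator (ball x (2 * r / 2 ^ j)) y * norm (G y))"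
    have I0: "0 \<le> I" unfolding I_def by (intro integral_nonneg_AE) auto
    obtain m where m: "?n = Suc m" using DIM_positive[where 'a='a] gr0_conv_Suc by blast
    have "\<bar>mollify u (2 ^ Suc j) x - mollify u (2 ^ j) x\<bar> \<le> (real ?n * (2 ^ Suc j) ^ (?n - 1) * (2 * r / 2 ^ j) * I) * (2 ^ Suc j - 2 ^ j)"
      unfolding mollify_def I_def by (rule bump_integral_step[OF r u G w x]) auto
    also have "\<dots> = real ?n * (2 * r) * (2 ^ m * (2 ^ j) ^ m * I)" by (simp add: m power_mult_distrib)
    also have "(2 ^ m * (2 ^ j) ^ m * I) = 2 ^ m * (2 * r) ^ ?n * (F j x / 2 ^ j)"
      using r by (simp add: F_def I_def[symmetric] m power_divide power_mult_distrib)
    also have "\<dots> = (2 ^ m * 2 ^ ?n) * r ^ ?n * (F j x / 2 ^ j)" by (simp add: power_mult_distrib)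
    \<comment> \<open>The power 2^m stems from the upper end 2^(j+1) of the scale interval, 2^n from
      the normalisation of \<open>F\<close> by (2r)^n.\<close>
    also have "\<dots> \<le> 4 ^ ?n * r ^ ?n * (F j x / 2 ^ j)"
    proof (intro mult_right_mono)
      have "(2::real) ^ m * 2 ^ ?n \<le> 2 ^ ?n * 2 ^ ?n" by (simp add: m)
      also have "\<dots> = 4 ^ ?n" by (simp add: power_mult_distrib[symmetric])
      finally show "(2::real) ^ m * 2 ^ ?n \<le> 4 ^ ?n" .
    qed (use r F0 in auto)
    finally show ?thesis using r by (simp add: mult_ac mult_left_mono)
  qed
  have tele: "\<bar>mollify u (2 ^ k) x - bump_mass * c\<bar> \<le> real ?n * (2 * 4 ^ ?n * r) * r ^ ?n * (\<Sum>j<k. F j x / 2 ^ j)" if x: "x \<in> ball z r" for k x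
  proof (induction k)
    case 0 then show ?case by (simp add: m1)
  next
    case (Suc k)
    then show ?case using step[OF x, of k] by (simp add: distrib_left)
  qed
  obtain \<rho> where \<rho>: "strict_mono (\<rho>::nat\<Rightarrow>nat)" "AE x in ?L. (\<lambda>k. mollify u (2 ^ \<rho> k) x) \<longlonglongrightarrow> bump_mass * u x"
    using mollify_tendsto_subseq[OF u] by blast
  have "AE x in ?L. u x \<noteq> c \<longrightarrow> (\<exists>k. \<bar>u x - c\<bar> \<le> CP * r * (\<Sum>j<k. F j x / 2 ^ j))"
    using \<rho>(2) AE_space
  proof eventually_elim
    case (elim x)
    show ?case
    proof
      assume ne: "u x \<noteq> c"
      have x: "x \<in> ball z r" using elim by simp
      have "(\<lambda>k. \<bar>mollify u (2 ^ \<rho> k) x - bump_mass * c\<bar>) \<longlonglongrightarrow> \<bar>bump_mass * u x - bump_mass * c\<bar>" using elim by (intro tendsto_intros)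
      moreover have "bump_mass * \<bar>u x - c\<bar> / 2 < \<bar>bump_mass * u x - bump_mass * c\<bar>"
        using ne bump_mass_pos by (simp add: right_diff_distrib[symmetric] abs_mult)
      ultimately have "\<forall>\<^sub>F k in sequentially. bump_mass * \<bar>u x - c\<bar> / 2 < \<bar>mollify u (2 ^ \<rho> k) x - bump_mass * c\<bar>"
        by (rule order_tendstoD(1))
      then obtain k where k: "bump_mass * \<bar>u x - c\<bar> / 2 < \<bar>mollify u (2 ^ \<rho> k) x - bump_mass * c\<bar>"
        using eventually_happens'[OF sequentially_bot] by blast
      have "cN * r ^ ?n * \<bar>u x - c\<bar> \<le> bump_mass * \<bar>u x - c\<bar>" using cN by (intro mult_right_mono) auto
      also have "\<dots> \<le> 2 * (real ?n * (2 * 4 ^ ?n * r) * r ^ ?n * (\<Sum>j<\<rho> k. F j x / 2 ^ j))" using k tele[OF x, of "\<rho> k"] by linarith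
      finally have "r ^ ?n * (cN * \<bar>u x - c\<bar>) \<le> r ^ ?n * (4 * real ?n * 4 ^ ?n * r * (\<Sum>j<\<rho> k. F j x / 2 ^ j))" by (simp add: mult_ac)
      then have "cN * \<bar>u x - c\<bar> \<le> 4 * real ?n * 4 ^ ?n * r * (\<Sum>j<\<rho> k. F j x / 2 ^ j)" using r by simp
      then have "\<bar>u x - c\<bar> \<le> 4 * real ?n * 4 ^ ?n * r * (\<Sum>j<\<rho> k. F j x / 2 ^ j) / cN" using cN by (simp add: pos_le_divide_eq mult.commute)
      also have "\<dots> = CP * r * (\<Sum>j<\<rho> k. F j x / 2 ^ j)" by (simp add: CP_def cN_def)
      finally show "\<exists>k. \<bar>u x - c\<bar> \<le> CP * r * (\<Sum>j<k. F j x / 2 ^ j)" by blast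
    qed
  qed
  then show thesis by (rule that)
qed

end

section \<open>Integrating the potential\<close>

lemma sigma_finite_lebesgue: "sigma_finite_measure (lebesgue :: 'a::euclidean_space measure)"
proof -
  obtain A :: "'a set set" where A: "countable A" "A \<subseteq> sets lborel" "\<Union>A = space lborel" "\<forall>a\<in>A. emeasure lborel a \<noteq> \<infinity>"
    using lborel.sigma_finite_countable by blast
  show ?thesis
  proof
    show "\<exists>A::'a set set. countable A \<and> A \<subseteq> sets lebesgue \<and> \<Union>A = space lebesgue \<and> (\<forall>a\<in>A. emeasure lebesgue a \<noteq> \<infinity>)"
      using A by (intro exI[of _ A]) (auto simp: subset_iff)
  qed
qed

interpretation lebesgue: sigma_finite_measure "lebesgue :: 'a::euclidean_space measure"
  by (rule sigma_finite_lebesgue)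

interpretation lebesgue_pair: pair_sigma_finite "lebesgue :: 'a::euclidean_space measure" "lebesgue :: 'a::euclidean_space measure" ..

lemma borel_measurable_diff_pair:
  assumes [measurable]: "h \<in> borel_measurable borel"
  shows "(\<lambda>p. h (fst p - snd p :: 'a::euclidean_space)) \<in> borel_measurable (lebesgue \<Otimes>\<^sub>M lebesgue)"
proof -
  have id: "(\<lambda>x::'a. x) \<in> borel_measurable lebesgue" by (intro measurable_completion) simp
  have [measurable]: "fst \<in> borel_measurable (lebesgue \<Otimes>\<^sub>M lebesgue :: ('a \<times> 'a) measure)" 
    "snd \<in> borel_measurable (lebesgue \<Otimes>\<^sub>M lebesgue :: ('a \<times> 'a) measure)"
    using measurable_compose[OF measurable_fst id] measurable_compose[OF measurable_snd id] by auto
  show ?thesis by measurable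
qed

text \<open>Normalised by l^n instead of the volume of the ball, which matches the means over
  cubes.\<close>

definition ball_avg :: "('a::euclidean_space \<Rightarrow> real) \<Rightarrow> real \<Rightarrow> 'a \<Rightarrow> real" where
  "ball_avg f l x = enn2real (\<integral>\<^sup>+y\<in>ball x l. ennreal (f y) \<partial>lebesgue) / l ^ DIM('a)"

context double_phase_A
begin

text \<open>Applying \<open>average_powr\<close> with the actual modular m of Q, while keeping d in
  the factor (d / l^n)^e, makes the bound linear in m. Linear bounds on single cubes can be
  integrated over a family of cubes. For m = 0 small positive values replace m.\<close>

lemma average_powr_linear:
  assumes l: "0 < l" and Q: "Q = cbox c (c + l *\<^sub>R One)"
    and f[measurable]: "f \<in> borel_measurable lebesgue" "\<And>x. 0 \<le> f x"
    and d: "0 < d" "d \<le> 1"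
    and le: "(\<integral>\<^sup>+x\<in>Q. ennreal (ph x (f x)) \<partial>lebesgue) \<le> ennreal d"
    and e: "0 \<le> e" "e \<le> 1" and be: "(4 / ainf_const) * (2 * 2 ^ DIM('a)) powr e * (1 - ainf_const) + 2 powr e \<le> 4 / ainf_const"
  shows "(\<integral>\<^sup>+x\<in>Q. ennreal (ph x (enn2real (\<integral>\<^sup>+x\<in>Q. ennreal (f x) \<partial>lebesgue) / l ^ DIM('a)) powr (1 + e)) \<partial>lebesgue)
    \<le> ennreal (avg_powr_const * (d / l ^ DIM('a)) powr e) * (\<integral>\<^sup>+x\<in>Q. ennreal (ph x (f x)) \<partial>lebesgue)"
    (is "?I \<le> _ * ?m")
proof -
  have m: "?m \<le> ennreal d" by (fact le)
  then obtain m where mm: "?m = ennreal m" "0 \<le> m" "m \<le> d" using d by (cases ?m) (auto simp: top_unique)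
  have key: "?I \<le> ennreal (avg_powr_const * (d / l ^ DIM('a)) powr e * d')" if d': "0 < d'" "m \<le> d'" "d' \<le> d" for d'
  proof -
    have "?I \<le> ennreal (avg_powr_const * d' * (d' / l ^ DIM('a)) powr e)"
      using mm d' d by (intro average_powr[OF l Q f _ _ _ e be]) (auto intro: ennreal_leI)
    also have "\<dots> \<le> ennreal (avg_powr_const * d' * (d / l ^ DIM('a)) powr e)"
      using avg_powr_const_pos d' l e by (intro ennreal_leI mult_left_mono powr_mono2 divide_right_mono) auto
    finally show ?thesis by (simp add: mult_ac)
  qed
  show ?thesis
  proof (cases "m = 0")
    case False
    then have "?I \<le> ennreal (avg_powr_const * (d / l ^ DIM('a)) powr e * m)" using mm by (intro key) auto
    then show ?thesis using mm avg_powr_const_pos by (simp add: ennreal_mult')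
  next
    case True
    define K where "K = avg_powr_const * (d / l ^ DIM('a)) powr e"
    have K: "0 \<le> K" using avg_powr_const_pos by (simp add: K_def)
    have "?I \<le> 0 + ennreal \<eta>" if \<eta>: "0 < \<eta>" for \<eta>
    proof -
      define d' where "d' = min d (\<eta> / (K + 1))"
      have d': "0 < d'" "d' \<le> d" using d \<eta> K by (auto simp: d'_def)
      have "?I \<le> ennreal (K * d')" unfolding K_def using d' True by (intro key) auto
      also have "K * d' \<le> (K + 1) * d'" using d' by (intro mult_right_mono) auto
      also have "\<dots> \<le> (K + 1) * (\<eta> / (K + 1))" using K by (intro mult_left_mono) (auto simp: d'_def)
      also have "\<dots> = \<eta>" using K by simp
      finally show ?thesis by (simp add: ennreal_leI)
    qed
    then have "?I \<le> 0" by (rule ennreal_le_epsilon)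
    then show ?thesis by simp
  qed
qed

text \<open>All translates of a cube of side 4l are used at once. If |x - y| < l, the ball around x
  lies in the cube \<open>Q y\<close> around y, so \<open>ball_avg\<close> at x is at most 4^n times
  the mean over \<open>Q y\<close>. Integrating over these y, a set of volume V l^n, and exchanging
  the integrals leaves a constant argument on each cube, where \<open>average_powr_linear\<close>
  applies. After exchanging back, each x lies in \<open>Q y\<close> for a set of y of measure
  (4l)^n, and the factors l^n cancel.\<close>

lemma ball_avg_powr:
  fixes f :: "'a \<Rightarrow> real"
  assumes l: "0 < l"
    and f[measurable]: "f \<in> borel_measurable lebesgue" "\<And>x. 0 \<le> f x"
    and d: "0 < d" "d \<le> 1"
    and le: "(\<integral>\<^sup>+x. ennreal (ph x (f x)) \<partial>lebesgue) \<le> ennreal d"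
    and e: "0 \<le> e" "e \<le> 1" and be: "(4 / ainf_const) * (2 * 2 ^ DIM('a)) powr e * (1 - ainf_const) + 2 powr e \<le> 4 / ainf_const"
  defines "CB \<equiv> (4 ^ DIM('a)) powr (2 * q) * avg_powr_const * 4 ^ DIM('a) / unit_ball_vol (real DIM('a))"
  shows "(\<integral>\<^sup>+x. ennreal (ph x (ball_avg f l x) powr (1 + e)) \<partial>lebesgue) \<le> ennreal (CB * d * (d / l ^ DIM('a)) powr e)"
    "ball_avg f l \<in> borel_measurable lebesgue"
    "(\<integral>\<^sup>+y\<in>ball x l. ennreal (f y) \<partial>lebesgue) < \<infinity>"
proof -
  let ?n = "DIM('a)"
  define C0 where "C0 = cbox ((-2 * l) *\<^sub>R One) ((2 * l) *\<^sub>R (One :: 'a))"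
  define Q where "Q y = cbox (y - (2 * l) *\<^sub>R One) (y - (2 * l) *\<^sub>R One + (4 * l) *\<^sub>R One)" for y :: 'a
  define B0 where "B0 = ball (0::'a) l"
  have QC: "x \<in> Q y \<longleftrightarrow> x - y \<in> C0" "x \<in> Q y \<longleftrightarrow> y \<in> Q x" for x y
    unfolding Q_def C0_def by (force simp: mem_box inner_simps)+
  have BB: "y \<in> ball x l \<longleftrightarrow> x - y \<in> B0" for x y by (simp add: B0_def dist_norm norm_minus_commute)
  have l4: "0 < 4 * l" using l by simp
  have Qc: "Q y \<in> cubes" for y unfolding Q_def cubes_def using l4 by blast
  have mQ: "emeasure lebesgue (Q y) = ennreal ((4 * l) ^ ?n)" for y
    using hcube_measure(5)[OF l4, of "y - (2 * l) *\<^sub>R One"] cube_emeasure(4)[OF Qc, of y] unfolding Q_def by simp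
  have leQ: "(\<integral>\<^sup>+x\<in>Q y. ennreal (ph x (f x)) \<partial>lebesgue) \<le> ennreal d" for y
    by (rule order_trans[OF nn_integral_mono le]) (auto simp: indicator_def)
  have fin: "(\<integral>\<^sup>+x\<in>Q y. ennreal (f x) \<partial>lebesgue) < \<infinity>" for y by (rule averaging_hom(1)[OF Qc f d leQ])
  have ballQ: "ball x l \<subseteq> Q y" if "dist x y < l" for x y
  proof
    fix w assume "w \<in> ball x l"
    then have "dist w y < 2 * l" using that dist_triangle[of w y x] by (simp add: dist_commute)
    then have "\<bar>(w - y) \<bullet> i\<bar> \<le> 2 * l" if "i \<in> Basis" for i
      using Basis_le_norm[OF that, of "w - y"] by (simp add: dist_norm)
    then have "- (2 * l) \<le> w \<bullet> i - y \<bullet> i \<and> w \<bullet> i - y \<bullet> i \<le> 2 * l" if "i \<in> Basis" for i using that by (fastforce simp: inner_diff_left abs_le_iff)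
    then show "w \<in> Q y" by (force simp: QC(1) C0_def mem_box inner_simps)
  qed
  show "(\<integral>\<^sup>+y\<in>ball x l. ennreal (f y) \<partial>lebesgue) < \<infinity>" for x
    by (rule le_less_trans[OF nn_integral_mono fin[of x]]) (use ballQ[of x x] l in \<open>auto simp: indicator_def\<close>)
  have indC[measurable]: "(\<lambda>p. indicator C0 (fst p - snd p) :: ennreal) \<in> borel_measurable (lebesgue \<Otimes>\<^sub>M lebesgue)"
    by (rule borel_measurable_diff_pair) (simp add: C0_def)
  have indB[measurable]: "(\<lambda>p. indicator B0 (fst p - snd p) :: ennreal) \<in> borel_measurable (lebesgue \<Otimes>\<^sub>M lebesgue)"
    unfolding B0_def by (intro borel_measurable_diff_pair borel_measurable_indicator) auto
  have [measurable]: "(\<lambda>p. f (fst p)) \<in> borel_measurable (lebesgue \<Otimes>\<^sub>M lebesgue)" "(\<lambda>p. f (snd p)) \<in> borel_measurable (lebesgue \<Otimes>\<^sub>M lebesgue)"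
    using measurable_compose[OF measurable_fst f(1)] measurable_compose[OF measurable_snd f(1)] by auto
  have [measurable]: "(\<lambda>p. a (fst p)) \<in> borel_measurable (lebesgue \<Otimes>\<^sub>M lebesgue)"
    using measurable_compose[OF measurable_fst a_meas] by auto
  have "(\<lambda>x. \<integral>\<^sup>+y. ennreal (f y) * indicator B0 (x - y) \<partial>lebesgue) \<in> borel_measurable lebesgue"
    by (rule lebesgue.borel_measurable_nn_integral) (simp add: case_prod_beta')
  moreover have "(\<integral>\<^sup>+y\<in>ball x l. ennreal (f y) \<partial>lebesgue) = (\<integral>\<^sup>+y. ennreal (f y) * indicator B0 (x - y) \<partial>lebesgue)" for x
    by (intro nn_integral_cong) (simp add: indicator_def BB del: mem_ball)
  ultimately show bm[measurable]: "ball_avg f l \<in> borel_measurable lebesgue" unfolding ball_avg_def[abs_def] by simp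
  define av where "av y = enn2real (\<integral>\<^sup>+x\<in>Q y. ennreal (f x) \<partial>lebesgue) / (4 * l) ^ ?n" for y
  have av0: "0 \<le> av y" for y using l by (simp add: av_def)
  have "(\<lambda>y. \<integral>\<^sup>+x. ennreal (f x) * indicator C0 (y - x) \<partial>lebesgue) \<in> borel_measurable lebesgue"
    by (rule lebesgue.borel_measurable_nn_integral) (simp add: case_prod_beta')
  moreover have "(\<integral>\<^sup>+x\<in>Q y. ennreal (f x) \<partial>lebesgue) = (\<integral>\<^sup>+x. ennreal (f x) * indicator C0 (y - x) \<partial>lebesgue)" for y
    by (intro nn_integral_cong) (simp add: indicator_def QC(1)[symmetric] QC(2)[of _ y])
  ultimately have avm[measurable]: "av \<in> borel_measurable lebesgue" unfolding av_def[abs_def] by simp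
  have [measurable]: "(\<lambda>p. av (snd p)) \<in> borel_measurable (lebesgue \<Otimes>\<^sub>M lebesgue)"
    using measurable_compose[OF measurable_snd avm] by auto
  have ba_le: "ball_avg f l x \<le> 4 ^ ?n * av y" if "dist x y < l" for x y
  proof -
    have "(\<integral>\<^sup>+y\<in>ball x l. ennreal (f y) \<partial>lebesgue) \<le> (\<integral>\<^sup>+x\<in>Q y. ennreal (f x) \<partial>lebesgue)"
      using ballQ[OF that] by (intro nn_integral_mono) (auto simp: indicator_def)
    then have "enn2real (\<integral>\<^sup>+y\<in>ball x l. ennreal (f y) \<partial>lebesgue) \<le> enn2real (\<integral>\<^sup>+x\<in>Q y. ennreal (f x) \<partial>lebesgue)"
      using fin[of y] by (intro enn2real_mono) auto
    then have "ball_avg f l x \<le> enn2real (\<integral>\<^sup>+x\<in>Q y. ennreal (f x) \<partial>lebesgue) / l ^ ?n"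
      unfolding ball_avg_def using l by (intro divide_right_mono) auto
    also have "\<dots> = 4 ^ ?n * av y" using l by (simp add: av_def power_mult_distrib)
    finally show ?thesis .
  qed
  have ba0: "0 \<le> ball_avg f l x" for x using l by (simp add: ball_avg_def)
  define K where "K = (4 ^ ?n) powr (2 * q)"
  have pw: "ph x (ball_avg f l x) powr (1 + e) \<le> K * ph x (av y) powr (1 + e)" if "dist x y < l" for x y
  proof -
    have "ph x (ball_avg f l x) \<le> ph x (4 ^ ?n * av y)" by (intro ph_mono ba0 ba_le that)
    also have "\<dots> \<le> (4 ^ ?n) powr q * ph x (av y)" by (intro ph_scale_le av0) simp
    finally have "ph x (ball_avg f l x) powr (1 + e) \<le> ((4 ^ ?n) powr q * ph x (av y)) powr (1 + e)" using e by (intro powr_mono2) auto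
    also have "\<dots> = (4 ^ ?n) powr (q * (1 + e)) * ph x (av y) powr (1 + e)" by (simp add: powr_mult powr_powr)
    also have "\<dots> \<le> K * ph x (av y) powr (1 + e)"
      unfolding K_def using e p1 pq by (intro mult_right_mono powr_mono) auto
    finally show ?thesis .
  qed
  have K: "0 \<le> K" by (simp add: K_def)
  define V where "V = unit_ball_vol (real ?n)"
  have V: "V > 0" by (simp add: V_def)
  let ?D = "(d / (4 * l) ^ ?n) powr e"
  have mB: "(\<integral>\<^sup>+y. indicator B0 (x - y) \<partial>lebesgue) = ennreal (V * l ^ ?n)" for x
  proof -
    have "(\<integral>\<^sup>+y. indicator B0 (x - y) \<partial>lebesgue) = (\<integral>\<^sup>+y. indicator (ball x l) y \<partial>lebesgue)"
      by (intro nn_integral_cong) (simp add: indicator_def BB del: mem_ball)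
    also have "\<dots> = ennreal (V * l ^ ?n)" using l by (simp add: emeasure_ball V_def)
    finally show ?thesis .
  qed
  have phm[measurable]: "(\<lambda>p. ph (fst p) (av (snd p))) \<in> borel_measurable (lebesgue \<Otimes>\<^sub>M lebesgue)" unfolding ph_def by measurable
  have phf[measurable]: "(\<lambda>p. ph (fst p) (f (fst p))) \<in> borel_measurable (lebesgue \<Otimes>\<^sub>M lebesgue)" unfolding ph_def by measurable
  have "ennreal (V * l ^ ?n) * (\<integral>\<^sup>+x. ennreal (ph x (ball_avg f l x) powr (1 + e)) \<partial>lebesgue)
     = (\<integral>\<^sup>+x. \<integral>\<^sup>+y. ennreal (ph x (ball_avg f l x) powr (1 + e)) * indicator B0 (x - y) \<partial>lebesgue \<partial>lebesgue)"
  proof -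
    have i: "(\<integral>\<^sup>+y. ennreal (ph x (ball_avg f l x) powr (1 + e)) * indicator B0 (x - y) \<partial>lebesgue) 
       = ennreal (V * l ^ ?n) * ennreal (ph x (ball_avg f l x) powr (1 + e))" for x
    proof -
      have [measurable]: "(\<lambda>y. indicator B0 (x - y) :: ennreal) \<in> borel_measurable lebesgue"
        using measurable_compose[OF measurable_Pair1' indB, of x] by simp
      show ?thesis by (subst nn_integral_cmult) (auto simp: mB mult.commute)
    qed
    show ?thesis unfolding i by (subst nn_integral_cmult) auto
  qed
  also have "\<dots> \<le> (\<integral>\<^sup>+x. \<integral>\<^sup>+y. ennreal (K * ph x (av y) powr (1 + e)) * indicator B0 (x - y) \<partial>lebesgue \<partial>lebesgue)"
    using pw BB by (intro nn_integral_mono) (auto simp: indicator_def B0_def dist_norm intro!: ennreal_leI)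
  also have "\<dots> = (\<integral>\<^sup>+y. \<integral>\<^sup>+x. ennreal (K * ph x (av y) powr (1 + e)) * indicator B0 (x - y) \<partial>lebesgue \<partial>lebesgue)"
    by (rule lebesgue_pair.Fubini'[symmetric]) (simp add: case_prod_beta')
  also have "\<dots> \<le> (\<integral>\<^sup>+y. ennreal (K * (avg_powr_const * ?D)) * (\<integral>\<^sup>+x. ennreal (ph x (f x)) * indicator C0 (x - y) \<partial>lebesgue) \<partial>lebesgue)"
  proof (intro nn_integral_mono)
    fix y :: 'a
    have [measurable]: "Q y \<in> sets lebesgue" by (simp add: Q_def)
    have "(\<integral>\<^sup>+x. ennreal (K * ph x (av y) powr (1 + e)) * indicator B0 (x - y) \<partial>lebesgue)
      \<le> (\<integral>\<^sup>+x. ennreal K * (ennreal (ph x (av y) powr (1 + e)) * indicator (Q y) x) \<partial>lebesgue)"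
    proof (intro nn_integral_mono)
      fix x
      show "ennreal (K * ph x (av y) powr (1 + e)) * indicator B0 (x - y) \<le> ennreal K * (ennreal (ph x (av y) powr (1 + e)) * indicator (Q y) x)"
      proof (cases "x - y \<in> B0")
        case True
        then have "dist x y < l" by (simp add: B0_def dist_norm norm_minus_commute)
        then have "x \<in> Q y" using ballQ[of x y] l by auto
        then show ?thesis using True K by (simp add: ennreal_mult')
      qed simp
    qed
    also have "\<dots> = ennreal K * (\<integral>\<^sup>+x\<in>Q y. ennreal (ph x (av y) powr (1 + e)) \<partial>lebesgue)"
      by (intro nn_integral_cmult) measurable
    also have "\<dots> \<le> ennreal K * (ennreal (avg_powr_const * ?D) * (\<integral>\<^sup>+x\<in>Q y. ennreal (ph x (f x)) \<partial>lebesgue))"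
      unfolding av_def by (intro mult_left_mono average_powr_linear[OF l4 Q_def f d leQ e be]) auto
    also have "\<dots> = ennreal (K * (avg_powr_const * ?D)) * (\<integral>\<^sup>+x. ennreal (ph x (f x)) * indicator C0 (x - y) \<partial>lebesgue)"
      using K by (simp add: ennreal_mult' mult.assoc indicator_def QC(1))
    finally show "(\<integral>\<^sup>+x. ennreal (K * ph x (av y) powr (1 + e)) * indicator B0 (x - y) \<partial>lebesgue) 
      \<le> ennreal (K * (avg_powr_const * ?D)) * (\<integral>\<^sup>+x. ennreal (ph x (f x)) * indicator C0 (x - y) \<partial>lebesgue)" .
  qed
  also have "\<dots> = ennreal (K * (avg_powr_const * ?D)) * (\<integral>\<^sup>+y. \<integral>\<^sup>+x. ennreal (ph x (f x)) * indicator C0 (x - y) \<partial>lebesgue \<partial>lebesgue)"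
  proof (rule nn_integral_cmult)
    have "(\<lambda>p. ennreal (ph (snd p) (f (snd p))) * indicator C0 (snd p - fst p)) \<in> borel_measurable (lebesgue \<Otimes>\<^sub>M lebesgue)"
      using measurable_compose[OF measurable_pair_swap', of "\<lambda>p. ennreal (ph (fst p) (f (fst p))) * indicator C0 (fst p - snd p)"] by (simp add: case_prod_beta')
    then show "(\<lambda>y. \<integral>\<^sup>+x. ennreal (ph x (f x)) * indicator C0 (x - y) \<partial>lebesgue) \<in> borel_measurable lebesgue"
      by (intro lebesgue.borel_measurable_nn_integral) (simp add: case_prod_beta')
  qed
  also have "(\<integral>\<^sup>+y. \<integral>\<^sup>+x. ennreal (ph x (f x)) * indicator C0 (x - y) \<partial>lebesgue \<partial>lebesgue)
     = (\<integral>\<^sup>+x. \<integral>\<^sup>+y. ennreal (ph x (f x)) * indicator C0 (x - y) \<partial>lebesgue \<partial>lebesgue)"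
    by (rule lebesgue_pair.Fubini') (simp add: case_prod_beta')
  also have "\<dots> = (\<integral>\<^sup>+x. ennreal ((4 * l) ^ ?n) * ennreal (ph x (f x)) \<partial>lebesgue)"
  proof (intro nn_integral_cong)
    fix x
    have "Q x \<in> sets lebesgue" by (simp add: Q_def)
    moreover have "(\<integral>\<^sup>+y. ennreal (ph x (f x)) * indicator C0 (x - y) \<partial>lebesgue) = (\<integral>\<^sup>+y. ennreal (ph x (f x)) * indicator (Q x) y \<partial>lebesgue)"
      by (intro nn_integral_cong) (simp add: indicator_def QC(1)[symmetric] QC(2)[of _ x])
    ultimately have "(\<integral>\<^sup>+y. ennreal (ph x (f x)) * indicator C0 (x - y) \<partial>lebesgue) = ennreal (ph x (f x)) * emeasure lebesgue (Q x)"
      by (simp only: nn_integral_cmult_indicator)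
    then show "(\<integral>\<^sup>+y. ennreal (ph x (f x)) * indicator C0 (x - y) \<partial>lebesgue) = ennreal ((4 * l) ^ ?n) * ennreal (ph x (f x))"
      by (simp only: mQ mult.commute)
  qed
  also have "\<dots> = ennreal ((4 * l) ^ ?n) * (\<integral>\<^sup>+x. ennreal (ph x (f x)) \<partial>lebesgue)"
    by (intro nn_integral_cmult) measurable
  also have "ennreal (K * (avg_powr_const * ?D)) * \<dots> \<le> ennreal (K * (avg_powr_const * ?D)) * (ennreal ((4 * l) ^ ?n) * ennreal d)"
    by (intro mult_left_mono le) auto
  also have "\<dots> = ennreal (K * (avg_powr_const * ?D) * ((4 * l) ^ ?n * d))"
    using K avg_powr_const_pos l d by (simp add: ennreal_mult'[symmetric] ennreal_mult''[symmetric])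
  also have "\<dots> \<le> ennreal (V * l ^ ?n * (CB * d * (d / l ^ ?n) powr e))"
  proof (rule ennreal_leI)
    have "?D \<le> (d / l ^ ?n) powr e"
      using e d l by (intro powr_mono2 divide_left_mono power_mono) auto
    then have "K * (avg_powr_const * ?D) * ((4 * l) ^ ?n * d) \<le> K * (avg_powr_const * (d / l ^ ?n) powr e) * ((4 * l) ^ ?n * d)"
      using K avg_powr_const_pos l d by (intro mult_right_mono mult_left_mono) auto
    also have "\<dots> = V * l ^ ?n * (CB * d * (d / l ^ ?n) powr e)"
      unfolding CB_def K_def V_def[symmetric] using V l by (simp add: power_mult_distrib)
    finally show "K * (avg_powr_const * ?D) * ((4 * l) ^ ?n * d) \<le> V * l ^ ?n * (CB * d * (d / l ^ ?n) powr e)" .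
  qed
  finally have fin: "ennreal (V * l ^ ?n) * (\<integral>\<^sup>+x. ennreal (ph x (ball_avg f l x) powr (1 + e)) \<partial>lebesgue) \<le> ennreal (V * l ^ ?n * (CB * d * (d / l ^ ?n) powr e))" .
  have Vl: "0 < V * l ^ ?n" using V l by simp
  have CB0: "0 \<le> CB" using avg_powr_const_pos by (simp add: CB_def)
  then have "ennreal (V * l ^ ?n) * (\<integral>\<^sup>+x. ennreal (ph x (ball_avg f l x) powr (1 + e)) \<partial>lebesgue) \<le> ennreal (V * l ^ ?n) * ennreal (CB * d * (d / l ^ ?n) powr e)"
    using fin Vl d by (simp add: ennreal_mult')
  then show "(\<integral>\<^sup>+x. ennreal (ph x (ball_avg f l x) powr (1 + e)) \<partial>lebesgue) \<le> ennreal (CB * d * (d / l ^ ?n) powr e)"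
    using Vl l V by (subst (asm) ennreal_mult_le_mult_iff) auto
qed

text \<open>At each point one scale j dominates with weight (3/4)^j, so the modular of the sum is
  bounded by the weighted sum of the modulars of the ball averages. Their bounds grow like 2^(j n
  e), and \<open>e2\<close> keeps the products below a multiple of (7/8)^j.\<close>

lemma potential_powr:
  fixes f g :: "'a \<Rightarrow> real"
  assumes r: "0 < r" and C: "1 \<le> C"
    and f: "f \<in> borel_measurable lebesgue" "\<And>x. 0 \<le> f x"
    and d: "0 < d" "d \<le> 1"
    and le: "(\<integral>\<^sup>+x. ennreal (ph x (f x)) \<partial>lebesgue) \<le> ennreal d"
    and e: "0 \<le> e" "e \<le> 1" and be: "(4 / ainf_const) * (2 * 2 ^ DIM('a)) powr e * (1 - ainf_const) + 2 powr e \<le> 4 / ainf_const"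
    and e2: "2 powr (real DIM('a) * e) \<le> 7 / 6"
    and B: "B \<in> sets lebesgue" and g0: "\<And>x. 0 \<le> g x"
    and g: "AE x in lebesgue. x \<in> B \<longrightarrow> g x \<noteq> 0 \<longrightarrow> (\<exists>k. g x \<le> C * (\<Sum>j<k. ball_avg f (2 * r / 2 ^ j) x / 2 ^ j))"
  defines "CB \<equiv> (4 ^ DIM('a)) powr (2 * q) * avg_powr_const * 4 ^ DIM('a) / unit_ball_vol (real DIM('a))"
  shows "(\<integral>\<^sup>+x\<in>B. ennreal (ph x (g x) powr (1 + e)) \<partial>lebesgue) \<le> ennreal (8 * (3 * C) powr (2 * q) * CB * d * (d / r ^ DIM('a)) powr e)"
proof -
  let ?n = "DIM('a)"
  define A where "A j = ball_avg f (2 * r / 2 ^ j)" for j :: nat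
  have rj: "0 < 2 * r / 2 ^ j" for j :: nat using r by simp
  have A0: "0 \<le> A j x" for j x using r by (simp add: A_def ball_avg_def)
  have Am[measurable]: "A j \<in> borel_measurable lebesgue" for j
    unfolding A_def by (rule ball_avg_powr(2)[OF rj f d le e be])
  have CB0: "0 \<le> CB" using avg_powr_const_pos by (simp add: CB_def)
  define K where "K = (3 * C) powr (2 * q)"
  have K: "0 \<le> K" by (simp add: K_def)
  have pt: "ennreal (ph x (g x) powr (1 + e)) \<le> (\<Sum>j. ennreal (K * (3/4) ^ j * ph x (A j x) powr (1 + e)))"
    if ex: "g x \<noteq> 0 \<longrightarrow> (\<exists>k. g x \<le> C * (\<Sum>j<k. A j x / 2 ^ j))" for x
  proof (cases "g x = 0")
    case False
    then obtain k where k: "g x \<le> C * (\<Sum>j<k. A j x / 2 ^ j)" using ex by blast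
    have gp: "g x > 0" using False g0[of x] by simp
    \<comment> \<open>Some term must be large, since \<open>2\<^sup>-\<^sup>j = (3/4)\<^sup>j (2/3)\<^sup>j\<close> and \<open>\<Sum>\<^sub>j (2/3)\<^sup>j = 3\<close>.\<close>
    have "\<exists>j. g x \<le> 3 * C * ((3/4) ^ j * A j x)"
    proof (rule ccontr)
      assume "\<not> ?thesis"
      then have small: "3 * C * ((3/4) ^ j * A j x) < g x" for j by (simp add: not_le)
      have "C * (\<Sum>j<k. A j x / 2 ^ j) = (\<Sum>j<k. C * ((3/4) ^ j * A j x) * (2/3) ^ j)"
      proof -
        have h: "(3/4::real) ^ j * (2/3) ^ j = 1 / 2 ^ j" for j
        proof -
          have "(3/4::real) ^ j * (2/3) ^ j = (3/4 * (2/3)) ^ j" by (rule power_mult_distrib[symmetric])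
          also have "3/4 * (2/3) = (1/2::real)" by simp
          finally show ?thesis by (simp add: power_divide)
        qed
        have "C * (A j x / 2 ^ j) = C * ((3/4) ^ j * A j x) * (2/3) ^ j" for j
        proof -
          have "C * ((3/4) ^ j * A j x) * (2/3) ^ j = C * (A j x * ((3/4) ^ j * (2/3) ^ j))" by (simp only: mult_ac)
          then show ?thesis unfolding h by simp
        qed
        then show ?thesis by (simp add: sum_distrib_left)
      qed
      also have "\<dots> \<le> (\<Sum>j<k. (g x / 3) * (2/3) ^ j)"
      proof (intro sum_mono mult_right_mono)
        fix j
        have "3 * (C * ((3/4) ^ j * A j x)) < g x" using small[of j] by (simp only: mult.assoc)
        then show "C * ((3/4) ^ j * A j x) \<le> g x / 3" by linarith
      qed simp
      also have "\<dots> = (g x / 3) * (\<Sum>j<k. (2/3) ^ j)" by (simp add: sum_distrib_left)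
      also have "(\<Sum>j<k. (2/3) ^ j) = 3 * (1 - (2/3::real) ^ k)" by (subst sum_gp_strict) (simp add: field_simps)
      also have "(g x / 3) * (3 * (1 - (2/3::real) ^ k)) = g x * (1 - (2/3) ^ k)" by simp
      also have "\<dots> < g x" using gp by (simp add: mult_less_cancel_left2)
      finally show False using k by simp
    qed
    then obtain j where j: "g x \<le> 3 * C * ((3/4) ^ j * A j x)" by blast
    have "ph x (g x) \<le> ph x (3 * C * ((3/4) ^ j * A j x))" by (intro ph_mono g0 j)
    also have "\<dots> \<le> (3 * C) powr q * ph x ((3/4) ^ j * A j x)" using C A0 by (intro ph_scale_le) auto
    also have "\<dots> \<le> (3 * C) powr q * ((3/4) ^ j * ph x (A j x))" using A0 by (intro mult_left_mono ph_scale_down) (auto simp: power_le_one)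
    finally have "ph x (g x) powr (1 + e) \<le> ((3 * C) powr q * ((3/4) ^ j * ph x (A j x))) powr (1 + e)"
      using e by (intro powr_mono2) auto
    also have "\<dots> = (3 * C) powr (q * (1 + e)) * (((3/4) ^ j) powr (1 + e) * ph x (A j x) powr (1 + e))"
      using C by (simp add: powr_mult powr_powr)
    also have "\<dots> \<le> K * ((3/4) ^ j * ph x (A j x) powr (1 + e))"
    proof (intro mult_mono order_refl)
      show "(3 * C) powr (q * (1 + e)) \<le> K" unfolding K_def using C e p1 pq by (intro powr_mono) auto
      have "((3/4::real) ^ j) powr (1 + e) \<le> ((3/4) ^ j) powr 1" using e by (intro powr_mono') (auto simp: power_le_one)
      then show "((3/4::real) ^ j) powr (1 + e) \<le> (3/4) ^ j" by simp
    qed (use K in auto)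
    finally have "ennreal (ph x (g x) powr (1 + e)) \<le> ennreal (K * (3/4) ^ j * ph x (A j x) powr (1 + e))" by (intro ennreal_leI) (simp add: mult.assoc)
    also have "\<dots> = (\<Sum>i\<in>{j}. ennreal (K * (3/4) ^ i * ph x (A i x) powr (1 + e)))" by simp
    also have "\<dots> \<le> (\<Sum>i. ennreal (K * (3/4) ^ i * ph x (A i x) powr (1 + e)))"
      by (intro sum_le_suminf) auto
    finally show ?thesis .
  qed (use e in simp)
  \<comment> \<open>The ratio of the geometric series; 3/4 * 7/6 = 7/8 produces the factor
    8.\<close>
  define x0 where "x0 = 3/4 * 2 powr (real ?n * e)"
  have x0: "0 \<le> x0" "x0 \<le> 7 / 8" using e2 by (auto simp: x0_def)
  define D where "D = (d / r ^ ?n) powr e"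
  have "(\<integral>\<^sup>+x\<in>B. ennreal (ph x (g x) powr (1 + e)) \<partial>lebesgue) \<le> (\<integral>\<^sup>+x. (\<Sum>j. ennreal (K * (3/4) ^ j * ph x (A j x) powr (1 + e))) \<partial>lebesgue)"
  proof (rule nn_integral_mono_AE)
    show "AE x in lebesgue. ennreal (ph x (g x) powr (1 + e)) * indicator B x \<le> (\<Sum>j. ennreal (K * (3/4) ^ j * ph x (A j x) powr (1 + e)))"
      using g
    proof eventually_elim
      case (elim x)
      then show ?case using pt[of x] by (cases "x \<in> B") (auto simp: A_def)
    qed
  qed
  also have "\<dots> = (\<Sum>j. \<integral>\<^sup>+x. ennreal (K * (3/4) ^ j * ph x (A j x) powr (1 + e)) \<partial>lebesgue)"
    by (intro nn_integral_suminf) measurable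
  also have "\<dots> \<le> (\<Sum>j. ennreal (K * CB * d * D * x0 ^ j))"
  proof (intro suminf_le summableI)
    fix j
    have "(\<integral>\<^sup>+x. ennreal (K * (3/4) ^ j * ph x (A j x) powr (1 + e)) \<partial>lebesgue) 
       = ennreal (K * (3/4) ^ j) * (\<integral>\<^sup>+x. ennreal (ph x (A j x) powr (1 + e)) \<partial>lebesgue)"
      using K by (subst nn_integral_cmult[symmetric]) (auto simp: ennreal_mult')
    also have "\<dots> \<le> ennreal (K * (3/4) ^ j) * ennreal (CB * d * (d / (2 * r / 2 ^ j) ^ ?n) powr e)"
      unfolding A_def CB_def by (intro mult_left_mono ball_avg_powr(1)[OF rj f d le e be]) auto
    also have "\<dots> = ennreal (K * (3/4) ^ j * (CB * d * (d / (2 * r / 2 ^ j) ^ ?n) powr e))"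
      using K by (simp add: ennreal_mult')
    also have "\<dots> \<le> ennreal (K * CB * d * D * x0 ^ j)"
    proof (rule ennreal_leI)
      have "d / (2 * r / 2 ^ j) ^ ?n = (d / (2 * r) ^ ?n) * (2 ^ j) ^ ?n" by (simp add: power_divide)
      also have "\<dots> \<le> (d / r ^ ?n) * (2 ^ j) ^ ?n" using d r by (intro mult_right_mono divide_left_mono power_mono) auto
      finally have "(d / (2 * r / 2 ^ j) ^ ?n) powr e \<le> ((d / r ^ ?n) * (2 ^ j) ^ ?n) powr e"
        using e d r by (intro powr_mono2) auto
      also have "\<dots> = D * ((2 ^ j) ^ ?n) powr e" unfolding D_def by (rule powr_mult)
      also have "((2 ^ j) ^ ?n) powr e = (2 powr (real ?n * e)) ^ j"
        by (simp add: powr_realpow[symmetric] powr_powr powr_power mult_ac)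
      finally have "K * (3/4) ^ j * (CB * d * (d / (2 * r / 2 ^ j) ^ ?n) powr e) \<le> K * (3/4) ^ j * (CB * d * (D * (2 powr (real ?n * e)) ^ j))"
        using K CB0 d by (intro mult_left_mono) auto
      then show "K * (3/4) ^ j * (CB * d * (d / (2 * r / 2 ^ j) ^ ?n) powr e) \<le> K * CB * d * D * x0 ^ j"
        by (simp only: x0_def power_mult_distrib mult_ac)
    qed
    finally show "(\<integral>\<^sup>+x. ennreal (K * (3/4) ^ j * ph x (A j x) powr (1 + e)) \<partial>lebesgue) \<le> ennreal (K * CB * d * D * x0 ^ j)" .
  qed
  also have "\<dots> = ennreal (K * CB * d * D * (1 / (1 - x0)))"
    using K CB0 d x0 by (intro suminf_ennreal_eq sums_mult geometric_sums) (auto simp: D_def)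
  also have "\<dots> \<le> ennreal (K * CB * d * D * 8)"
    using K CB0 d x0 by (intro ennreal_leI mult_left_mono) (auto simp: D_def divide_le_eq)
  finally show ?thesis by (simp add: K_def D_def mult_ac)
qed

end

section \<open>The Sobolev--Poincare inequality\<close>

text \<open>The i-th derivative of (x - z)_i \<eta>(x) integrates to 0, so the integral of \<eta> is
  minus that of (x - z)_i times the i-th derivative of \<eta>, and |(x - z)_i| <= r on the ball. One
  coordinate direction i is enough.\<close>

lemma test_fun_integral_bound:
  fixes z :: "'a::euclidean_space"
  assumes r: "0 < r" and \<eta>: "\<eta> \<in> test_funs (ball z r)"
  shows "\<bar>LINT x|lebesgue_on (ball z r). \<eta> x\<bar> \<le> r * (LINT x|lebesgue_on (ball z r). norm (grad \<eta> x))"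
    "integrable (lebesgue_on (ball z r)) \<eta>" "integrable (lebesgue_on (ball z r)) (grad \<eta>)"
proof -
  let ?L = "lebesgue_on (ball z r)"
  interpret L: finite_measure ?L by (rule finite_measure_lebesgue_on) simp
  obtain i :: 'a where i: "i \<in> Basis" using nonempty_Basis by blast
  let ?C = "closure {x. \<eta> x \<noteq> 0}"
  have C: "compact ?C" "?C \<subseteq> ball z r" using \<eta> by (auto simp: test_funs_def)
  define D where "D x h = ((x - z) \<bullet> i) * frechet_derivative \<eta> (at x) h + (h \<bullet> i) * \<eta> x" for x h
  note d = test_fun_deriv[OF \<eta>]
  have \<eta>c: "continuous_on UNIV \<eta>" using d(1) by (intro has_derivative_continuous_on[of UNIV \<eta>]) (auto intro: has_derivative_at_withinI)
  have Dd: "((\<lambda>x. ((x - z) \<bullet> i) * \<eta> x) has_derivative D x) (at x)" for x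
  proof -
    have "((\<lambda>x. (x - z) \<bullet> i) has_derivative (\<lambda>h. h \<bullet> i)) (at x)" by (auto intro!: derivative_eq_intros)
    from has_derivative_mult[OF this d(1)] show ?thesis by (simp add: D_def[abs_def])
  qed
  have Dc: "continuous_on UNIV (\<lambda>x. D x i)"
    unfolding D_def using d(2) \<eta>c by (intro continuous_intros)
  have Ds: "((x - z) \<bullet> i) * \<eta> x = 0" if "x \<notin> ?C" for x using that closure_subset[of "{x. \<eta> x \<noteq> 0}"] by auto
  note D = integral_derivative_zero[OF Dd Dc Ds C(1)]
  have D0: "D x i = 0" if "x \<notin> ball z r" for x
  proof -
    have "x \<notin> ?C" using that C(2) by blast
    then show ?thesis using d(3)[of x] closure_subset[of "{x. \<eta> x \<noteq> 0}"] by (auto simp: D_def)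
  qed
  have "(LINT x|?L. D x i) = (LINT x|lebesgue. indicator (ball z r) x *\<^sub>R D x i)" by (rule integral_restrict_space) simp
  also have "\<dots> = (LINT x|lebesgue. D x i)" using D0 by (intro Bochner_Integration.integral_cong) (auto simp: indicator_def)
  finally have DL: "(LINT x|?L. D x i) = 0" using D by simp
  have gc: "continuous_on UNIV (grad \<eta>)" unfolding grad_def[abs_def] using d(2) by (intro continuous_intros)
  have bint: "integrable ?L h" if h: "continuous_on UNIV h" for h :: "'a \<Rightarrow> 'b::euclidean_space"
  proof -
    have "bounded (h ` cball z r)" by (intro compact_imp_bounded compact_continuous_image continuous_on_subset[OF h]) auto
    then obtain K where K: "\<forall>x\<in>cball z r. norm (h x) \<le> K" by (auto simp: bounded_iff)
    show ?thesis by (intro L.integrable_const_bound[of _ K] borel_measurable_lebesgue_on borel_measurable_continuous_onI h AE_I2) (use K in auto)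
  qed
  show \<eta>i: "integrable ?L \<eta>" by (rule bint[OF \<eta>c])
  show gi: "integrable ?L (grad \<eta>)" by (rule bint[OF gc])
  have pi: "integrable ?L (\<lambda>x. ((x - z) \<bullet> i) * frechet_derivative \<eta> (at x) i)"
    using d(2) by (intro bint continuous_intros)
  have "(LINT x|?L. D x i) = (LINT x|?L. ((x - z) \<bullet> i) * frechet_derivative \<eta> (at x) i) + (LINT x|?L. \<eta> x)"
    unfolding D_def using i pi \<eta>i by simp
  then have "\<bar>LINT x|?L. \<eta> x\<bar> = \<bar>LINT x|?L. ((x - z) \<bullet> i) * frechet_derivative \<eta> (at x) i\<bar>" using DL by simp
  also have "\<dots> \<le> (LINT x|?L. \<bar>((x - z) \<bullet> i) * frechet_derivative \<eta> (at x) i\<bar>)" by (rule integral_abs_bound)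
  also have "\<dots> \<le> (LINT x|?L. r * norm (grad \<eta> x))"
  proof (rule integral_mono')
    fix x assume "x \<in> space ?L"
    then have x: "norm (x - z) \<le> r" by (simp add: dist_norm norm_minus_commute)
    have "\<bar>(x - z) \<bullet> i\<bar> \<le> r" using Basis_le_norm[OF i, of "x - z"] x by simp
    moreover have "\<bar>frechet_derivative \<eta> (at x) i\<bar> \<le> norm (grad \<eta> x)"
      using Basis_le_norm[OF i, of "grad \<eta> x"] by (simp add: grad_inner[OF i])
    ultimately show "\<bar>((x - z) \<bullet> i) * frechet_derivative \<eta> (at x) i\<bar> \<le> r * norm (grad \<eta> x)"
      unfolding abs_mult using r by (intro mult_mono) auto
  qed (use gi r in auto)
  finally show "\<bar>LINT x|?L. \<eta> x\<bar> \<le> r * (LINT x|?L. norm (grad \<eta> x))" by simp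
qed

lemma W11_facts:
  assumes "u \<in> W11 U"
  shows "integrable (lebesgue_on U) u" "has_weak_grad U u (weak_grad U u)" "integrable (lebesgue_on U) (weak_grad U u)"
  using assms someI_ex[of "has_weak_grad U u"] unfolding W11_def weak_grad_def by auto

text \<open>Both sides are continuous in the W11 distance, so the bound passes from test functions
  to their limits.\<close>

lemma W11_0_integral_bound:
  fixes z :: "'a::euclidean_space"
  assumes r: "0 < r" and u: "u \<in> W11_0 (ball z r)"
  shows "\<bar>LINT x|lebesgue_on (ball z r). u x\<bar> \<le> r * (LINT x|lebesgue_on (ball z r). norm (weak_grad (ball z r) u x))"
proof -
  let ?L = "lebesgue_on (ball z r)" and ?G = "weak_grad (ball z r) u"
  have "u \<in> W11 (ball z r)" using u by (simp add: W11_0_def)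
  note f = W11_facts[OF this]
  obtain \<eta> where \<eta>: "\<And>k::nat. \<eta> k \<in> test_funs (ball z r)" 
    "(\<lambda>k. (LINT x|?L. \<bar>\<eta> k x - u x\<bar>) + (LINT x|?L. norm (grad (\<eta> k) x - ?G x))) \<longlonglongrightarrow> 0" (is "?e \<longlonglongrightarrow> 0")
    using u unfolding W11_0_def by blast
  have "\<bar>LINT x|?L. u x\<bar> \<le> r * (LINT x|?L. norm (?G x)) + (1 + r) * ?e k" for k
  proof -
    note t = test_fun_integral_bound[OF r \<eta>(1)[of k]]
    have "(LINT x|?L. u x) = (LINT x|?L. \<eta> k x) - (LINT x|?L. \<eta> k x - u x)" using t f by simp
    then have "\<bar>LINT x|?L. u x\<bar> \<le> \<bar>LINT x|?L. \<eta> k x\<bar> + \<bar>LINT x|?L. \<eta> k x - u x\<bar>" by simp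
    also have "\<dots> \<le> r * (LINT x|?L. norm (grad (\<eta> k) x)) + (LINT x|?L. \<bar>\<eta> k x - u x\<bar>)"
      by (intro add_mono t integral_abs_bound)
    also have "(LINT x|?L. norm (grad (\<eta> k) x)) \<le> (LINT x|?L. norm (?G x) + norm (grad (\<eta> k) x - ?G x))"
    proof (rule integral_mono)
      show "norm (grad (\<eta> k) x) \<le> norm (?G x) + norm (grad (\<eta> k) x - ?G x)" for x
        using norm_triangle_ineq[of "?G x" "grad (\<eta> k) x - ?G x"] by simp
    qed (use t f in auto)
    also have "\<dots> = (LINT x|?L. norm (?G x)) + (LINT x|?L. norm (grad (\<eta> k) x - ?G x))"
      using t f by (intro Bochner_Integration.integral_add) auto
    finally have "\<bar>LINT x|?L. u x\<bar> \<le> r * ((LINT x|?L. norm (?G x)) + (LINT x|?L. norm (grad (\<eta> k) x - ?G x))) + (LINT x|?L. \<bar>\<eta> k x - u x\<bar>)"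
      using r by simp
    also have "\<dots> \<le> r * (LINT x|?L. norm (?G x)) + (1 + r) * ?e k"
    proof -
      have "0 \<le> (LINT x|?L. norm (grad (\<eta> k) x - ?G x))" "0 \<le> r * (LINT x|?L. \<bar>\<eta> k x - u x\<bar>)"
        using r by (auto intro!: integral_nonneg_AE mult_nonneg_nonneg)
      then show ?thesis by (simp add: algebra_simps)
    qed
    finally show ?thesis .
  qed
  moreover have "(\<lambda>k. r * (LINT x|?L. norm (?G x)) + (1 + r) * ?e k) \<longlonglongrightarrow> r * (LINT x|?L. norm (?G x)) + (1 + r) * 0"
    by (intro tendsto_intros \<eta>)
  ultimately show ?thesis by (intro LIMSEQ_le_const[where X = "\<lambda>k. r * (LINT x|?L. norm (?G x)) + (1 + r) * ?e k"]) auto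
qed

lemma W11_diff_measurable:
  assumes "u \<in> W11 (ball z r)"
  shows "(\<lambda>x. indicator (ball z r) x * (\<bar>u x - c\<bar> / k)) \<in> borel_measurable lebesgue"
proof -
  have "(\<lambda>x. \<bar>u x - c\<bar> / k) \<in> borel_measurable (lebesgue_on (ball z r))" using W11_facts(1)[OF assms] by auto
  then show ?thesis by (subst (asm) borel_measurable_restrict_space_iff) auto
qed

lemma ennpowr_ennreal: "0 \<le> y \<Longrightarrow> ennpowr (ennreal y) s = ennreal (y powr s)"
  by (simp add: ennpowr_def)

lemma ennpowr_mono: 
  assumes "x \<le> y" "0 \<le> s" shows "ennpowr x s \<le> ennpowr y s"
proof (cases "y = \<infinity>")
  case False
  then obtain b where b: "y = ennreal b" "0 \<le> b" by (cases y) auto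
  then obtain c where c: "x = ennreal c" "0 \<le> c" "c \<le> b" using assms by (cases x) (auto simp: top_unique)
  then show ?thesis using b assms by (simp add: ennpowr_ennreal ennreal_leI powr_mono2)
qed (simp add: ennpowr_def)

lemma le_one_plus_powr: "0 \<le> y \<Longrightarrow> 1 \<le> s \<Longrightarrow> y \<le> 1 + y powr s" for y s :: real
proof (cases "y \<le> 1")
  case False
  assume "1 \<le> s"
  then have "y powr 1 \<le> y powr s" using False by (intro powr_mono) auto
  then show ?thesis using False by simp
qed (simp add: add_increasing2)

lemma nn_integral_finite_of_powr:
  fixes h :: "'a \<Rightarrow> real"
  assumes [measurable]: "h \<in> borel_measurable M" and h: "\<And>x. 0 \<le> h x" and s: "1 \<le> s" and V: "emeasure M (space M) = ennreal V"
    and fin: "(\<integral>\<^sup>+x. ennreal (h x powr s) \<partial>M) < \<infinity>"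
  shows "(\<integral>\<^sup>+x. ennreal (h x) \<partial>M) < \<infinity>"
proof -
  have "(\<integral>\<^sup>+x. ennreal (h x) \<partial>M) \<le> (\<integral>\<^sup>+x. 1 + ennreal (h x powr s) \<partial>M)"
  proof (rule nn_integral_mono)
    fix x
    have "ennreal (h x) \<le> ennreal (1 + h x powr s)" using le_one_plus_powr[OF h s] by (rule ennreal_leI)
    then show "ennreal (h x) \<le> 1 + ennreal (h x powr s)" by simp
  qed
  also have "\<dots> = ennreal V + (\<integral>\<^sup>+x. ennreal (h x powr s) \<partial>M)" using V by (subst nn_integral_add) auto
  finally show ?thesis using fin by (auto simp: le_less_trans)
qed

lemma nn_avg_power_mean:
  fixes h :: "'a::euclidean_space \<Rightarrow> real"
  assumes h[measurable]: "h \<in> borel_measurable (lebesgue_on B)" "\<And>x. 0 \<le> h x" and s: "1 \<le> s"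
    and B: "B \<in> sets lebesgue" and V: "emeasure lebesgue B = ennreal V" "0 < V"
  shows "nn_avg B (\<lambda>x. ennreal (h x)) \<le> ennpowr (nn_avg B (\<lambda>x. ennpowr (ennreal (h x)) s)) (1 / s)"
proof -
  have VL: "emeasure (lebesgue_on B) (space (lebesgue_on B)) = ennreal V"
    using B V by (simp add: emeasure_restrict_space)
  let ?I = "\<integral>\<^sup>+x. ennreal (h x powr s) \<partial>lebesgue_on B"
  have eq: "ennpowr (ennreal (h x)) s = ennreal (h x powr s)" for x using h(2) by (rule ennpowr_ennreal)
  show ?thesis
  proof (cases "?I = \<infinity>")
    case True
    then have "nn_avg B (\<lambda>x. ennpowr (ennreal (h x)) s) = \<infinity>"
      unfolding nn_avg_def eq V(1) by (simp add: ennreal_top_divide)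
    then show ?thesis by (simp add: ennpowr_def)
  next
    case False
    then obtain j where j: "?I = ennreal j" "0 \<le> j" by (cases ?I) auto
    have "(\<integral>\<^sup>+x. ennreal (h x) \<partial>lebesgue_on B) < \<infinity>"
      using False by (intro nn_integral_finite_of_powr[OF h s VL]) (auto simp: less_top)
    then obtain i where i: "(\<integral>\<^sup>+x. ennreal (h x) \<partial>lebesgue_on B) = ennreal i" "0 \<le> i"
      by (cases "\<integral>\<^sup>+x. ennreal (h x) \<partial>lebesgue_on B") auto
    have "ennreal ((i / V) powr s * V) \<le> ?I" by (rule nn_integral_powr_jensen[OF h s VL V(2) i])
    then have "(i / V) powr s * V \<le> j" using j by simp
    then have "(i / V) powr s \<le> j / V" using V by (simp add: pos_le_divide_eq)
    then have "((i / V) powr s) powr (1 / s) \<le> (j / V) powr (1 / s)" using s by (intro powr_mono2) auto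
    then have "i / V \<le> (j / V) powr (1 / s)" using s i V by (simp add: powr_powr)
    then show ?thesis using i j V by (simp add: nn_avg_def eq divide_ennreal ennpowr_ennreal ennreal_leI)
  qed
qed

lemma powr_add_le:
  fixes x y :: real
  assumes "0 \<le> x" "0 \<le> y" "0 \<le> e" "e \<le> 1"
  shows "(x + y) powr (1 + e) \<le> 4 * (x powr (1 + e) + y powr (1 + e))"
proof -
  have "(x + y) powr (1 + e) \<le> (2 * max x y) powr (1 + e)" using assms by (intro powr_mono2) auto
  also have "\<dots> = 2 powr (1 + e) * max x y powr (1 + e)" by (rule powr_mult)
  also have "\<dots> \<le> 2 powr 2 * (x powr (1 + e) + y powr (1 + e))"
    using assms by (intro mult_mono powr_mono) (auto simp: max_def)
  finally show ?thesis by simp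
qed

section \<open>Choice of the exponent and the constants, and the final estimates\<close>

context double_phase_A
begin

text \<open>Two smallness conditions on e meet here: the reverse Hoelder recursion must close, and
  the growth 2^(n e) per scale must leave the series with weights (3/4)^j convergent. The value 7/6
  is chosen with 3/4 * 7/6 < 1.\<close>

lemma exponent_exists:
  obtains e where "0 < e" "e \<le> 1" "(4 / ainf_const) * (2 * 2 ^ DIM('a)) powr e * (1 - ainf_const) + 2 powr e \<le> 4 / ainf_const"
    "2 powr (real DIM('a) * e) \<le> 7 / 6"
proof -
  obtain e0 where e0: "0 < e0" "e0 \<le> 1" 
   "\<And>e. 0 \<le> e \<Longrightarrow> e \<le> e0 \<Longrightarrow> (4 / ainf_const) * (2 * 2 ^ DIM('a)) powr e * (1 - ainf_const) + 2 powr e \<le> 4 / ainf_const"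
    using tree_exponent[OF ainf_const, of "DIM('a)"] by metis
  define e where "e = min e0 (log 2 (7/6) / real DIM('a))"
  have "0 < e" using e0 by (simp add: e_def)
  moreover have "real DIM('a) * e \<le> log 2 (7/6)"
  proof -
    have "real DIM('a) * e \<le> real DIM('a) * (log 2 (7/6) / real DIM('a))" by (intro mult_left_mono) (auto simp: e_def)
    then show ?thesis by simp
  qed
  then have "2 powr (real DIM('a) * e) \<le> 2 powr log 2 (7/6)" by (intro powr_mono) auto
  ultimately show thesis using e0 by (intro that[of e]) (auto simp: e_def)
qed

lemma ph_powr_add:
  assumes "0 \<le> s" "0 \<le> t" "0 \<le> e" "e \<le> 1"
  shows "ph x (s + t) powr (1 + e) \<le> 4 * 2 powr (2 * q) * (ph x s powr (1 + e) + ph x t powr (1 + e))"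
proof -
  have "ph x (s + t) powr (1 + e) \<le> (2 powr q * (ph x s + ph x t)) powr (1 + e)"
    using assms ph_quasi_add[OF assms(1,2)] by (intro powr_mono2) auto
  also have "\<dots> = 2 powr (q * (1 + e)) * (ph x s + ph x t) powr (1 + e)" by (simp add: powr_mult powr_powr)
  also have "\<dots> \<le> 2 powr (2 * q) * (4 * (ph x s powr (1 + e) + ph x t powr (1 + e)))"
  proof (rule mult_mono)
    have "q * (1 + e) \<le> 2 * q" using mult_left_mono[of "1 + e" 2 q] assms p1 pq by (simp add: mult.commute)
    then show "2 powr (q * (1 + e)) \<le> (2::real) powr (2 * q)" by (intro powr_mono) auto
    show "(ph x s + ph x t) powr (1 + e) \<le> 4 * (ph x s powr (1 + e) + ph x t powr (1 + e))"
      using assms by (intro powr_add_le) auto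
  qed auto
  finally show ?thesis by (simp only: mult_ac)
qed

lemma ph_powr_scale:
  assumes "0 \<le> t" "1 \<le> c" "0 \<le> e" "e \<le> 1"
  shows "ph x (c * t) powr (1 + e) \<le> c powr (2 * q) * ph x t powr (1 + e)"
proof -
  have "ph x (c * t) powr (1 + e) \<le> (c powr q * ph x t) powr (1 + e)"
    using assms ph_scale_le[OF assms(1,2)] by (intro powr_mono2) auto
  also have "\<dots> = c powr (q * (1 + e)) * ph x t powr (1 + e)" by (simp add: powr_mult powr_powr)
  also have "\<dots> \<le> c powr (2 * q) * ph x t powr (1 + e)"
    using assms p1 pq by (intro mult_right_mono powr_mono) auto
  finally show ?thesis .
qed

text \<open>The constant of \<open>potential_powr\<close>, with C taken from
  \<open>pointwise_potential\<close> and raised to at least 1, since the growth bound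
  \<open>ph_scale_le\<close> is for factors at least 1.\<close>

definition potential_const :: real where 
  "potential_const = 8 * (3 * max 1 (real DIM('a) * 4 * 4 ^ DIM('a) * 4 ^ DIM('a) / (exp (- 4 / 3) * unit_ball_vol (real DIM('a))))) powr (2 * q)
     * ((4 ^ DIM('a)) powr (2 * q) * avg_powr_const * 4 ^ DIM('a) / unit_ball_vol (real DIM('a)))"

text \<open>The volume of a cube of side 2r over that of a ball of radius r, raised to at least
  1.\<close>

definition volume_ratio :: real where "volume_ratio = max 1 (2 ^ DIM('a) / unit_ball_vol (real DIM('a)))"

text \<open>Jensen's inequality turns the (1+e)-power bound for |u - c|/r into a modular bound by at
  most this multiple of d.\<close>

definition mean_const :: real where "mean_const = unit_ball_vol (real DIM('a)) * max 1 (potential_const / unit_ball_vol (real DIM('a))) + 1"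

definition oscillation_const :: real where "oscillation_const = 4 * 2 powr (2 * q) * (potential_const + (mean_const * volume_ratio) powr (2 * q) * avg_powr_const)"

definition zero_trace_const :: real where "zero_trace_const = 4 * 2 powr (2 * q) * (oscillation_const + volume_ratio powr (2 * q) * avg_powr_const)"

lemma const_bounds: "0 \<le> potential_const" "1 \<le> volume_ratio" "1 \<le> mean_const" "0 < oscillation_const" "0 < zero_trace_const"
proof -
  show k0: "0 \<le> potential_const" using avg_powr_const_pos by (simp add: potential_const_def)
  show k1: "1 \<le> volume_ratio" by (simp add: volume_ratio_def)
  show k2: "1 \<le> mean_const" by (simp add: mean_const_def)
  have "mean_const * volume_ratio > 0" using k1 k2 by simp
  then show k3: "0 < oscillation_const" unfolding oscillation_const_def using k0 avg_powr_const_pos by (intro mult_pos_pos add_nonneg_pos) auto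
  show "0 < zero_trace_const" unfolding zero_trace_const_def using k3 k1 avg_powr_const_pos by (intro mult_pos_pos add_pos_pos) auto
qed

context
  fixes e :: real
  assumes e: "0 < e" "e \<le> 1" and be: "(4 / ainf_const) * (2 * 2 ^ DIM('a)) powr e * (1 - ainf_const) + 2 powr e \<le> 4 / ainf_const"
    and e2: "2 powr (real DIM('a) * e) \<le> 7 / 6"
begin

text \<open>The ball sits in a cube of side 2r. Extending f by 0 turns its integral over the ball
  into one over that cube, where \<open>average_powr\<close> applies.\<close>

lemma constant_powr:
  assumes r: "0 < r" and f[measurable]: "f \<in> borel_measurable lebesgue" "\<And>x. 0 \<le> f x"
    and d: "0 < d" "d \<le> 1" and le: "(\<integral>\<^sup>+x\<in>ball z r. ennreal (ph x (f x)) \<partial>lebesgue) \<le> ennreal d"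
    and K: "1 \<le> K" and t: "0 \<le> t" "t \<le> K * (enn2real (\<integral>\<^sup>+x\<in>ball z r. ennreal (f x) \<partial>lebesgue) / (2 * r) ^ DIM('a))"
  shows "(\<integral>\<^sup>+x\<in>ball z r. ennreal (ph x t powr (1 + e)) \<partial>lebesgue) \<le> ennreal (K powr (2 * q) * avg_powr_const * d * (d / r ^ DIM('a)) powr e)"
proof -
  define Q where "Q = cbox (z - r *\<^sub>R One) (z - r *\<^sub>R One + (2 * r) *\<^sub>R One)"
  have r2: "0 < 2 * r" using r by simp
  have [measurable]: "Q \<in> sets lebesgue" "ball z r \<in> sets lebesgue" by (auto simp: Q_def)
  have BQ: "ball z r \<subseteq> Q"
  proof
    fix x assume "x \<in> ball z r"
    then have "\<bar>(x - z) \<bullet> i\<bar> \<le> r" if "i \<in> Basis" for i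
      using Basis_le_norm[OF that, of "x - z"] by (simp add: dist_norm norm_minus_commute)
    then have "- r \<le> x \<bullet> i - z \<bullet> i \<and> x \<bullet> i - z \<bullet> i \<le> r" if "i \<in> Basis" for i using that by (fastforce simp: inner_diff_left abs_le_iff)
    then show "x \<in> Q" by (force simp: Q_def mem_box inner_simps)
  qed
  define f' where "f' x = indicator (ball z r) x * f x" for x
  have f'm[measurable]: "f' \<in> borel_measurable lebesgue" unfolding f'_def by measurable
  have f'0: "0 \<le> f' x" for x using f by (simp add: f'_def)
  have "(\<integral>\<^sup>+x\<in>Q. ennreal (ph x (f' x)) \<partial>lebesgue) = (\<integral>\<^sup>+x\<in>ball z r. ennreal (ph x (f x)) \<partial>lebesgue)"
    using BQ by (intro nn_integral_cong) (auto simp: f'_def indicator_def)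
  then have le': "(\<integral>\<^sup>+x\<in>Q. ennreal (ph x (f' x)) \<partial>lebesgue) \<le> ennreal d" using le by simp
  define av where "av = enn2real (\<integral>\<^sup>+x\<in>Q. ennreal (f' x) \<partial>lebesgue) / (2 * r) ^ DIM('a)"
  have av0: "0 \<le> av" using r by (simp add: av_def)
  have "(\<integral>\<^sup>+x\<in>Q. ennreal (f' x) \<partial>lebesgue) = (\<integral>\<^sup>+x\<in>ball z r. ennreal (f x) \<partial>lebesgue)"
    using BQ by (intro nn_integral_cong) (auto simp: f'_def indicator_def)
  then have tav: "t \<le> K * av" using t by (simp add: av_def)
  have ap: "(\<integral>\<^sup>+x\<in>Q. ennreal (ph x av powr (1 + e)) \<partial>lebesgue) \<le> ennreal (avg_powr_const * d * (d / (2 * r) ^ DIM('a)) powr e)"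
    unfolding av_def using e be by (intro average_powr[OF r2 Q_def f'm f'0 d le']) auto
  have "ph x t powr (1 + e) \<le> K powr (2 * q) * ph x av powr (1 + e)" for x
  proof -
    have "ph x t powr (1 + e) \<le> ph x (K * av) powr (1 + e)" using e t tav by (intro powr_mono2 ph_mono) auto
    also have "\<dots> \<le> K powr (2 * q) * ph x av powr (1 + e)" using av0 K e by (intro ph_powr_scale) auto
    finally show ?thesis .
  qed
  then have "(\<integral>\<^sup>+x\<in>ball z r. ennreal (ph x t powr (1 + e)) \<partial>lebesgue) \<le> (\<integral>\<^sup>+x. ennreal (K powr (2 * q)) * (ennreal (ph x av powr (1 + e)) * indicator Q x) \<partial>lebesgue)"
    using BQ by (intro nn_integral_mono) (auto simp: indicator_def ennreal_mult'[symmetric] intro!: ennreal_leI)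
  also have "\<dots> = ennreal (K powr (2 * q)) * (\<integral>\<^sup>+x\<in>Q. ennreal (ph x av powr (1 + e)) \<partial>lebesgue)"
    by (intro nn_integral_cmult) measurable
  also have "\<dots> \<le> ennreal (K powr (2 * q)) * ennreal (avg_powr_const * d * (d / (2 * r) ^ DIM('a)) powr e)"
    by (intro mult_left_mono ap) auto
  also have "\<dots> = ennreal (K powr (2 * q) * (avg_powr_const * d * (d / (2 * r) ^ DIM('a)) powr e))"
    by (simp add: ennreal_mult')
  also have "\<dots> \<le> ennreal (K powr (2 * q) * (avg_powr_const * d * (d / r ^ DIM('a)) powr e))"
    using d r e avg_powr_const_pos by (intro ennreal_leI mult_left_mono powr_mono2 divide_left_mono power_mono) auto
  finally show ?thesis by (simp add: mult.assoc)
qed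

context
  fixes z :: 'a and r :: real and u :: "'a \<Rightarrow> real" and d :: real
  assumes r: "0 < r" and u: "u \<in> W11 (ball z r)" and d: "0 < d" "d \<le> 1"
    and le: "(\<integral>\<^sup>+x. ennreal (ph x (norm (weak_grad (ball z r) u x))) \<partial>lebesgue_on (ball z r)) \<le> ennreal d"
begin

interpretation L: finite_measure "lebesgue_on (ball z r)" by (rule finite_measure_lebesgue_on) simp

lemma V_pos: "0 < unit_ball_vol (real DIM('a))" by simp

lemma ball_measure: "measure lebesgue (ball z r) = unit_ball_vol (real DIM('a)) * r ^ DIM('a)" "emeasure lebesgue (ball z r) = ennreal (unit_ball_vol (real DIM('a)) * r ^ DIM('a))" "0 < unit_ball_vol (real DIM('a)) * r ^ DIM('a)"
  using r by (auto simp: content_ball emeasure_ball simp del: emeasure_completion) (auto simp: emeasure_ball)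

lemma integral_norm_grad:
  "(LINT x|lebesgue_on (ball z r). norm (weak_grad (ball z r) u x)) = enn2real (\<integral>\<^sup>+x\<in>ball z r. ennreal (indicator (ball z r) x * norm (weak_grad (ball z r) u x)) \<partial>lebesgue)"
proof -
  have [measurable]: "weak_grad (ball z r) u \<in> borel_measurable (lebesgue_on (ball z r))" using W11_facts(3)[OF u] by auto
  have "(LINT x|lebesgue_on (ball z r). norm (weak_grad (ball z r) u x)) = enn2real (\<integral>\<^sup>+x. ennreal (norm (weak_grad (ball z r) u x)) \<partial>lebesgue_on (ball z r))"
    by (intro integral_eq_nn_integral) auto
  also have "(\<integral>\<^sup>+x. ennreal (norm (weak_grad (ball z r) u x)) \<partial>lebesgue_on (ball z r)) = (\<integral>\<^sup>+x\<in>ball z r. ennreal (indicator (ball z r) x * norm (weak_grad (ball z r) u x)) \<partial>lebesgue)"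
    by (subst nn_integral_restrict_space) (auto intro!: nn_integral_cong simp: indicator_def)
  finally show ?thesis .
qed

lemma grad_modular:
  "(\<lambda>x. indicator (ball z r) x * norm (weak_grad (ball z r) u x)) \<in> borel_measurable lebesgue"
  "(\<integral>\<^sup>+x. ennreal (ph x (indicator (ball z r) x * norm (weak_grad (ball z r) u x))) \<partial>lebesgue) \<le> ennreal d"
  "(\<integral>\<^sup>+x\<in>ball z r. ennreal (ph x (indicator (ball z r) x * norm (weak_grad (ball z r) u x))) \<partial>lebesgue) \<le> ennreal d"
proof -
  have "(\<lambda>x. norm (weak_grad (ball z r) u x)) \<in> borel_measurable (lebesgue_on (ball z r))" using W11_facts(3)[OF u] by auto
  then show "(\<lambda>x. indicator (ball z r) x * norm (weak_grad (ball z r) u x)) \<in> borel_measurable lebesgue"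
    by (subst (asm) borel_measurable_restrict_space_iff) auto
  have "(\<integral>\<^sup>+x. ennreal (ph x (indicator (ball z r) x * norm (weak_grad (ball z r) u x))) \<partial>lebesgue) = (\<integral>\<^sup>+x. ennreal (ph x (norm (weak_grad (ball z r) u x))) \<partial>lebesgue_on (ball z r))"
    by (subst nn_integral_restrict_space) (auto intro!: nn_integral_cong simp: indicator_def)
  then show 1: "(\<integral>\<^sup>+x. ennreal (ph x (indicator (ball z r) x * norm (weak_grad (ball z r) u x))) \<partial>lebesgue) \<le> ennreal d" using le by simp
  show "(\<integral>\<^sup>+x\<in>ball z r. ennreal (ph x (indicator (ball z r) x * norm (weak_grad (ball z r) u x))) \<partial>lebesgue) \<le> ennreal d"
    by (rule order_trans[OF nn_integral_mono 1]) (auto simp: indicator_def)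
qed

lemmas diff_measurable = W11_diff_measurable[OF u]

lemma oscillation_powr:
  obtains c where "(\<integral>\<^sup>+x\<in>ball z r. ennreal (ph x (indicator (ball z r) x * (\<bar>u x - c\<bar> / r)) powr (1 + e)) \<partial>lebesgue) \<le> ennreal (potential_const * d * (d / r ^ DIM('a)) powr e)"
proof -
  define f where "f x = indicator (ball z r) x * norm (weak_grad (ball z r) u x)" for x
  note wf = W11_facts[OF u]
  have Gm[measurable]: "weak_grad (ball z r) u \<in> borel_measurable (lebesgue_on (ball z r))" using wf(3) by auto
  have ba: "ball_avg f (2 * r / 2 ^ j) x = (2 ^ j / (2 * r)) ^ DIM('a) * (LINT y|lebesgue_on (ball z r). indicator (ball x (2 * r / 2 ^ j)) y * norm (weak_grad (ball z r) u y))" for j x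
  proof -
    have [measurable]: "indicator (ball x (2 * r / 2 ^ j)) \<in> borel_measurable (lebesgue_on (ball z r))"
      by (intro borel_measurable_lebesgue_on borel_measurable_indicator) auto
    have "(LINT y|lebesgue_on (ball z r). indicator (ball x (2 * r / 2 ^ j)) y * norm (weak_grad (ball z r) u y)) = 
       enn2real (\<integral>\<^sup>+y. ennreal (indicator (ball x (2 * r / 2 ^ j)) y * norm (weak_grad (ball z r) u y)) \<partial>lebesgue_on (ball z r))"
      by (intro integral_eq_nn_integral) auto
    also have "(\<integral>\<^sup>+y. ennreal (indicator (ball x (2 * r / 2 ^ j)) y * norm (weak_grad (ball z r) u y)) \<partial>lebesgue_on (ball z r)) = (\<integral>\<^sup>+y\<in>ball x (2 * r / 2 ^ j). ennreal (f y) \<partial>lebesgue)"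
      by (subst nn_integral_restrict_space) (auto intro!: nn_integral_cong simp: indicator_def f_def)
    finally show ?thesis using r by (simp add: ball_avg_def power_divide)
  qed
  define CP where "CP = real DIM('a) * 4 * 4 ^ DIM('a) * 4 ^ DIM('a) / (exp (- 4 / 3) * unit_ball_vol (real DIM('a)))"
  obtain c where c: "AE x in lebesgue_on (ball z r). u x \<noteq> c \<longrightarrow> (\<exists>k. \<bar>u x - c\<bar> \<le> CP * r * (\<Sum>j<k. ball_avg f (2 * r / 2 ^ j) x / 2 ^ j))"
    using pointwise_potential[OF r wf(1,3,2)] unfolding CP_def ba by blast
  show thesis
  proof (rule that[of c])
    show "(\<integral>\<^sup>+x\<in>ball z r. ennreal (ph x (indicator (ball z r) x * (\<bar>u x - c\<bar> / r)) powr (1 + e)) \<partial>lebesgue) \<le> ennreal (potential_const * d * (d / r ^ DIM('a)) powr e)"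
      unfolding potential_const_def CP_def[symmetric]
    proof (rule potential_powr[where f = f])
      show "f \<in> borel_measurable lebesgue" using grad_modular(1) unfolding f_def[abs_def] .
      show "(\<integral>\<^sup>+x. ennreal (ph x (f x)) \<partial>lebesgue) \<le> ennreal d" using grad_modular(2) unfolding f_def .
      have "AE x in lebesgue. x \<in> ball z r \<longrightarrow> u x \<noteq> c \<longrightarrow> (\<exists>k. \<bar>u x - c\<bar> \<le> CP * r * (\<Sum>j<k. ball_avg f (2 * r / 2 ^ j) x / 2 ^ j))"
        using c by (subst (asm) AE_restrict_space_iff) auto
      then show "AE x in lebesgue. x \<in> ball z r \<longrightarrow> indicator (ball z r) x * (\<bar>u x - c\<bar> / r) \<noteq> 0 \<longrightarrow> (\<exists>k. indicator (ball z r) x * (\<bar>u x - c\<bar> / r) \<le> max 1 CP * (\<Sum>j<k. ball_avg f (2 * r / 2 ^ j) x / 2 ^ j))"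
      proof eventually_elim
        case (elim x)
        show ?case
        proof (intro impI)
          assume x: "x \<in> ball z r" "indicator (ball z r) x * (\<bar>u x - c\<bar> / r) \<noteq> 0"
          then have "u x \<noteq> c" by auto
          then obtain k where k: "\<bar>u x - c\<bar> \<le> CP * r * (\<Sum>j<k. ball_avg f (2 * r / 2 ^ j) x / 2 ^ j)" using elim x by blast
          have S: "0 \<le> (\<Sum>j<k. ball_avg f (2 * r / 2 ^ j) x / 2 ^ j)" using r by (intro sum_nonneg) (simp add: ball_avg_def)
          have "\<bar>u x - c\<bar> / r \<le> CP * (\<Sum>j<k. ball_avg f (2 * r / 2 ^ j) x / 2 ^ j)" using k r by (simp add: pos_divide_le_eq mult_ac)
          also have "\<dots> \<le> max 1 CP * (\<Sum>j<k. ball_avg f (2 * r / 2 ^ j) x / 2 ^ j)" using S by (intro mult_right_mono) auto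
          finally show "\<exists>k. indicator (ball z r) x * (\<bar>u x - c\<bar> / r) \<le> max 1 CP * (\<Sum>j<k. ball_avg f (2 * r / 2 ^ j) x / 2 ^ j)" using x by auto
        qed
      qed
    qed (use r d e be e2 in \<open>auto simp: f_def\<close>)
  qed
qed

lemma ph_triangle_powr:
  assumes "(\<integral>\<^sup>+x\<in>ball z r. ennreal (ph x (indicator (ball z r) x * (\<bar>u x - c\<bar> / r)) powr (1 + e)) \<partial>lebesgue) \<le> ennreal (A1 * d * (d / r ^ DIM('a)) powr e)"
    and "(\<integral>\<^sup>+x\<in>ball z r. ennreal (ph x (\<bar>c - c'\<bar> / r) powr (1 + e)) \<partial>lebesgue) \<le> ennreal (A2 * d * (d / r ^ DIM('a)) powr e)"
    and A: "0 \<le> A1" "0 \<le> A2"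
  shows "(\<integral>\<^sup>+x\<in>ball z r. ennreal (ph x (indicator (ball z r) x * (\<bar>u x - c'\<bar> / r)) powr (1 + e)) \<partial>lebesgue) \<le> ennreal (4 * 2 powr (2 * q) * (A1 + A2) * d * (d / r ^ DIM('a)) powr e)"
proof -
  have "(\<integral>\<^sup>+x\<in>ball z r. ennreal (ph x (indicator (ball z r) x * (\<bar>u x - c'\<bar> / r)) powr (1 + e)) \<partial>lebesgue) \<le>
    (\<integral>\<^sup>+x. ennreal (4 * 2 powr (2 * q)) * (ennreal (ph x (indicator (ball z r) x * (\<bar>u x - c\<bar> / r)) powr (1 + e)) * indicator (ball z r) x + ennreal (ph x (\<bar>c - c'\<bar> / r) powr (1 + e)) * indicator (ball z r) x) \<partial>lebesgue)"
  proof (intro nn_integral_mono)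
    fix x
    show "ennreal (ph x (indicator (ball z r) x * (\<bar>u x - c'\<bar> / r)) powr (1 + e)) * indicator (ball z r) x \<le> 
      ennreal (4 * 2 powr (2 * q)) * (ennreal (ph x (indicator (ball z r) x * (\<bar>u x - c\<bar> / r)) powr (1 + e)) * indicator (ball z r) x + ennreal (ph x (\<bar>c - c'\<bar> / r) powr (1 + e)) * indicator (ball z r) x)"
    proof (cases "x \<in> ball z r")
      case True
      have "ph x (\<bar>u x - c'\<bar> / r) powr (1 + e) \<le> ph x (\<bar>u x - c\<bar> / r + \<bar>c - c'\<bar> / r) powr (1 + e)"
        using r e by (intro powr_mono2 ph_mono) (auto simp: add_divide_distrib[symmetric] divide_right_mono)
      also have "\<dots> \<le> 4 * 2 powr (2 * q) * (ph x (\<bar>u x - c\<bar> / r) powr (1 + e) + ph x (\<bar>c - c'\<bar> / r) powr (1 + e))"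
        using r e by (intro ph_powr_add) auto
      finally have "ennreal (ph x (\<bar>u x - c'\<bar> / r) powr (1 + e)) \<le> ennreal (4 * 2 powr (2 * q) * (ph x (\<bar>u x - c\<bar> / r) powr (1 + e) + ph x (\<bar>c - c'\<bar> / r) powr (1 + e)))"
        by (rule ennreal_leI)
      then show ?thesis using True by (simp add: ennreal_mult')
    qed simp
  qed
  also have "\<dots> = ennreal (4 * 2 powr (2 * q)) * ((\<integral>\<^sup>+x\<in>ball z r. ennreal (ph x (indicator (ball z r) x * (\<bar>u x - c\<bar> / r)) powr (1 + e)) \<partial>lebesgue) + (\<integral>\<^sup>+x\<in>ball z r. ennreal (ph x (\<bar>c - c'\<bar> / r) powr (1 + e)) \<partial>lebesgue))"
  proof -
    have [measurable]: "ball z r \<in> sets lebesgue" by simp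
    have gen: "(\<lambda>x. ennreal (F x powr (1 + e)) * indicator (ball z r) x) \<in> borel_measurable lebesgue" 
      if [measurable]: "F \<in> borel_measurable lebesgue" for F :: "'a \<Rightarrow> real" by measurable
    note m1 = gen[OF ph_meas[OF diff_measurable[of c]]] and m2 = gen[OF ph_meas[OF borel_measurable_const[of "\<bar>c - c'\<bar> / r"]]]
    show ?thesis by (simp only: nn_integral_cmult[OF borel_measurable_add[OF m1 m2]] nn_integral_add[OF m1 m2])
  qed
  also have "\<dots> \<le> ennreal (4 * 2 powr (2 * q)) * (ennreal (A1 * d * (d / r ^ DIM('a)) powr e) + ennreal (A2 * d * (d / r ^ DIM('a)) powr e))"
    by (intro mult_left_mono add_mono assms) auto
  also have "\<dots> = ennreal (4 * 2 powr (2 * q) * (A1 * d * (d / r ^ DIM('a)) powr e + A2 * d * (d / r ^ DIM('a)) powr e))"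
  proof -
    have p: "ennreal (A1 * d * (d / r ^ DIM('a)) powr e) + ennreal (A2 * d * (d / r ^ DIM('a)) powr e) = 
      ennreal (A1 * d * (d / r ^ DIM('a)) powr e + A2 * d * (d / r ^ DIM('a)) powr e)"
      using A d by (intro ennreal_plus[symmetric]) auto
    show ?thesis unfolding p by (rule ennreal_mult'[symmetric]) simp
  qed
  finally show ?thesis by (simp add: algebra_simps)
qed

text \<open>The constant c of the potential bound is unspecified, but its distance to the mean is at
  most the mean of |u - c|. The averaging bound is therefore applied to a multiple of |u - c|/r,
  whose modular is recovered from the (1+e)-power bound by Jensen's inequality.\<close>

lemma mean_oscillation_powr:
  "(\<integral>\<^sup>+x\<in>ball z r. ennreal (ph x (indicator (ball z r) x * (\<bar>u x - avg (ball z r) u\<bar> / r)) powr (1 + e)) \<partial>lebesgue) \<le> ennreal (oscillation_const * d * (d / r ^ DIM('a)) powr e)"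
proof -
  obtain c where c: "(\<integral>\<^sup>+x\<in>ball z r. ennreal (ph x (indicator (ball z r) x * (\<bar>u x - c\<bar> / r)) powr (1 + e)) \<partial>lebesgue) \<le> ennreal (potential_const * d * (d / r ^ DIM('a)) powr e)"
    by (rule oscillation_powr)
  define g where "g x = indicator (ball z r) x * (\<bar>u x - c\<bar> / r)" for x
  have gm[measurable]: "g \<in> borel_measurable lebesgue" unfolding g_def[abs_def] by (rule diff_measurable)
  have [measurable]: "ball z r \<in> sets lebesgue" by simp
  have g0: "0 \<le> g x" for x using r by (simp add: g_def)
  have VL: "emeasure (lebesgue_on (ball z r)) (space (lebesgue_on (ball z r))) = ennreal (unit_ball_vol (real DIM('a)) * r ^ DIM('a))"
    using ball_measure(2) by (simp add: emeasure_restrict_space)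
  have phL: "(\<lambda>x. ph x (g x)) \<in> borel_measurable (lebesgue_on (ball z r))" by (intro measurable_restrict_space1) measurable
  have cL: "(\<integral>\<^sup>+x. ennreal (ph x (g x) powr (1 + e)) \<partial>lebesgue_on (ball z r)) \<le> ennreal (potential_const * d * (d / r ^ DIM('a)) powr e)"
    using c by (subst nn_integral_restrict_space) (auto simp: g_def)
  have e1: "1 \<le> 1 + e" using e by simp
  have "(\<integral>\<^sup>+x. ennreal (ph x (g x)) \<partial>lebesgue_on (ball z r)) < \<infinity>"
    by (rule nn_integral_finite_of_powr[OF phL _ e1 VL]) (use cL in \<open>auto intro: le_less_trans\<close>)
  then obtain i where i: "(\<integral>\<^sup>+x. ennreal (ph x (g x)) \<partial>lebesgue_on (ball z r)) = ennreal i" "0 \<le> i"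
    by (cases "\<integral>\<^sup>+x. ennreal (ph x (g x)) \<partial>lebesgue_on (ball z r)") auto
  have dr: "0 < d / r ^ DIM('a)" using d r by simp
  have "ennreal ((i / (unit_ball_vol (real DIM('a)) * r ^ DIM('a))) powr (1 + e) * (unit_ball_vol (real DIM('a)) * r ^ DIM('a))) \<le> (\<integral>\<^sup>+x. ennreal (ph x (g x) powr (1 + e)) \<partial>lebesgue_on (ball z r))"
    by (rule nn_integral_powr_jensen[OF phL _ e1 VL ball_measure(3) i]) simp
  also note cL
  finally have "(i / (unit_ball_vol (real DIM('a)) * r ^ DIM('a))) powr (1 + e) * (unit_ball_vol (real DIM('a)) * r ^ DIM('a)) \<le> potential_const * d * (d / r ^ DIM('a)) powr e"
    using const_bounds d by (subst (asm) ennreal_le_iff) auto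
  then have "(i / (unit_ball_vol (real DIM('a)) * r ^ DIM('a))) powr (1 + e) \<le> potential_const * d * (d / r ^ DIM('a)) powr e / (unit_ball_vol (real DIM('a)) * r ^ DIM('a))"
    using ball_measure(3) by (simp add: pos_le_divide_eq)
  also have "\<dots> = potential_const / unit_ball_vol (real DIM('a)) * (d / r ^ DIM('a)) powr (1 + e)" using dr r d by (simp add: powr_add)
  \<comment> \<open>A number at least 1 is bounded by its own (1+e)-th power. The whole right-hand
    side thus becomes a (1+e)-th power, and the root can be taken.\<close>
  also have "\<dots> \<le> (max 1 (potential_const / unit_ball_vol (real DIM('a)))) powr (1 + e) * (d / r ^ DIM('a)) powr (1 + e)"
  proof (rule mult_right_mono)
    have "max 1 (potential_const / unit_ball_vol (real DIM('a))) powr 1 \<le> max 1 (potential_const / unit_ball_vol (real DIM('a))) powr (1 + e)" using e by (intro powr_mono) auto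
    then show "potential_const / unit_ball_vol (real DIM('a)) \<le> (max 1 (potential_const / unit_ball_vol (real DIM('a)))) powr (1 + e)" by simp
  qed simp
  also have "\<dots> = (max 1 (potential_const / unit_ball_vol (real DIM('a))) * (d / r ^ DIM('a))) powr (1 + e)" by (rule powr_mult[symmetric])
  finally have pw: "(i / (unit_ball_vol (real DIM('a)) * r ^ DIM('a))) powr (1 + e) \<le> (max 1 (potential_const / unit_ball_vol (real DIM('a))) * (d / r ^ DIM('a))) powr (1 + e)" .
  have "i / (unit_ball_vol (real DIM('a)) * r ^ DIM('a)) \<le> max 1 (potential_const / unit_ball_vol (real DIM('a))) * (d / r ^ DIM('a))"
  proof (rule ccontr)
    assume "\<not> ?thesis"
    then have "(max 1 (potential_const / unit_ball_vol (real DIM('a))) * (d / r ^ DIM('a))) powr (1 + e) < (i / (unit_ball_vol (real DIM('a)) * r ^ DIM('a))) powr (1 + e)"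
    proof (intro powr_less_mono2)
      show "0 \<le> max 1 (potential_const / unit_ball_vol (real DIM('a))) * (d / r ^ DIM('a))"
        by (rule mult_nonneg_nonneg) (use dr in \<open>auto simp: le_max_iff_disj\<close>)
    qed (use e in auto)
    then show False using pw by linarith
  qed
  then have "i \<le> unit_ball_vol (real DIM('a)) * max 1 (potential_const / unit_ball_vol (real DIM('a))) * d" using ball_measure(3) r by (simp add: field_simps)
  also have "\<dots> \<le> mean_const * d" using d unfolding mean_const_def by (intro mult_right_mono) auto
  finally have iK: "i / mean_const \<le> d" using const_bounds(3) by (simp add: pos_divide_le_eq mult.commute)
  \<comment> \<open>Shrinking by \<open>mean_const\<close> brings the modular down to d, as
    \<open>constant_powr\<close> requires.\<close>
  define f where "f x = 1 / mean_const * g x" for x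
  have fm[measurable]: "f \<in> borel_measurable lebesgue" unfolding f_def[abs_def] by measurable
  have f0: "0 \<le> f x" for x using g0 const_bounds by (simp add: f_def)
  have "(\<integral>\<^sup>+x\<in>ball z r. ennreal (ph x (f x)) \<partial>lebesgue) \<le> (\<integral>\<^sup>+x. ennreal (1 / mean_const) * (ennreal (ph x (g x)) * indicator (ball z r) x) \<partial>lebesgue)"
  proof (intro nn_integral_mono)
    fix x
    have "ph x (f x) \<le> 1 / mean_const * ph x (g x)" unfolding f_def using g0 const_bounds by (intro ph_scale_down) auto
    then have "ennreal (ph x (f x)) \<le> ennreal (1 / mean_const * ph x (g x))" by (rule ennreal_leI)
    also have "\<dots> = ennreal (1 / mean_const) * ennreal (ph x (g x))" using const_bounds by (intro ennreal_mult') simp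
    finally show "ennreal (ph x (f x)) * indicator (ball z r) x \<le> ennreal (1 / mean_const) * (ennreal (ph x (g x)) * indicator (ball z r) x)" 
      by (auto simp: indicator_def)
  qed
  also have "\<dots> = ennreal (1 / mean_const) * (\<integral>\<^sup>+x\<in>ball z r. ennreal (ph x (g x)) \<partial>lebesgue)" by (intro nn_integral_cmult) measurable
  also have "(\<integral>\<^sup>+x\<in>ball z r. ennreal (ph x (g x)) \<partial>lebesgue) = ennreal i" using i(1) by (subst (asm) nn_integral_restrict_space) auto
  also have "ennreal (1 / mean_const) * ennreal i = ennreal (i / mean_const)" using const_bounds by (simp add: ennreal_mult'[symmetric])
  also have "\<dots> \<le> ennreal d" using iK by (rule ennreal_leI)
  finally have fle: "(\<integral>\<^sup>+x\<in>ball z r. ennreal (ph x (f x)) \<partial>lebesgue) \<le> ennreal d" .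
  have ui: "integrable (lebesgue_on (ball z r)) u" using W11_facts(1)[OF u] .
  have "avg (ball z r) u - c = (LINT x|lebesgue_on (ball z r). u x - c) / measure lebesgue (ball z r)"
  proof -
    have nz: "measure lebesgue (ball z r) \<noteq> 0" using ball_measure(3) unfolding ball_measure(1) by (rule less_imp_neq[symmetric])
    have "(LINT x|lebesgue_on (ball z r). u x - c) = (LINT x|lebesgue_on (ball z r). u x) - c * measure lebesgue (ball z r)"
      using ui by (simp add: measure_restrict_space)
    then show ?thesis unfolding avg_def using nz by (simp add: diff_divide_distrib)
  qed
  then have "\<bar>avg (ball z r) u - c\<bar> \<le> (LINT x|lebesgue_on (ball z r). \<bar>u x - c\<bar>) / measure lebesgue (ball z r)"
    using ball_measure integral_abs_bound[of "lebesgue_on (ball z r)" "\<lambda>x. u x - c"] by (simp add: divide_right_mono)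
  also have "(LINT x|lebesgue_on (ball z r). \<bar>u x - c\<bar>) = (LINT x|lebesgue_on (ball z r). (mean_const * r) * f x)"
    using r const_bounds by (intro Bochner_Integration.integral_cong) (auto simp: f_def g_def)
  also have "\<dots> = mean_const * r * enn2real (\<integral>\<^sup>+x\<in>ball z r. ennreal (f x) \<partial>lebesgue)"
  proof -
    have "(LINT x|lebesgue_on (ball z r). f x) = enn2real (\<integral>\<^sup>+x. ennreal (f x) \<partial>lebesgue_on (ball z r))"
      using f0 by (intro integral_eq_nn_integral measurable_restrict_space1) auto
    then show ?thesis by (simp add: nn_integral_restrict_space)
  qed
  finally have "\<bar>c - avg (ball z r) u\<bar> / r \<le> mean_const * enn2real (\<integral>\<^sup>+x\<in>ball z r. ennreal (f x) \<partial>lebesgue) / (unit_ball_vol (real DIM('a)) * r ^ DIM('a))"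
    using r ball_measure by (simp add: field_simps abs_minus_commute)
  also have "\<dots> = (mean_const * (2 ^ DIM('a) / unit_ball_vol (real DIM('a)))) * (enn2real (\<integral>\<^sup>+x\<in>ball z r. ennreal (f x) \<partial>lebesgue) / (2 * r) ^ DIM('a))"
    using r V_pos by (simp add: field_simps)
  also have "\<dots> \<le> (mean_const * volume_ratio) * (enn2real (\<integral>\<^sup>+x\<in>ball z r. ennreal (f x) \<partial>lebesgue) / (2 * r) ^ DIM('a))"
    using r const_bounds by (intro mult_right_mono mult_left_mono) (auto simp: volume_ratio_def)
  finally have t: "\<bar>c - avg (ball z r) u\<bar> / r \<le> (mean_const * volume_ratio) * (enn2real (\<integral>\<^sup>+x\<in>ball z r. ennreal (f x) \<partial>lebesgue) / (2 * r) ^ DIM('a))" .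
  have K21: "1 \<le> mean_const * volume_ratio" using mult_mono[of 1 mean_const 1 volume_ratio] const_bounds by simp
  have "(\<integral>\<^sup>+x\<in>ball z r. ennreal (ph x (\<bar>c - avg (ball z r) u\<bar> / r) powr (1 + e)) \<partial>lebesgue) \<le> ennreal ((mean_const * volume_ratio) powr (2 * q) * avg_powr_const * d * (d / r ^ DIM('a)) powr e)"
    by (rule constant_powr[OF r fm f0 d fle K21 _ t]) (use r in simp)
  from ph_triangle_powr[OF c this] show ?thesis
    using const_bounds avg_powr_const_pos unfolding oscillation_const_def by simp
qed

text \<open>The oscillation around the mean is already controlled. For zero boundary values the mean
  divided by r is at most a multiple of the mean of |grad u|, so \<open>constant_powr\<close>
  handles it with f = |grad u|.\<close>

lemma zero_trace_powr:
  assumes u0: "u \<in> W11_0 (ball z r)"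
  shows "(\<integral>\<^sup>+x\<in>ball z r. ennreal (ph x (indicator (ball z r) x * (\<bar>u x\<bar> / r)) powr (1 + e)) \<partial>lebesgue) \<le> ennreal (zero_trace_const * d * (d / r ^ DIM('a)) powr e)"
proof -
  define f where "f x = indicator (ball z r) x * norm (weak_grad (ball z r) u x)" for x
  have "\<bar>avg (ball z r) u\<bar> = \<bar>LINT x|lebesgue_on (ball z r). u x\<bar> / (unit_ball_vol (real DIM('a)) * r ^ DIM('a))" using ball_measure by (simp add: avg_def)
  also have "\<dots> \<le> r * (LINT x|lebesgue_on (ball z r). norm (weak_grad (ball z r) u x)) / (unit_ball_vol (real DIM('a)) * r ^ DIM('a))"
    using W11_0_integral_bound[OF r u0] ball_measure(3) by (intro divide_right_mono) auto
  also have "(LINT x|lebesgue_on (ball z r). norm (weak_grad (ball z r) u x)) = enn2real (\<integral>\<^sup>+x\<in>ball z r. ennreal (f x) \<partial>lebesgue)" unfolding f_def by (rule integral_norm_grad)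
  finally have "\<bar>avg (ball z r) u - 0\<bar> / r \<le> enn2real (\<integral>\<^sup>+x\<in>ball z r. ennreal (f x) \<partial>lebesgue) / (unit_ball_vol (real DIM('a)) * r ^ DIM('a))"
    using r ball_measure by (simp add: field_simps)
  also have "\<dots> = (2 ^ DIM('a) / unit_ball_vol (real DIM('a))) * (enn2real (\<integral>\<^sup>+x\<in>ball z r. ennreal (f x) \<partial>lebesgue) / (2 * r) ^ DIM('a))"
    using r V_pos by (simp add: field_simps)
  also have "\<dots> \<le> volume_ratio * (enn2real (\<integral>\<^sup>+x\<in>ball z r. ennreal (f x) \<partial>lebesgue) / (2 * r) ^ DIM('a))"
    using r by (intro mult_right_mono) (auto simp: volume_ratio_def)
  finally have t: "\<bar>avg (ball z r) u - 0\<bar> / r \<le> volume_ratio * (enn2real (\<integral>\<^sup>+x\<in>ball z r. ennreal (f x) \<partial>lebesgue) / (2 * r) ^ DIM('a))" .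
  have "(\<integral>\<^sup>+x\<in>ball z r. ennreal (ph x (\<bar>avg (ball z r) u - 0\<bar> / r) powr (1 + e)) \<partial>lebesgue) \<le> ennreal (volume_ratio powr (2 * q) * avg_powr_const * d * (d / r ^ DIM('a)) powr e)"
    by (rule constant_powr[where f = f, OF r _ _ d _ const_bounds(2) _ t]) (use r grad_modular in \<open>auto simp: f_def[abs_def]\<close>)
  from ph_triangle_powr[OF mean_oscillation_powr this] show ?thesis
    using const_bounds avg_powr_const_pos unfolding zero_trace_const_def by simp
qed

end

text \<open>The exponents match: K m (m / r^n)^e over the volume V r^n is K/V (m / r^n)^(1+e), whose
  root is linear in m / r^n. Assuming the bound for all positive d >= m includes m = 0, where
  letting d tend to 0 shows that the integral vanishes.\<close>

lemma average_of_powr_bound: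
  fixes h :: "'a \<Rightarrow> real"
  assumes r: "0 < r" and h: "\<And>x. 0 \<le> h x" and K: "0 < K" and m: "0 \<le> m" "m \<le> 1"
    and le: "\<And>d. 0 < d \<Longrightarrow> d \<le> 1 \<Longrightarrow> m \<le> d \<Longrightarrow> 
      (\<integral>\<^sup>+x. ennreal (h x powr (1 + e)) \<partial>lebesgue_on (ball z r)) \<le> ennreal (K * d * (d / r ^ DIM('a)) powr e)"
  shows "ennpowr (nn_avg (ball z r) (\<lambda>x. ennpowr (ennreal (h x)) (1 + e))) (1 / (1 + e)) 
     \<le> ennreal ((K / unit_ball_vol (real DIM('a))) powr (1 / (1 + e)) * unit_ball_vol (real DIM('a))) * (ennreal m / emeasure lebesgue (ball z r))"
proof -
  let ?V = "unit_ball_vol (real DIM('a))" and ?I = "\<integral>\<^sup>+x. ennreal (h x powr (1 + e)) \<partial>lebesgue_on (ball z r)"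
  have V: "0 < ?V" by simp
  have rn: "0 < r ^ DIM('a)" using r by simp
  have mB: "emeasure lebesgue (ball z r) = ennreal (?V * r ^ DIM('a))" using r by (simp add: emeasure_ball)
  have "?I \<le> ennreal (K * m * (m / r ^ DIM('a)) powr e)"
  proof (cases "m = 0")
    case False
    then show ?thesis using m by (intro le) auto
  next
    case True
    define c where "c = K * (1 / r ^ DIM('a)) powr e"
    have c: "0 < c" unfolding c_def using K r by (intro mult_pos_pos) auto
    have "?I \<le> 0 + ennreal \<eta>" if \<eta>: "0 < \<eta>" for \<eta>
    proof -
      define d where "d = min 1 (\<eta> / c)"
      have d: "0 < d" "d \<le> 1" using \<eta> c by (auto simp: d_def)
      have "?I \<le> ennreal (K * d * (d / r ^ DIM('a)) powr e)" using d True by (intro le) auto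
      also have "\<dots> \<le> ennreal (K * d * (1 / r ^ DIM('a)) powr e)"
        using d K e rn by (intro ennreal_leI mult_left_mono powr_mono2 divide_right_mono) auto
      also have "K * d * (1 / r ^ DIM('a)) powr e = c * d" by (simp add: c_def)
      also have "ennreal (c * d) \<le> ennreal (c * (\<eta> / c))" using c by (intro ennreal_leI mult_left_mono) (auto simp: d_def)
      also have "c * (\<eta> / c) = \<eta>" using c by simp
      finally show ?thesis by simp
    qed
    then have "?I \<le> 0" by (rule ennreal_le_epsilon)
    then show ?thesis by simp
  qed
  then have "?I / ennreal (?V * r ^ DIM('a)) \<le> ennreal (K * m * (m / r ^ DIM('a)) powr e) / ennreal (?V * r ^ DIM('a))"
    by (rule divide_right_mono_ennreal)
  also have "\<dots> = ennreal (K * m * (m / r ^ DIM('a)) powr e / (?V * r ^ DIM('a)))"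
    using K m rn by (intro divide_ennreal) auto
  also have "K * m * (m / r ^ DIM('a)) powr e / (?V * r ^ DIM('a)) = K / ?V * (m / r ^ DIM('a)) powr (1 + e)"
    using m rn V by (cases "m = 0") (auto simp: powr_add)
  finally have I: "?I / ennreal (?V * r ^ DIM('a)) \<le> ennreal (K / ?V * (m / r ^ DIM('a)) powr (1 + e))" .
  have "ennpowr (nn_avg (ball z r) (\<lambda>x. ennpowr (ennreal (h x)) (1 + e))) (1 / (1 + e)) 
      \<le> ennpowr (ennreal (K / ?V * (m / r ^ DIM('a)) powr (1 + e))) (1 / (1 + e))"
    using e I by (intro ennpowr_mono) (auto simp: nn_avg_def mB ennpowr_ennreal[OF h] simp del: emeasure_completion)
  also have "\<dots> = ennreal ((K / ?V) powr (1 / (1 + e)) * (m / r ^ DIM('a)))"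
  proof -
    have "(K / ?V * x powr (1 + e)) powr (1 / (1 + e)) = (K / ?V) powr (1 / (1 + e)) * x" if "0 \<le> x" for x
      unfolding powr_mult powr_powr using e that by simp
    then show ?thesis using K V m rn by (subst ennpowr_ennreal) auto
  qed
  also have "\<dots> = ennreal ((K / ?V) powr (1 / (1 + e)) * ?V * (m / (?V * r ^ DIM('a))))"
    using V by simp
  also have "\<dots> = ennreal ((K / ?V) powr (1 / (1 + e)) * ?V) * ennreal (m / (?V * r ^ DIM('a)))"
    using V by (intro ennreal_mult') simp
  also have "ennreal (m / (?V * r ^ DIM('a))) = ennreal m / emeasure lebesgue (ball z r)"
    unfolding mB using m V rn by (intro divide_ennreal[symmetric]) auto
  finally show ?thesis .
qed

text \<open>A free constant c treats the mean and the zero boundary value together, and the sum of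
  the two constants serves either case.\<close>

lemma sobolev_poincare:
  fixes z :: 'a
  assumes r: "0 < r" and u: "u \<in> W11 (ball z r)"
    and le: "(\<integral>\<^sup>+x. ennreal (ph x (norm (weak_grad (ball z r) u x))) \<partial>lebesgue_on (ball z r)) \<le> 1"
  defines "C \<equiv> ((oscillation_const + zero_trace_const) / unit_ball_vol (real DIM('a))) powr (1 / (1 + e)) * unit_ball_vol (real DIM('a))"
  shows "nn_avg (ball z r) (\<lambda>x. ennreal (ph x (\<bar>u x - c\<bar> / r)))
      \<le> ennpowr (nn_avg (ball z r) (\<lambda>x. ennpowr (ennreal (ph x (\<bar>u x - c\<bar> / r))) (1 + e))) (1 / (1 + e))"
    "c = avg (ball z r) u \<or> c = 0 \<and> u \<in> W11_0 (ball z r) \<Longrightarrow> 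
      ennpowr (nn_avg (ball z r) (\<lambda>x. ennpowr (ennreal (ph x (\<bar>u x - c\<bar> / r))) (1 + e))) (1 / (1 + e))
      \<le> ennreal C * nn_avg (ball z r) (\<lambda>x. ennreal (ph x (norm (weak_grad (ball z r) u x))))"
proof -
  let ?L = "lebesgue_on (ball z r)" and ?m = "\<integral>\<^sup>+x. ennreal (ph x (norm (weak_grad (ball z r) u x))) \<partial>lebesgue_on (ball z r)"
  have eq: "(\<integral>\<^sup>+x. ennreal (ph x (\<bar>u x - c\<bar> / r) powr (1 + e)) \<partial>?L) 
     = (\<integral>\<^sup>+x\<in>ball z r. ennreal (ph x (indicator (ball z r) x * (\<bar>u x - c\<bar> / r)) powr (1 + e)) \<partial>lebesgue)" for c
    by (subst nn_integral_restrict_space) (auto intro!: nn_integral_cong simp: indicator_def)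
  have m: "(\<lambda>x. ph x (\<bar>u x - c\<bar> / r)) \<in> borel_measurable ?L"
  proof -
    have "(\<lambda>x. ph x (indicator (ball z r) x * (\<bar>u x - c\<bar> / r))) \<in> borel_measurable ?L"
      by (rule measurable_restrict_space1[OF ph_meas[OF W11_diff_measurable[OF u]]])
    then show ?thesis by (rule measurable_cong[THEN iffD1, rotated]) simp
  qed
  have mB: "emeasure lebesgue (ball z r) = ennreal (unit_ball_vol (real DIM('a)) * r ^ DIM('a))" "0 < unit_ball_vol (real DIM('a)) * r ^ DIM('a)"
    using r by (auto simp: emeasure_ball)
  show "nn_avg (ball z r) (\<lambda>x. ennreal (ph x (\<bar>u x - c\<bar> / r)))
      \<le> ennpowr (nn_avg (ball z r) (\<lambda>x. ennpowr (ennreal (ph x (\<bar>u x - c\<bar> / r))) (1 + e))) (1 / (1 + e))"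
    using e by (intro nn_avg_power_mean[OF m _ _ _ mB]) auto
  assume c: "c = avg (ball z r) u \<or> c = 0 \<and> u \<in> W11_0 (ball z r)"
  obtain m where m: "?m = ennreal m" "0 \<le> m" using le by (cases ?m) (auto simp: top_unique)
  then have m1: "m \<le> 1" using le by simp
  have bound: "(\<integral>\<^sup>+x. ennreal (ph x (\<bar>u x - c\<bar> / r) powr (1 + e)) \<partial>?L) \<le> ennreal ((oscillation_const + zero_trace_const) * d * (d / r ^ DIM('a)) powr e)"
    if d: "0 < d" "d \<le> 1" "m \<le> d" for d
  proof -
    have dl: "?m \<le> ennreal d" using m d by (simp add: ennreal_leI)
    have "(\<integral>\<^sup>+x. ennreal (ph x (\<bar>u x - c\<bar> / r) powr (1 + e)) \<partial>?L) \<le> ennreal (oscillation_const * d * (d / r ^ DIM('a)) powr e)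
       \<or> (\<integral>\<^sup>+x. ennreal (ph x (\<bar>u x - c\<bar> / r) powr (1 + e)) \<partial>?L) \<le> ennreal (zero_trace_const * d * (d / r ^ DIM('a)) powr e)"
      using c mean_oscillation_powr[OF r u d(1,2) dl] zero_trace_powr[OF r u d(1,2) dl] unfolding eq by auto
    moreover have "ennreal (oscillation_const * d * (d / r ^ DIM('a)) powr e) \<le> ennreal ((oscillation_const + zero_trace_const) * d * (d / r ^ DIM('a)) powr e)"
      "ennreal (zero_trace_const * d * (d / r ^ DIM('a)) powr e) \<le> ennreal ((oscillation_const + zero_trace_const) * d * (d / r ^ DIM('a)) powr e)"
      using const_bounds(4,5) d by (auto intro!: ennreal_leI mult_right_mono)
    ultimately show ?thesis by (meson order_trans)
  qed
  have "ennpowr (nn_avg (ball z r) (\<lambda>x. ennpowr (ennreal (ph x (\<bar>u x - c\<bar> / r))) (1 + e))) (1 / (1 + e))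
      \<le> ennreal C * (ennreal m / emeasure lebesgue (ball z r))"
    unfolding C_def using const_bounds(4,5) by (intro average_of_powr_bound[OF r _ _ m(2) m1 bound]) auto
  also have "ennreal m / emeasure lebesgue (ball z r) = nn_avg (ball z r) (\<lambda>x. ennreal (ph x (norm (weak_grad (ball z r) u x))))"
    unfolding nn_avg_def m(1) ..
  finally show "ennpowr (nn_avg (ball z r) (\<lambda>x. ennpowr (ennreal (ph x (\<bar>u x - c\<bar> / r))) (1 + e))) (1 / (1 + e))
      \<le> ennreal C * nn_avg (ball z r) (\<lambda>x. ennreal (ph x (norm (weak_grad (ball z r) u x))))" .
qed

end

lemma sobolev_poincare_constants:
  obtains s C :: real where "1 < s" "0 < C"
    "\<And>z r u c. 0 < r \<Longrightarrow> u \<in> W11 (ball z r) \<Longrightarrow>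
      (\<integral>\<^sup>+x. ennreal (ph x (norm (weak_grad (ball z r) u x))) \<partial>lebesgue_on (ball z r)) \<le> 1 \<Longrightarrow>
      c = avg (ball z r) u \<or> c = 0 \<and> u \<in> W11_0 (ball z r) \<Longrightarrow>
      nn_avg (ball z r) (\<lambda>x. ennreal (ph x (\<bar>u x - c\<bar> / r)))
        \<le> ennpowr (nn_avg (ball z r) (\<lambda>x. ennpowr (ennreal (ph x (\<bar>u x - c\<bar> / r))) s)) (1 / s) \<and>
      ennpowr (nn_avg (ball z r) (\<lambda>x. ennpowr (ennreal (ph x (\<bar>u x - c\<bar> / r))) s)) (1 / s)
        \<le> ennreal C * nn_avg (ball z r) (\<lambda>x. ennreal (ph x (norm (weak_grad (ball z r) u x))))"
proof -
  obtain e where e: "0 < e" "e \<le> 1" "(4 / ainf_const) * (2 * 2 ^ DIM('a)) powr e * (1 - ainf_const) + 2 powr e \<le> 4 / ainf_const"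
    "2 powr (real DIM('a) * e) \<le> 7 / 6" by (rule exponent_exists)
  note sp = sobolev_poincare[OF e]
  define C where "C = ((oscillation_const + zero_trace_const) / unit_ball_vol (real DIM('a))) powr (1 / (1 + e)) * unit_ball_vol (real DIM('a))"
  have "0 < oscillation_const + zero_trace_const" using const_bounds(4,5) by simp
  then have "0 < (oscillation_const + zero_trace_const) / unit_ball_vol (real DIM('a))" by simp
  then have "0 < C" unfolding C_def by (intro mult_pos_pos) auto
  then show thesis using e sp by (intro that[of "1 + e" C]) (auto simp: C_def)
qed

end

theorem theorem2p23:
  fixes p q :: real and a :: "'a::euclidean_space \<Rightarrow> real"
    and \<phi> :: "'a \<Rightarrow> real \<Rightarrow> ennreal"
  assumes "1 < p" and "p < q"
    and "a \<in> borel_measurable lebesgue" and "\<And>x. 0 \<le> a x"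
    and "\<phi> = double_phase p q a"
    and "\<phi> \<in> class_A"
  shows "\<exists>s C :: real. s > 1 \<and> C > 0 \<and>
    (\<forall>(z::'a) (r::real) (u::'a \<Rightarrow> real). \<forall>B. r > 0 \<longrightarrow> B = ball z r \<longrightarrow> u \<in> W11 B \<longrightarrow>
       (\<integral>\<^sup>+x. \<phi> x (norm (weak_grad B u x)) \<partial>lebesgue_on B) \<le> 1 \<longrightarrow>
       (nn_avg B (\<lambda>x. \<phi> x (\<bar>u x - avg B u\<bar> / r))
          \<le> ennpowr (nn_avg B (\<lambda>x. ennpowr (\<phi> x (\<bar>u x - avg B u\<bar> / r)) s)) (1 / s) \<and>
        ennpowr (nn_avg B (\<lambda>x. ennpowr (\<phi> x (\<bar>u x - avg B u\<bar> / r)) s)) (1 / s)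
          \<le> ennreal C * nn_avg B (\<lambda>x. \<phi> x (norm (weak_grad B u x)))) \<and>
       (u \<in> W11_0 B \<longrightarrow>
        nn_avg B (\<lambda>x. \<phi> x (\<bar>u x\<bar> / r))
          \<le> ennpowr (nn_avg B (\<lambda>x. ennpowr (\<phi> x (\<bar>u x\<bar> / r)) s)) (1 / s) \<and>
        ennpowr (nn_avg B (\<lambda>x. ennpowr (\<phi> x (\<bar>u x\<bar> / r)) s)) (1 / s)
          \<le> ennreal C * nn_avg B (\<lambda>x. \<phi> x (norm (weak_grad B u x)))))"
proof -
  interpret double_phase_A p q a using assms by unfold_locales auto
  have \<phi>: "\<phi> x t = ennreal (ph x t)" for x t by (simp add: assms(5) double_phase_ph)
  obtain s C where sC: "1 < s" "0 < C" and
    *: "\<And>z r u c. 0 < r \<Longrightarrow> u \<in> W11 (ball z r) \<Longrightarrow>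
      (\<integral>\<^sup>+x. ennreal (ph x (norm (weak_grad (ball z r) u x))) \<partial>lebesgue_on (ball z r)) \<le> 1 \<Longrightarrow>
      c = avg (ball z r) u \<or> c = 0 \<and> u \<in> W11_0 (ball z r) \<Longrightarrow>
      nn_avg (ball z r) (\<lambda>x. ennreal (ph x (\<bar>u x - c\<bar> / r)))
        \<le> ennpowr (nn_avg (ball z r) (\<lambda>x. ennpowr (ennreal (ph x (\<bar>u x - c\<bar> / r))) s)) (1 / s) \<and>
      ennpowr (nn_avg (ball z r) (\<lambda>x. ennpowr (ennreal (ph x (\<bar>u x - c\<bar> / r))) s)) (1 / s)
        \<le> ennreal C * nn_avg (ball z r) (\<lambda>x. ennreal (ph x (norm (weak_grad (ball z r) u x))))"
    using sobolev_poincare_constants by blast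
  show ?thesis unfolding \<phi>
  proof (rule exI[of _ s], rule exI[of _ C], intro conjI allI impI sC)
    fix z :: 'a and r :: real and u :: "'a \<Rightarrow> real" and B :: "'a set"
    assume B: "r > 0" "B = ball z r" "u \<in> W11 B" "(\<integral>\<^sup>+x. ennreal (ph x (norm (weak_grad B u x))) \<partial>lebesgue_on B) \<le> 1"
    note H = *[OF B(1) B(3)[unfolded B(2)] B(4)[unfolded B(2)]]
    show "nn_avg B (\<lambda>x. ennreal (ph x (\<bar>u x - avg B u\<bar> / r)))
          \<le> ennpowr (nn_avg B (\<lambda>x. ennpowr (ennreal (ph x (\<bar>u x - avg B u\<bar> / r))) s)) (1 / s)"
      "ennpowr (nn_avg B (\<lambda>x. ennpowr (ennreal (ph x (\<bar>u x - avg B u\<bar> / r))) s)) (1 / s)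
          \<le> ennreal C * nn_avg B (\<lambda>x. ennreal (ph x (norm (weak_grad B u x))))"
      using H[of "avg B u"] unfolding B(2) by auto
    assume "u \<in> W11_0 B"
    then show "nn_avg B (\<lambda>x. ennreal (ph x (\<bar>u x\<bar> / r)))
          \<le> ennpowr (nn_avg B (\<lambda>x. ennpowr (ennreal (ph x (\<bar>u x\<bar> / r))) s)) (1 / s)"
      "ennpowr (nn_avg B (\<lambda>x. ennpowr (ennreal (ph x (\<bar>u x\<bar> / r))) s)) (1 / s)
          \<le> ennreal C * nn_avg B (\<lambda>x. ennreal (ph x (norm (weak_grad B u x))))"
      using H[of 0] unfolding B(2) by auto
  qed
qed

end
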